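(* Let $\mathcal T\in\mathrm{Tree}(N)$. For $j\in[N]\cap\mathcal T$ (i.e. each $j\in[N]$ such that the one-letter string $j$ belongs to $\mathcal T$), let \[ \mathcal T_j=\{s\in\mathcal T_{N,\mathrm{free}}: sj\in\mathcal T\}, \] that is, $\mathcal T_j$ is the branch of $\mathcal T$ rooted at the vertex $j$. Then for all $\mathcal B$-valued laws $\mu_1,\dots,\mu_N$, \[ \boxplus_{\mathcal T}(\mu_1,\dots,\mu_N)=\biguplus_{j\in[N]\cap\mathcal T}\bigl[\mu_j\vdash\boxplus_{\mathcal T_j}(\mu_1,\dots,\mu_N)\bigr]. \]
   Context: $\mathcal B$ is a unital $C^*$-algebra. For a right Hilbert $\mathcal B$-module $\mathcal H$, $\mathcal L(\mathcal H)$ is the $C^*$-algebra of bounded adjointable right-$\mathcal B$-modular operators. A $\mathcal B$-$\mathcal B$-correspondence is a right Hilbert $\mathcal B$-module with a left action given by a unital $*$-homomorphism $\mathcal B\to\mathcal L(\mathcal H)$. A $\mathcal B$-central unit vector is $\xi\in\mathcal H$ with $\langle\xi,\xi\rangle=1$, $b\xi=\xi b$ for all $b\in\mathcal B$; then $\mathcal H=\mathcal B\xi\oplus\mathcal H^\circ$, $\mathcal H^\circ=\{h:\langle h,\xi\rangle=0\}$. Laws: $\mathcal B\langle X\rangle$ is the universal unital $*$-algebra generated by $\mathcal B$ and a self-adjoint indeterminate $X$. A $\mathcal B$-valued law is a unital $\mathcal B$-$\mathcal B$-bimodule map $\mu:\mathcal B\langle X\rangle\to\mathcal B$ that is completely positive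 ($\mu^{(m)}(P^*P)\ge0$ for $P\in M_m(\mathcal B\langle X\rangle)$) and exponentially bounded ($\|\mu(b_0Xb_1\cdots Xb_\ell)\|\le MR^\ell\|b_0\|\cdots\|b_\ell\|$ for some $M,R>0$). Trees: $[N]=\{1,\dots,N\}$. A string on $[N]$ is alternating if consecutive letters differ. $\mathcal T_{N,\mathrm{free}}$ is the graph whose vertices are the alternating strings on $[N]$ (including the empty string $\emptyset$), with an edge between $s$ and $js$ whenever $js$ is alternating, rooted at $\emptyset$. $\mathrm{Tree}(N)$ is the set of connected subgraphs containing $\emptyset$, each identified with its vertex set. $\mathcal T$-free convolution: given correspondences with $\mathcal B$-central unit vectors $(\mathcal H_j,\xi_j)$, $j\in[N]$, put $\mathcal H=\bigoplus_{s\in\mathcal T}\mathcal H_s^\circ$, $\mathcal H_\emptyset^\circ=\mathcal B$, $\mathcal H^\circ_{j_1\cdots j_m}=\mathcal H_{j_1}^\circ\otimes_{\mathcal B}\cdots\otimes_{\mathcal B}\mathcal H_{j_m}^\circ$, $\xi=1\in\mathcal H_\emptyset^\circ$. $\lambda_{\mathcal T,j}:\mathcal L(\mathcal H_j)\to\mathcal L(\mathcal H)$ is the $*$-homomorphism for which $\lambda_{\mathcal T,j}(x)$ acts on $\mathcal H_s^\circ\oplus\mathcal H_{js}^\circ\cong\mathcal H_j\otimes_{\mathcal B}\mathcal H_s^\circ$ as $x\otimes\mathrm{id}$ when $s\in\mathcal T$ does not begin with $j$ and $js\in\mathcal T$, and as zero on $\mathcal H_s^\circ$ when $s\in\mathcal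 T$ does not begin with $j$ and $js\notin\mathcal T$. For laws $\mu_1,\dots,\mu_N$, let $\mathcal H_j=L^2(\mathcal B\langle X\rangle,\mu_j)$ (separation-completion for $\langle p,q\rangle=\mu_j(p^*q)$), $\xi_j$ the class of $1$, $X_j$ multiplication by $X$; then $\boxplus_{\mathcal T}(\mu_1,\dots,\mu_N)$ is the law of $\sum_{j=1}^N\lambda_{\mathcal T,j}(X_j)$ with respect to $a\mapsto\langle\xi,a\xi\rangle$. Boolean convolution $\mu_1\uplus\cdots\uplus\mu_n$ is $\boxplus_{\mathcal T}$ for $\mathcal T=\{\emptyset,1,\dots,n\}$ (it is commutative and associative; the empty Boolean convolution is the law $\delta_0$ of the zero operator). Orthogonal convolution $\mu\vdash\nu$ is $\boxplus_{\mathcal T}(\mu,\nu)$ for $\mathcal T=\{\emptyset,1,21\}\in\mathrm{Tree}(2)$. *)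

theory Defs
  imports "HOL-Analysis.Analysis"
begin

section \<open>Unital C*-algebras\<close>

class star =
  fixes star :: "'a \<Rightarrow> 'a"

text \<open>
  The norm axiom \<open>norm 1 = 1\<close> inherited from \<^class>\<open>real_normed_algebra_1\<close> is automatic in
  every nonzero unital C*-algebra.
\<close>

class cstar_algebra = real_normed_algebra_1 + banach + star +
  fixes scaleC :: "complex \<Rightarrow> 'a \<Rightarrow> 'a"
  assumes scaleC_add_right: "scaleC c (x + y) = scaleC c x + scaleC c y"
    and scaleC_add_left: "scaleC (c + d) x = scaleC c x + scaleC d x"
    and scaleC_scaleC: "scaleC c (scaleC d x) = scaleC (c * d) x"
    and scaleC_of_real: "scaleC (complex_of_real r) x = scaleR r x"
    and scaleC_mult_left: "scaleC c x * y = scaleC c (x * y)"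
    and scaleC_mult_right: "x * scaleC c y = scaleC c (x * y)"
    and norm_scaleC: "norm (scaleC c x) = cmod c * norm x"
    and star_add: "star (x + y) = star x + star y"
    and star_scaleC: "star (scaleC c x) = scaleC (cnj c) (star x)"
    and star_mult: "star (x * y) = star y * star x"
    and star_star: "star (star x) = x"
    and cstar_identity: "norm (star x * x) = (norm x)\<^sup>2"

instantiation complex :: cstar_algebra
begin

definition star_complex :: "complex \<Rightarrow> complex" where
  "star_complex = cnj"

definition scaleC_complex :: "complex \<Rightarrow> complex \<Rightarrow> complex" where
  "scaleC_complex = (*)"

instance
  by standard
    (auto simp: star_complex_def scaleC_complex_def algebra_simps scaleR_conv_of_real
      norm_mult power2_eq_square)

end

lemma star_one: "star (1::'b::cstar_algebra) = 1"
  by (metis mult_1_left mult_1_right star_mult star_star)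

text \<open>
  Positivity in \<open>M\<^sub>m(B)\<close>. A matrix is a function of which only the entries with indices below
  \<open>m\<close> are relevant; positive elements of a C*-algebra are those of the form \<open>C\<^sup>* C\<close>.
\<close>

definition mat_pos :: "nat \<Rightarrow> (nat \<Rightarrow> nat \<Rightarrow> 'b::cstar_algebra) \<Rightarrow> bool" where
  "mat_pos m A \<longleftrightarrow> (\<exists>C. \<forall>i<m. \<forall>j<m. A i j = (\<Sum>k<m. star (C k i) * C k j))"


section \<open>The algebra of noncommutative polynomials over \<open>B\<close>\<close>

text \<open>
  \<open>B\<langle>X\<rangle>\<close> is given by generators and relations: formal expressions in elements of \<open>B\<close> and \<open>X\<close>,
  modulo the smallest congruence that turns them into a unital complex algebra in which the
  constants form a unital homomorphic image of \<open>B\<close>. The complex scalar multiplication is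
  \<open>c p = (c 1) p\<close>; this is bilinear precisely because of the rule \<open>scalar_central\<close>.
\<close>

datatype 'b ncexpr =
    EConst 'b
  | EVar
  | EAdd "'b ncexpr" "'b ncexpr"
  | EMul "'b ncexpr" "'b ncexpr"

inductive ncrel :: "'b::cstar_algebra ncexpr \<Rightarrow> 'b ncexpr \<Rightarrow> bool" where
  nc_refl: "ncrel p p"
| nc_sym: "ncrel p q \<Longrightarrow> ncrel q p"
| nc_trans: "ncrel p q \<Longrightarrow> ncrel q r \<Longrightarrow> ncrel p r"
| add_cong: "ncrel p p' \<Longrightarrow> ncrel q q' \<Longrightarrow> ncrel (EAdd p q) (EAdd p' q')"
| mul_cong: "ncrel p p' \<Longrightarrow> ncrel q q' \<Longrightarrow> ncrel (EMul p q) (EMul p' q')"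
| add_assoc: "ncrel (EAdd (EAdd p q) r) (EAdd p (EAdd q r))"
| add_commute: "ncrel (EAdd p q) (EAdd q p)"
| add_zero: "ncrel (EAdd (EConst 0) p) p"
| add_inverse: "ncrel (EAdd (EMul (EConst (- 1)) p) p) (EConst 0)"
| mul_assoc: "ncrel (EMul (EMul p q) r) (EMul p (EMul q r))"
| mul_one_left: "ncrel (EMul (EConst 1) p) p"
| mul_one_right: "ncrel (EMul p (EConst 1)) p"
| distrib_right: "ncrel (EMul (EAdd p q) r) (EAdd (EMul p r) (EMul q r))"
| distrib_left: "ncrel (EMul p (EAdd q r)) (EAdd (EMul p q) (EMul p r))"
| const_add: "ncrel (EConst (a + b)) (EAdd (EConst a) (EConst b))"
| const_mul: "ncrel (EConst (a * b)) (EMul (EConst a) (EConst b))"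
| scalar_central: "ncrel (EMul (EConst (scaleC c 1)) p) (EMul p (EConst (scaleC c 1)))"

quotient_type (overloaded) 'b ncpoly = "'b::cstar_algebra ncexpr" / ncrel
  by (rule equivpI) (auto intro: reflpI sympI transpI ncrel.intros)

primrec estar :: "'b::cstar_algebra ncexpr \<Rightarrow> 'b ncexpr" where
  "estar (EConst b) = EConst (star b)"
| "estar EVar = EVar"
| "estar (EAdd p q) = EAdd (estar p) (estar q)"
| "estar (EMul p q) = EMul (estar q) (estar p)"

lemma star_zero: "star (0::'b::cstar_algebra) = 0"
  by (metis add_cancel_right_right star_add)

lemma star_minus: "star (- x) = - star (x::'b::cstar_algebra)"
  by (metis add.right_inverse add_eq_0_iff star_add star_zero)

lemma ncrel_minus_one_central:
  "ncrel (EMul (EConst (- 1)) p) (EMul p (EConst (- 1 :: 'b::cstar_algebra)))"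
proof -
  have "scaleC (complex_of_real (- 1)) (1::'b) = - 1"
    by (simp only: scaleC_of_real) simp
  then show ?thesis
    using ncrel.scalar_central[of "complex_of_real (- 1)" p] by metis
qed

lemma estar_cong: "ncrel p q \<Longrightarrow> ncrel (estar p) (estar q)"
proof (induction rule: ncrel.induct)
  case (nc_trans p q r)
  then show ?case by (blast intro: ncrel.nc_trans)
next
  case (add_inverse p)
  have "ncrel (EAdd (EMul (estar p) (EConst (- 1))) (estar p)) (EConst 0)"
    by (rule ncrel.nc_trans[OF ncrel.add_cong[OF
          ncrel.nc_sym[OF ncrel_minus_one_central] ncrel.nc_refl] ncrel.add_inverse])
  then show ?case by (simp add: star_zero star_minus star_one)
next
  case (scalar_central c p)
  then show ?case
    by (simp add: star_scaleC star_one ncrel.nc_sym[OF ncrel.scalar_central])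
qed (auto simp: star_zero star_one star_add star_mult intro: ncrel.intros)

text \<open>The value at \<open>X = 0\<close>; it only serves to show that \<open>B\<langle>X\<rangle>\<close> is not the zero ring.\<close>

primrec eval0 :: "'b::cstar_algebra ncexpr \<Rightarrow> 'b" where
  "eval0 (EConst b) = b"
| "eval0 EVar = 0"
| "eval0 (EAdd p q) = eval0 p + eval0 q"
| "eval0 (EMul p q) = eval0 p * eval0 q"

lemma eval0_cong: "ncrel p q \<Longrightarrow> eval0 p = eval0 q"
  by (induction rule: ncrel.induct)
    (auto simp: algebra_simps scaleC_mult_left scaleC_mult_right)

instantiation ncpoly :: (cstar_algebra) ring_1
begin

lift_definition zero_ncpoly :: "'a ncpoly" is "EConst 0" .

lift_definition one_ncpoly :: "'a ncpoly" is "EConst 1" .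

lift_definition plus_ncpoly :: "'a ncpoly \<Rightarrow> 'a ncpoly \<Rightarrow> 'a ncpoly" is EAdd
  by (rule ncrel.add_cong)

lift_definition times_ncpoly :: "'a ncpoly \<Rightarrow> 'a ncpoly \<Rightarrow> 'a ncpoly" is EMul
  by (rule ncrel.mul_cong)

lift_definition uminus_ncpoly :: "'a ncpoly \<Rightarrow> 'a ncpoly" is "EMul (EConst (- 1))"
  by (intro ncrel.mul_cong ncrel.nc_refl)

definition minus_ncpoly :: "'a ncpoly \<Rightarrow> 'a ncpoly \<Rightarrow> 'a ncpoly" where
  "minus_ncpoly p q = p + - q"

instance
proof
  fix p q r :: "'a ncpoly"
  show "p + q + r = p + (q + r)" by transfer (rule ncrel.add_assoc)
  show "p + q = q + p" by transfer (rule ncrel.add_commute)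
  show "0 + p = p" by transfer (rule ncrel.add_zero)
  show "- p + p = 0" by transfer (rule ncrel.add_inverse)
  show "p - q = p + - q" by (rule minus_ncpoly_def)
  show "p * q * r = p * (q * r)" by transfer (rule ncrel.mul_assoc)
  show "1 * p = p" by transfer (rule ncrel.mul_one_left)
  show "p * 1 = p" by transfer (rule ncrel.mul_one_right)
  show "(p + q) * r = p * r + q * r" by transfer (rule ncrel.distrib_right)
  show "p * (q + r) = p * q + p * r" by transfer (rule ncrel.distrib_left)
  show "(0::'a ncpoly) \<noteq> 1" by transfer (auto dest: eval0_cong)
qed

end

instantiation ncpoly :: (cstar_algebra) star
begin

lift_definition star_ncpoly :: "'a ncpoly \<Rightarrow> 'a ncpoly" is estar
  by (rule estar_cong)

instance ..

end

lift_definition ncconst :: "'b::cstar_algebra \<Rightarrow> 'b ncpoly" is EConst .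

lift_definition ncX :: "'b::cstar_algebra ncpoly" is EVar .


section \<open>\<open>B\<close>-valued laws\<close>

type_synonym 'b law = "'b ncpoly \<Rightarrow> 'b"

text \<open>Complex linearity is the bimodule property for the constants \<open>c 1\<close>.\<close>

definition bimodule_map :: "'b::cstar_algebra law \<Rightarrow> bool" where
  "bimodule_map \<mu> \<longleftrightarrow>
     (\<forall>p q. \<mu> (p + q) = \<mu> p + \<mu> q) \<and>
     (\<forall>a p b. \<mu> (ncconst a * p * ncconst b) = a * \<mu> p * b)"

definition completely_positive :: "'b::cstar_algebra law \<Rightarrow> bool" where
  "completely_positive \<mu> \<longleftrightarrow>
     (\<forall>m. \<forall>P :: nat \<Rightarrow> nat \<Rightarrow> 'b ncpoly.
        mat_pos m (\<lambda>i j. \<mu> (\<Sum>k<m. star (P k i) * P k j)))"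

definition exponentially_bounded :: "'b::cstar_algebra law \<Rightarrow> bool" where
  "exponentially_bounded \<mu> \<longleftrightarrow>
     (\<exists>M>0. \<exists>R>0. \<forall>b0 bs.
        norm (\<mu> (ncconst b0 * (\<Prod>b\<leftarrow>bs. ncX * ncconst b)))
          \<le> M * R ^ length bs * norm b0 * (\<Prod>b\<leftarrow>bs. norm b))"

definition is_law :: "'b::cstar_algebra law \<Rightarrow> bool" where
  "is_law \<mu> \<longleftrightarrow>
     bimodule_map \<mu> \<and> \<mu> 1 = 1 \<and> completely_positive \<mu> \<and> exponentially_bounded \<mu>"


section \<open>Correspondences and their operators\<close>

text \<open>
  The record holds the data both of a \<open>B\<close>-\<open>B\<close>-correspondence and of a
  not yet separated and completed one, whose inner product is only positive semidefinite.
  The inner product is linear in its second argument. The complex scalar multiplication is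
  \<open>c h = h (c 1)\<close>.
\<close>

record ('b, 'h) corr =
  hcarrier :: "'h set"
  hadd :: "'h \<Rightarrow> 'h \<Rightarrow> 'h"
  hzero :: "'h"
  hlact :: "'b \<Rightarrow> 'h \<Rightarrow> 'h"
  hract :: "'h \<Rightarrow> 'b \<Rightarrow> 'h"
  hip :: "'h \<Rightarrow> 'h \<Rightarrow> 'b"

definition hdiff :: "('b::cstar_algebra, 'h) corr \<Rightarrow> 'h \<Rightarrow> 'h \<Rightarrow> 'h" where
  "hdiff H h k = hadd H h (hract H k (- 1))"

definition hnorm :: "('b::cstar_algebra, 'h) corr \<Rightarrow> 'h \<Rightarrow> real" where
  "hnorm H h = sqrt (norm (hip H h h))"

text \<open>
  The bounded adjointable right modular operators \<open>L(H)\<close>, as functions that are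
  \<open>undefined\<close> outside of the carrier.
\<close>

definition adjointables :: "('b::cstar_algebra, 'h) corr \<Rightarrow> ('h \<Rightarrow> 'h) set" where
  "adjointables H = {x \<in> hcarrier H \<rightarrow>\<^sub>E hcarrier H.
     (\<forall>h\<in>hcarrier H. \<forall>k\<in>hcarrier H. x (hadd H h k) = hadd H (x h) (x k)) \<and>
     (\<forall>h\<in>hcarrier H. \<forall>b. x (hract H h b) = hract H (x h) b) \<and>
     (\<exists>K. \<forall>h\<in>hcarrier H. hnorm H (x h) \<le> K * hnorm H h) \<and>
     (\<exists>y \<in> hcarrier H \<rightarrow> hcarrier H.
        \<forall>h\<in>hcarrier H. \<forall>k\<in>hcarrier H. hip H (x h) k = hip H h (y k))}"

text \<open>
  The unital homomorphism \<open>B\<langle>X\<rangle> \<rightarrow> L(H)\<close> that is the left action on \<open>B\<close> and sends \<open>X\<close> to \<open>x\<close>.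
\<close>

definition poly_eval ::
    "('b::cstar_algebra, 'h) corr \<Rightarrow> ('h \<Rightarrow> 'h) \<Rightarrow> 'b ncpoly \<Rightarrow> ('h \<Rightarrow> 'h)" where
  "poly_eval H x = (THE \<pi>.
     (\<forall>p. \<pi> p \<in> adjointables H) \<and>
     (\<forall>b. \<pi> (ncconst b) = (\<lambda>h\<in>hcarrier H. hlact H b h)) \<and>
     \<pi> ncX = x \<and>
     (\<forall>p q. \<pi> (p + q) = (\<lambda>h\<in>hcarrier H. hadd H (\<pi> p h) (\<pi> q h))) \<and>
     (\<forall>p q. \<pi> (p * q) = compose (hcarrier H) (\<pi> p) (\<pi> q)))"

text \<open>The law of \<open>x\<close> with respect to \<open>a \<mapsto> \<langle>\<xi>, a \<xi>\<rangle>\<close>.\<close>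

definition law_of :: "('b::cstar_algebra, 'h) corr \<Rightarrow> 'h \<Rightarrow> ('h \<Rightarrow> 'h) \<Rightarrow> 'b law" where
  "law_of H \<xi> x p = hip H \<xi> (poly_eval H x p \<xi>)"


section \<open>Separation and completion\<close>

definition cauchy_seqs :: "('b::cstar_algebra, 'v) corr \<Rightarrow> (nat \<Rightarrow> 'v) set" where
  "cauchy_seqs V = {f. (\<forall>n. f n \<in> hcarrier V) \<and>
     (\<forall>e>0. \<exists>M. \<forall>m\<ge>M. \<forall>n\<ge>M. hnorm V (hdiff V (f m) (f n)) < e)}"

definition cauchy_rel :: "('b::cstar_algebra, 'v) corr \<Rightarrow> ((nat \<Rightarrow> 'v) \<times> (nat \<Rightarrow> 'v)) set" where
  "cauchy_rel V = {(f, g). f \<in> cauchy_seqs V \<and> g \<in> cauchy_seqs V \<and>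
     (\<lambda>n. hnorm V (hdiff V (f n) (g n))) \<longlonglongrightarrow> 0}"

definition completion ::
    "('b::cstar_algebra, 'v) corr \<Rightarrow> ('b, (nat \<Rightarrow> 'v) set) corr" where
  "completion V = \<lparr>
     hcarrier = cauchy_seqs V // cauchy_rel V,
     hadd = (\<lambda>A B. \<Union>f\<in>A. \<Union>g\<in>B. cauchy_rel V `` {\<lambda>n. hadd V (f n) (g n)}),
     hzero = cauchy_rel V `` {\<lambda>n. hzero V},
     hlact = (\<lambda>b A. \<Union>f\<in>A. cauchy_rel V `` {\<lambda>n. hlact V b (f n)}),
     hract = (\<lambda>A b. \<Union>f\<in>A. cauchy_rel V `` {\<lambda>n. hract V (f n) b}),
     hip = (\<lambda>A B. THE c. \<forall>f\<in>A. \<forall>g\<in>B. (\<lambda>n. hip V (f n) (g n)) \<longlonglongrightarrow> c)\<rparr>"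

text \<open>The class of a vector, that is, of the constant sequence.\<close>

definition cls :: "('b::cstar_algebra, 'v) corr \<Rightarrow> 'v \<Rightarrow> (nat \<Rightarrow> 'v) set" where
  "cls V v = cauchy_rel V `` {\<lambda>n. v}"


section \<open>The correspondence of a law\<close>

definition pre_L2 :: "'b::cstar_algebra law \<Rightarrow> ('b, 'b ncpoly) corr" where
  "pre_L2 \<mu> = \<lparr>
     hcarrier = UNIV,
     hadd = (+),
     hzero = 0,
     hlact = (\<lambda>b p. ncconst b * p),
     hract = (\<lambda>p b. p * ncconst b),
     hip = (\<lambda>p q. \<mu> (star p * q))\<rparr>"

type_synonym 'b L2 = "(nat \<Rightarrow> 'b ncpoly) set"

definition L2 :: "'b::cstar_algebra law \<Rightarrow> ('b, 'b L2) corr" where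
  "L2 \<mu> = completion (pre_L2 \<mu>)"

definition L2_unit :: "'b::cstar_algebra law \<Rightarrow> 'b L2" where
  "L2_unit \<mu> = cls (pre_L2 \<mu>) 1"

definition L2_X :: "'b::cstar_algebra law \<Rightarrow> 'b L2 \<Rightarrow> 'b L2" where
  "L2_X \<mu> = (THE x. x \<in> adjointables (L2 \<mu>) \<and>
     (\<forall>p. x (cls (pre_L2 \<mu>) p) = cls (pre_L2 \<mu>) (ncX * p)))"


section \<open>Trees\<close>

definition free_strings :: "nat \<Rightarrow> nat list set" where
  "free_strings N = {s. set s \<subseteq> {1..N} \<and> distinct_adj s}"

definition free_edges :: "nat \<Rightarrow> (nat list \<times> nat list) set" where
  "free_edges N =
     {(s, j # s) | s j. j # s \<in> free_strings N} \<union> {(j # s, s) | s j. j # s \<in> free_strings N}"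

text \<open>
  A connected subgraph of the tree \<open>T\<^bsub>N,free\<^esub>\<close> contains every edge between two of its vertices,
  so it is determined by its vertex set.
\<close>

definition Tree :: "nat \<Rightarrow> nat list set set" where
  "Tree N = {T. T \<subseteq> free_strings N \<and> [] \<in> T \<and>
     (\<forall>s\<in>T. \<forall>t\<in>T. (s, t) \<in> (free_edges N \<inter> T \<times> T)\<^sup>*)}"

definition branch :: "nat \<Rightarrow> nat list set \<Rightarrow> nat \<Rightarrow> nat list set" where
  "branch N T j = {s \<in> free_strings N. s @ [j] \<in> T}"


section \<open>The product space of a tree\<close>

text \<open>
  A pair \<open>([(j\<^sub>1, h\<^sub>1), \<dots>, (j\<^sub>m, h\<^sub>m)], b)\<close> with \<open>h\<^sub>i\<close> in \<open>H\<^sub>j\<^sub>i\<close> orthogonal to \<open>\<xi>\<^sub>j\<^sub>i\<close> stands for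
  the elementary tensor \<open>h\<^sub>1 \<otimes> \<dots> \<otimes> h\<^sub>m b\<close>, and for \<open>b \<in> B\<close> if \<open>m = 0\<close>.
\<close>

type_synonym ('b, 'h) etensor = "(nat \<times> 'h) list \<times> 'b"

definition hcirc :: "(nat \<Rightarrow> ('b::cstar_algebra, 'h) corr) \<Rightarrow> (nat \<Rightarrow> 'h) \<Rightarrow> nat \<Rightarrow> 'h set" where
  "hcirc H \<xi> j = {h \<in> hcarrier (H j). hip (H j) h (\<xi> j) = 0}"

definition etensors ::
    "(nat \<Rightarrow> ('b::cstar_algebra, 'h) corr) \<Rightarrow> (nat \<Rightarrow> 'h) \<Rightarrow> nat list \<Rightarrow> ('b, 'h) etensor set" where
  "etensors H \<xi> s = {(w, b). map fst w = s \<and> (\<forall>(j, h)\<in>set w. h \<in> hcirc H \<xi> j)}"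

fun etensor_lact ::
    "(nat \<Rightarrow> ('b::cstar_algebra, 'h) corr) \<Rightarrow> 'b \<Rightarrow> ('b, 'h) etensor \<Rightarrow> ('b, 'h) etensor" where
  "etensor_lact H a ([], b) = ([], a * b)"
| "etensor_lact H a ((j, h) # w, b) = ((j, hlact (H j) a h) # w, b)"

text \<open>
  \<open>word_ip H a u v\<close> is \<open>\<langle>u, a v\<rangle>\<close>, computed from the rule
  \<open>\<langle>h \<otimes> u, k \<otimes> v\<rangle> = \<langle>u, \<langle>h, k\<rangle> v\<rangle>\<close> for the inner product of a tensor product over \<open>B\<close>.
  The summands for distinct strings are orthogonal.
\<close>

fun word_ip ::
    "(nat \<Rightarrow> ('b::cstar_algebra, 'h) corr) \<Rightarrow> 'b \<Rightarrow> (nat \<times> 'h) list \<Rightarrow> (nat \<times> 'h) list \<Rightarrow> 'b" where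
  "word_ip H a [] [] = a"
| "word_ip H a ((i, h) # u) ((j, k) # v) =
     (if i = j then word_ip H (hip (H i) h (hlact (H i) a k)) u v else 0)"
| "word_ip H a [] (_ # _) = 0"
| "word_ip H a (_ # _) [] = 0"

definition etensor_ip ::
    "(nat \<Rightarrow> ('b::cstar_algebra, 'h) corr) \<Rightarrow> ('b, 'h) etensor \<Rightarrow> ('b, 'h) etensor \<Rightarrow> 'b" where
  "etensor_ip H u v = star (snd u) * word_ip H 1 (fst u) (fst v) * snd v"

text \<open>
  The algebraic direct sum over \<open>s \<in> T\<close> of the algebraic tensor products consists of the formal
  finite sums of elementary tensors, represented as lists. The relations that define the tensor
  product (such as \<open>h b \<otimes> k = h \<otimes> b k\<close>) hold up to vectors of norm zero, and are thus
  imposed by the separation-completion, which yields the Hilbert module direct sum.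
\<close>

definition pre_tree_space ::
    "nat list set \<Rightarrow> (nat \<Rightarrow> ('b::cstar_algebra, 'h) corr) \<Rightarrow> (nat \<Rightarrow> 'h)
      \<Rightarrow> ('b, ('b, 'h) etensor list) corr" where
  "pre_tree_space T H \<xi> = \<lparr>
     hcarrier = {us. set us \<subseteq> (\<Union>s\<in>T. etensors H \<xi> s)},
     hadd = (@),
     hzero = [],
     hlact = (\<lambda>a us. map (etensor_lact H a) us),
     hract = (\<lambda>us a. map (\<lambda>(w, b). (w, b * a)) us),
     hip = (\<lambda>us vs. \<Sum>u\<leftarrow>us. \<Sum>v\<leftarrow>vs. etensor_ip H u v)\<rparr>"

type_synonym ('b, 'h) tree_space = "(nat \<Rightarrow> ('b, 'h) etensor list) set"

definition tree_space ::
    "nat list set \<Rightarrow> (nat \<Rightarrow> ('b::cstar_algebra, 'h) corr) \<Rightarrow> (nat \<Rightarrow> 'h)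
      \<Rightarrow> ('b, ('b, 'h) tree_space) corr" where
  "tree_space T H \<xi> = completion (pre_tree_space T H \<xi>)"

definition tree_unit ::
    "nat list set \<Rightarrow> (nat \<Rightarrow> ('b::cstar_algebra, 'h) corr) \<Rightarrow> (nat \<Rightarrow> 'h)
      \<Rightarrow> ('b, 'h) tree_space" where
  "tree_unit T H \<xi> = cls (pre_tree_space T H \<xi>) [([], 1)]"

text \<open>
  The image of \<open>h \<otimes> u\<close>, for \<open>h \<in> H\<^sub>j\<close> and an elementary tensor \<open>u\<close> whose string \<open>s\<close> does not begin
  with \<open>j\<close>, under the isomorphism of \<open>H\<^sub>j \<otimes> H\<^sub>s\<^sup>\<circ>\<close> with the sum of \<open>H\<^sub>s\<^sup>\<circ>\<close> and \<open>H\<^sub>j\<^sub>s\<^sup>\<circ>\<close>: it is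
  \<open>\<langle>\<xi>\<^sub>j, h\<rangle> u + (h - \<xi>\<^sub>j \<langle>\<xi>\<^sub>j, h\<rangle>) \<otimes> u\<close>.
\<close>

definition tree_tensor ::
    "nat list set \<Rightarrow> (nat \<Rightarrow> ('b::cstar_algebra, 'h) corr) \<Rightarrow> (nat \<Rightarrow> 'h)
      \<Rightarrow> nat \<Rightarrow> 'h \<Rightarrow> ('b, 'h) etensor \<Rightarrow> ('b, 'h) tree_space" where
  "tree_tensor T H \<xi> j h u = cls (pre_tree_space T H \<xi>)
     [etensor_lact H (hip (H j) (\<xi> j) h) u,
      ((j, hdiff (H j) h (hract (H j) (\<xi> j) (hip (H j) (\<xi> j) h))) # fst u, snd u)]"

definition tree_lambda ::
    "nat list set \<Rightarrow> (nat \<Rightarrow> ('b::cstar_algebra, 'h) corr) \<Rightarrow> (nat \<Rightarrow> 'h)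
      \<Rightarrow> nat \<Rightarrow> ('h \<Rightarrow> 'h) \<Rightarrow> (('b, 'h) tree_space \<Rightarrow> ('b, 'h) tree_space)" where
  "tree_lambda T H \<xi> j x = (THE y. y \<in> adjointables (tree_space T H \<xi>) \<and>
     (\<forall>s\<in>T. (s = [] \<or> hd s \<noteq> j) \<longrightarrow> (\<forall>u\<in>etensors H \<xi> s.
        (j # s \<in> T \<longrightarrow> (\<forall>h\<in>hcarrier (H j).
            y (tree_tensor T H \<xi> j h u) = tree_tensor T H \<xi> j (x h) u)) \<and>
        (j # s \<notin> T \<longrightarrow>
            y (cls (pre_tree_space T H \<xi>) [u]) = hzero (tree_space T H \<xi>)))))"


section \<open>Convolutions\<close>

text \<open>Of the family \<open>\<mu>\<close> only the members \<open>\<mu> 1, \<dots>, \<mu> N\<close> are used.\<close>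

definition tree_conv ::
    "nat \<Rightarrow> nat list set \<Rightarrow> (nat \<Rightarrow> 'b::cstar_algebra law) \<Rightarrow> 'b law" where
  "tree_conv N T \<mu> =
     (let H = (\<lambda>j. L2 (\<mu> j));
          \<xi> = (\<lambda>j. L2_unit (\<mu> j));
          K = tree_space T H \<xi>;
          S = (\<lambda>k\<in>hcarrier K.
                foldr (\<lambda>j. hadd K (tree_lambda T H \<xi> j (L2_X (\<mu> j)) k)) [1..<Suc N] (hzero K))
      in law_of K (tree_unit T H \<xi>) S)"

text \<open>For the empty list this is the law of the zero operator on \<open>B\<close>.\<close>

definition boolean_conv :: "'b::cstar_algebra law list \<Rightarrow> 'b law" where
  "boolean_conv \<nu>s =
     tree_conv (length \<nu>s) (insert [] {[i] | i. i \<in> {1..length \<nu>s}}) (\<lambda>i. \<nu>s ! (i - 1))"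

definition orthogonal_conv :: "'b::cstar_algebra law \<Rightarrow> 'b law \<Rightarrow> 'b law" where
  "orthogonal_conv \<mu> \<nu> = tree_conv 2 {[], [1], [2, 1]} (\<lambda>i. if i = 1 then \<mu> else \<nu>)"

end

theory Submission
  imports Defs
begin

text \<open>
  Both sides are compared through their moments. Splitting a moment
  \<open>\<langle>\<xi>, S a\<^sub>1 S a\<^sub>2 \<cdots> S a\<^sub>n \<xi>\<rangle>\<close> at the first return to the root of the tree
  defines Boolean cumulants, which determine the moments and are determined by them. A path that
  avoids the root stays in the branch at one vertex \<open>j\<close>, where the space is the tensor product of the
  product space of that branch with the centered part of the space of \<open>\<mu>\<^sub>j\<close>, and \<open>S\<close> acts as the
  sum operator of the branch plus \<open>X\<^sub>j\<close> on the root of the branch. So the cumulants of a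
  convolution are \<open>\<Sum>\<^sub>j F(\<mu>\<^sub>j, \<nu>\<^sub>j)\<close>, where \<open>F\<close> depends only on \<open>\<mu>\<^sub>j\<close> and on the moments of the
  convolution \<open>\<nu>\<^sub>j\<close> over the branch. Evaluating this formula for the given tree, the Boolean tree
  and the orthogonal tree yields the same cumulants on both sides.

  For the operators and spaces to exist, inner products with values in \<open>B\<close> must satisfy the
  Cauchy-Schwarz inequality, which needs that \<open>c\<^sup>* c\<close> is the square of a self-adjoint element.
\<close>

section \<open>Positive elements of a C*-algebra\<close>

text \<open>The right-hand side nests convolutions, so the theory is developed for a class of
  functionals that contains the laws and is closed under convolution (\<open>quasi_law\<close>). The
  comparison rests on the fact that F(\<mu>, \<delta>_0) is the sequence of Boolean cumulants of
  \<mu> itself: for the orthogonal convolution \<rho> of \<mu> and \<nu>, uniqueness of cumulants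
  gives F(\<rho>, \<delta>_0) = F(\<mu>, \<nu>), and Boolean convolution adds the former. The
  obstacle is that operators and spaces are given by definite descriptions on completions of spaces
  of formal sums, where module laws hold only up to null vectors. Hence identities are proved
  weakly, by pairing with an arbitrary vector, and no isomorphism of Hilbert modules is constructed.
  Besides the module actions, only symmetric operators have to be extended to a completion; these
  are their own adjoints, and a geometric bound on the orbit of each vector already makes them
  bounded. This replaces the usual estimate of x \<otimes> id through positive matrices of
  operators.\<close>

lemma norm_star: "norm (star (x::'b::cstar_algebra)) = norm x"
proof -
  have le: "norm y \<le> norm (star y)" for y :: 'b
  proof (cases "y = 0")
    case False
    have "norm y * norm y \<le> norm (star y) * norm y"
      using cstar_identity[of y] norm_mult_ineq[of "star y" y] by (simp add: power2_eq_square)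
    then show ?thesis using False by simp
  qed simp
  show ?thesis using le[of x] le[of "star x"] by (simp add: star_star)
qed

lemma star_diff: "star (x - y) = star x - star (y::'b::cstar_algebra)"
  using star_add[of x "- y"] by (simp add: star_minus)

lemma star_scaleR: "star (scaleR r x) = scaleR r (star (x::'b::cstar_algebra))"
  using star_scaleC[of "complex_of_real r" x] by (simp add: scaleC_of_real)

lemma star_of_real: "star (of_real r :: 'b::cstar_algebra) = of_real r"
  by (simp add: of_real_def star_scaleR star_one)

lemma bounded_linear_star: "bounded_linear (star :: 'b::cstar_algebra \<Rightarrow> 'b)"
  by (rule bounded_linear_intro[of _ 1]) (auto simp: star_add star_scaleR norm_star)

lemma tendsto_star:
  "(f \<longlongrightarrow> a) F \<Longrightarrow> ((\<lambda>x. star (f x :: 'b::cstar_algebra)) \<longlongrightarrow> star a) F"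
  by (rule bounded_linear.tendsto[OF bounded_linear_star])

lemma star_sum_list: "star (\<Sum>x\<leftarrow>xs. f x) = (\<Sum>x\<leftarrow>xs. star (f x :: 'b::cstar_algebra))"
  by (induction xs) (auto simp: star_add star_zero)

lemma of_real_commute: "of_real r * x = x * (of_real r :: 'b::real_algebra_1)"
  by (simp add: of_real_def)

section \<open>Square roots by iteration\<close>

primrec sqrt_iter :: "'b::real_normed_algebra_1 \<Rightarrow> nat \<Rightarrow> 'b" where
  "sqrt_iter x 0 = 0"
| "sqrt_iter x (Suc n) = scaleR (1/2) (x + sqrt_iter x n * sqrt_iter x n)"

lemma sqrt_iter_one: "0 \<le> sqrt_iter (1::real) n \<and> sqrt_iter (1::real) n \<le> sqrt_iter 1 (Suc n)
   \<and> sqrt_iter (1::real) n \<le> 1"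
proof (induction n)
  case (Suc n)
  have "sqrt_iter (1::real) (Suc n) \<le> 1"
    using Suc mult_mono[of "sqrt_iter (1::real) n" 1 "sqrt_iter (1::real) n" 1] by simp
  moreover have "sqrt_iter (1::real) (Suc n) \<le> sqrt_iter 1 (Suc (Suc n))"
    using Suc mult_mono[of "sqrt_iter (1::real) n" "sqrt_iter (1::real) (Suc n)"
      "sqrt_iter (1::real) n" "sqrt_iter (1::real) (Suc n)"] by simp
  ultimately show ?case using Suc by simp
qed auto

lemma sqrt_iter_norm:
  fixes x :: "'b::real_normed_algebra_1"
  assumes "norm x \<le> 1"
  shows "norm (sqrt_iter x n) \<le> sqrt_iter 1 n"
proof (induction n)
  case (Suc n)
  have "norm (x + sqrt_iter x n * sqrt_iter x n) \<le> 1 + sqrt_iter 1 n * sqrt_iter 1 n"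
    using assms Suc norm_mult_ineq[of "sqrt_iter x n" "sqrt_iter x n"]
      mult_mono[OF Suc Suc] sqrt_iter_one[of n]
    by (intro norm_triangle_le) (simp add: add_mono)
  then show ?case by simp
qed simp

text \<open>The factorisation p * p - q * q = p * (p - q) + (p - q) * q needs no commutativity, so
  the increments for \<open>x\<close> are dominated by those of the scalar iteration for 1, whose
  sum telescopes.\<close>

lemma sqrt_iter_diff:
  fixes x :: "'b::real_normed_algebra_1"
  assumes "norm x \<le> 1"
  shows "norm (sqrt_iter x (Suc n) - sqrt_iter x n) \<le> sqrt_iter 1 (Suc n) - sqrt_iter 1 n"
proof (induction n)
  case (Suc n)
  define y where "y = sqrt_iter x"
  define t where "t = sqrt_iter (1::real)"
  have "scaleR (1/2) (x + p * p) - scaleR (1/2) (x + q * q) =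
     scaleR (1/2) (p * (p - q) + (p - q) * q)" for p q
    by (simp add: algebra_simps flip: scaleR_diff_right)
  from this[of "y (Suc n)" "y n"]
  have eq: "y (Suc (Suc n)) - y (Suc n) =
     scaleR (1/2) (y (Suc n) * (y (Suc n) - y n) + (y (Suc n) - y n) * y n)"
    unfolding y_def by (metis sqrt_iter.simps(2))
  have d: "norm (y (Suc n) - y n) \<le> t (Suc n) - t n" using Suc by (simp add: y_def t_def)
  have "norm (y (Suc n) * (y (Suc n) - y n)) \<le> t (Suc n) * (t (Suc n) - t n)"
    by (rule order.trans[OF norm_mult_ineq mult_mono[OF _ d]])
      (use sqrt_iter_norm[OF assms, of "Suc n"] sqrt_iter_one[of "Suc n"]
        in \<open>simp_all add: y_def t_def del: sqrt_iter.simps\<close>)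
  moreover have "norm ((y (Suc n) - y n) * y n) \<le> (t (Suc n) - t n) * t n"
    by (rule order.trans[OF norm_mult_ineq mult_mono[OF d]])
      (use sqrt_iter_norm[OF assms, of n] sqrt_iter_one[of n]
        in \<open>simp_all add: y_def t_def del: sqrt_iter.simps\<close>)
  ultimately have "norm (y (Suc n) * (y (Suc n) - y n) + (y (Suc n) - y n) * y n)
     \<le> t (Suc n) * (t (Suc n) - t n) + (t (Suc n) - t n) * t n"
    by (intro norm_triangle_le) simp
  then have "norm (y (Suc (Suc n)) - y (Suc n)) \<le>
     (t (Suc n) * (t (Suc n) - t n) + (t (Suc n) - t n) * t n) / 2"
    unfolding eq by simp
  also have "\<dots> = (1/2) *\<^sub>R (1 + t (Suc n) * t (Suc n)) - (1/2) *\<^sub>R (1 + t n * t n)"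
    by (simp add: algebra_simps diff_divide_distrib add_divide_distrib)
  also have "\<dots> = t (Suc (Suc n)) - t (Suc n)"
    unfolding t_def by simp
  finally show ?case unfolding y_def t_def .
qed (use assms in simp)

text \<open>The iteration \<open>y \<mapsto> (x + y\<^sup>2) / 2\<close> converges to \<open>y = 1 - sqrt (1 - x)\<close>; it is majorised by the
  same iteration for \<open>x = 1\<close>, so that no strict inequality for the norm of \<open>x\<close> is needed.\<close>

lemma sqrt_one_minus_exists:
  fixes x :: "'b::cstar_algebra"
  assumes sx: "star x = x" and nx: "norm x \<le> 1"
  obtains s where "star s = s" "s * s = 1 - x" "norm (1 - s) \<le> 1"
    "\<And>z. z * x = x * z \<Longrightarrow> z * s = s * z"
proof -
  define y where "y = sqrt_iter x"
  define t where "t = sqrt_iter (1::real)"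
  have "incseq t" unfolding t_def by (rule incseq_SucI) (use sqrt_iter_one in blast)
  moreover have "Bseq t" unfolding t_def by (rule BseqI'[of _ 1]) (use sqrt_iter_one in auto)
  ultimately have "convergent t" by (auto intro!: Bseq_mono_convergent simp: incseq_def)
  then have "Cauchy t" by (rule convergent_Cauchy)
  have diff: "norm (y (m + k) - y m) \<le> t (m + k) - t m" for m k
  proof (induction k)
    case (Suc k)
    have "norm (y (m + Suc k) - y m) \<le> norm (y (Suc (m + k)) - y (m + k)) + norm (y (m + k) - y m)"
      using norm_triangle_ineq[of "y (Suc (m + k)) - y (m + k)" "y (m + k) - y m"] by simp
    then show ?case
      using Suc sqrt_iter_diff[OF nx, of "m + k"] by (simp add: y_def t_def del: sqrt_iter.simps)
  qed simp
  have "Cauchy y"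
  proof (rule CauchyI)
    fix e :: real assume "0 < e"
    then obtain M where M: "\<And>m n. m \<ge> M \<Longrightarrow> n \<ge> M \<Longrightarrow> norm (t m - t n) < e"
      using \<open>Cauchy t\<close> by (meson CauchyD)
    have le: "norm (y n - y m) < e" if "m \<ge> M" "m \<le> n" for m n
      using diff[of m "n - m"] M[of n m] that by simp
    show "\<exists>M. \<forall>m\<ge>M. \<forall>n\<ge>M. norm (y m - y n) < e"
    proof (intro exI allI impI)
      fix m n assume "m \<ge> M" "n \<ge> M"
      then show "norm (y m - y n) < e"
        using le[of m n] le[of n m] by (cases "m \<le> n") (auto simp: norm_minus_commute)
    qed
  qed
  then obtain l where l: "y \<longlonglongrightarrow> l" using Cauchy_convergent convergent_def by blast
  have "(\<lambda>n. y (Suc n)) \<longlonglongrightarrow> scaleR (1/2) (x + l * l)"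
    unfolding y_def sqrt_iter.simps by (intro tendsto_intros l[unfolded y_def])
  then have "l = scaleR (1/2) (x + l * l)"
    using LIMSEQ_Suc[OF l] LIMSEQ_unique by blast
  then have "2 *\<^sub>R l = x + l * l" by (metis (no_types, lifting) divide_self_if scaleR_one scaleR_scaleR
       times_divide_eq_right mult.right_neutral zero_neq_numeral)
  then have ll: "l + l = x + l * l" by (simp add: scaleR_2)
  have "star (y n) = y n" for n
    unfolding y_def by (induction n) (auto simp: star_zero star_scaleR star_add star_mult sx)
  then have sl: "star l = l"
    using tendsto_star[OF l] LIMSEQ_unique l by (simp add: y_def)
  have nl: "norm l \<le> 1"
    by (rule LIMSEQ_le_const2[OF tendsto_norm[OF l]])
      (use sqrt_iter_norm[OF nx] sqrt_iter_one in \<open>auto simp: y_def intro: order.trans\<close>)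
  \<comment> \<open>Every iterate is a polynomial in \<open>x\<close>, so whatever commutes with
    \<open>x\<close> commutes with the limit. Later this makes roots of different elements
    commute.\<close>
  have comm: "z * l = l * z" if z: "z * x = x * z" for z
  proof -
    have c: "z * y n = y n * z" for n
      unfolding y_def
    proof (induction n)
      case (Suc n)
      have "z * (sqrt_iter x n * sqrt_iter x n) = sqrt_iter x n * sqrt_iter x n * z"
        by (metis Suc mult.assoc)
      then show ?case
        by (simp only: sqrt_iter.simps mult_scaleR_right mult_scaleR_left ring_distribs z)
    qed simp
    have "(\<lambda>n. z * y n) \<longlonglongrightarrow> z * l" "(\<lambda>n. y n * z) \<longlonglongrightarrow> l * z" by (intro tendsto_intros l)+
    then show ?thesis using LIMSEQ_unique c by simp
  qed
  show ?thesis
  proof (rule that[of "1 - l"])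
    show "(1 - l) * (1 - l) = 1 - x" using ll by (simp add: algebra_simps)
  qed (use sl nl comm in \<open>auto simp: star_diff star_one algebra_simps\<close>)
qed

text \<open>Squares of self-adjoint elements instead of \<open>star c * c\<close>: for these the
  norm criterion of \<open>cposI\<close> and \<open>norm_diff_cpos\<close> gives sums and limits,
  and the form \<open>star c * c\<close> is reached in \<open>cpos_star_mult\<close>.\<close>

definition cpos :: "'b::cstar_algebra \<Rightarrow> bool" where
  "cpos a \<longleftrightarrow> (\<exists>s. star s = s \<and> a = s * s)"

lemma cpos_star: "cpos a \<Longrightarrow> star a = a"
  by (auto simp: cpos_def star_mult)

lemma norm_square_selfadjoint: "star s = s \<Longrightarrow> norm (s * s) = (norm (s::'b::cstar_algebra))\<^sup>2"
  using cstar_identity[of s] by simp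

text \<open>The C*-identity doubles the exponent. Together with the bound on powers in
  \<open>cpos_swap\<close> this takes the place of the spectral radius formula.\<close>

lemma norm_power_selfadjoint:
  "star s = s \<Longrightarrow> norm (s ^ (2 ^ n)) = norm (s::'b::cstar_algebra) ^ (2 ^ n)"
proof (induction n arbitrary: s)
  case (Suc n)
  have "norm ((s * s) ^ (2 ^ n)) = norm (s * s) ^ (2 ^ n)"
    by (rule Suc.IH) (simp add: star_mult Suc.prems)
  then show ?case
    by (simp add: power_mult power2_eq_square norm_square_selfadjoint[OF Suc.prems])
qed simp

text \<open>Rescaling reduces this to the root of 1 - x with x = (r - a) / r. The bound on
  \<open>of_real (sqrt r) - s\<close> makes the root itself positive by \<open>cposI\<close>, so
  that roots can be taken again.\<close>

lemma cpos_sqrt: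
  fixes a :: "'b::cstar_algebra"
  assumes sa: "star a = a" and n: "norm (of_real r - a) \<le> r"
  obtains s where "star s = s" "s * s = a" "norm (of_real (sqrt r) - s) \<le> sqrt r"
    "\<And>z. z * a = a * z \<Longrightarrow> z * s = s * z"
proof (cases "r = 0")
  case True
  then show ?thesis using n that[of 0] by (simp add: star_zero)
next
  case False
  then have r: "r > 0" using n norm_ge_zero[of "of_real r - a"] by linarith
  define x where "x = scaleR (1 / r) (of_real r - a)"
  have "star x = x" by (simp add: x_def star_scaleR star_diff star_of_real sa)
  moreover have "norm x \<le> 1" using n r by (simp add: x_def)
  ultimately obtain s where s: "star s = s" "s * s = 1 - x" "norm (1 - s) \<le> 1"
    "\<And>z. z * x = x * z \<Longrightarrow> z * s = s * z" using sqrt_one_minus_exists by metis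
  show ?thesis
  proof (rule that[of "sqrt r *\<^sub>R s"])
    have "sqrt r *\<^sub>R s * sqrt r *\<^sub>R s = r *\<^sub>R (1 - x)" using s(2) r by simp
    also have "\<dots> = a" using r by (simp add: x_def of_real_def algebra_simps)
    finally show "sqrt r *\<^sub>R s * sqrt r *\<^sub>R s = a" .
    have "of_real (sqrt r) - sqrt r *\<^sub>R s = sqrt r *\<^sub>R (1 - s)"
      by (simp add: of_real_def algebra_simps)
    then show "norm (of_real (sqrt r) - sqrt r *\<^sub>R s) \<le> sqrt r"
      using s(3) r by (simp add: mult_left_le)
    show "z * sqrt r *\<^sub>R s = sqrt r *\<^sub>R s * z" if "z * a = a * z" for z
      using s(4)[of z] that by (simp add: x_def algebra_simps of_real_def)
    show "star (sqrt r *\<^sub>R s) = sqrt r *\<^sub>R s" by (simp add: star_scaleR s(1))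
  qed
qed

lemma cposI: "star a = a \<Longrightarrow> norm (of_real r - a) \<le> r \<Longrightarrow> cpos a"
  by (metis cpos_sqrt cpos_def)

lemma scaleC_minus_left: "scaleC (- c) x = - scaleC c (x::'b::cstar_algebra)"
  using scaleC_add_left[of c "- c" x] scaleC_of_real[of 0 x] by (simp add: eq_neg_iff_add_eq_0 add.commute)

lemma scaleC_minus_right: "scaleC c (- x) = - scaleC c (x::'b::cstar_algebra)"
  using scaleC_mult_right[of "-1" c x] by simp

lemma scaleC_diff_right: "scaleC c (x - y) = scaleC c x - scaleC c (y::'b::cstar_algebra)"
  using scaleC_add_right[of c x "- y"] by (simp add: scaleC_minus_right)

lemma scaleC_scaleR: "scaleC c (r *\<^sub>R x) = r *\<^sub>R scaleC c (x::'b::cstar_algebra)"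
  using scaleC_scaleC[of c "complex_of_real r" x] scaleC_scaleC[of "complex_of_real r" c x]
  by (simp add: scaleC_of_real mult.commute)

lemma scaleC_i_i: "scaleC \<i> (scaleC \<i> x) = - (x::'b::cstar_algebra)"
  using scaleC_of_real[of "-1" x] by (simp add: scaleC_scaleC)

text \<open>As \<open>s\<close> and \<open>t\<close> commute, the mixed terms in
  \<open>star w * w\<close> for w = s + i t cancel and the sum of the squares remains, while
  \<open>s\<close> is the real part of \<open>w\<close> and hence not larger in norm.\<close>

lemma norm_le_sum_squares:
  fixes s t :: "'b::cstar_algebra"
  assumes s: "star s = s" and t: "star t = t" and st: "s * t = t * s"
  shows "(norm s)\<^sup>2 \<le> norm (s * s + t * t)"
proof -
  define w where "w = s + scaleC \<i> t"
  have sw: "star w = s - scaleC \<i> t" by (simp add: w_def star_add star_scaleC s t scaleC_minus_left)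
  have "star w * w = s * s + t * t"
    unfolding sw unfolding w_def
    by (simp add: algebra_simps scaleC_mult_left scaleC_mult_right scaleC_i_i scaleC_diff_right scaleC_add_right st)
  then have nw: "(norm w)\<^sup>2 = norm (s * s + t * t)" using cstar_identity[of w] by simp
  have "s = (1/2) *\<^sub>R (w + star w)" unfolding sw by (simp add: w_def flip: scaleR_2)
  then have "norm s \<le> (1/2) * (norm w + norm (star w))"
    using norm_triangle_ineq[of w "star w"] by (metis (no_types, opaque_lifting) abs_of_pos half_gt_zero_iff
         mult_left_mono norm_scaleR less_eq_real_def zero_less_one)
  then have "norm s \<le> norm w" by (simp add: norm_star)
  then show ?thesis using nw by (metis norm_ge_zero power_mono)
qed

text \<open>The converse of \<open>cposI\<close>. For the normalised element x, a root p of x and a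
  root q of 1 - x commute, and p * p + q * q = 1 bounds the norm of q * q by 1.\<close>

lemma norm_diff_cpos:
  assumes "cpos a" "norm a \<le> r"
  shows "norm (of_real r - a) \<le> r"
proof -
  have *: "norm (of_real (norm a) - a) \<le> norm a"
  proof (cases "a = 0")
    case False
    obtain s where s: "star s = s" "a = s * s" using assms(1) by (auto simp: cpos_def)
    define x where "x = scaleR (1 / norm a) a"
    have sx: "star x = x" by (simp add: x_def star_scaleR cpos_star assms(1))
    have "norm x \<le> 1" using False by (simp add: x_def)
    then obtain q where q: "star q = q" "q * q = 1 - x" "\<And>z. z * x = x * z \<Longrightarrow> z * q = q * z"
      using sqrt_one_minus_exists[OF sx] by metis
    define p where "p = scaleR (1 / sqrt (norm a)) s"
    have pp: "p * p = x" by (simp add: p_def x_def s(2))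
    have "p * q = q * p" by (rule q(3)) (metis pp mult.assoc)
    moreover have "star p = p" by (simp add: p_def star_scaleR s)
    ultimately have "(norm q)\<^sup>2 \<le> norm (q * q + p * p)"
      using norm_le_sum_squares[of q p] q(1) by simp
    then have "norm (q * q) \<le> 1" by (simp add: pp q(2) norm_square_selfadjoint[OF q(1), unfolded q(2)])
    moreover have "of_real (norm a) - a = norm a *\<^sub>R (q * q)"
      using False by (simp add: q(2) x_def of_real_def algebra_simps)
    ultimately show ?thesis by (simp add: mult_left_le)
  qed simp
  have "of_real r - a = of_real (r - norm a) + (of_real (norm a) - a)" by simp
  then have "norm (of_real r - a) \<le> norm (of_real (r - norm a) :: 'a) + norm (of_real (norm a) - a)"
    by (metis norm_triangle_ineq)
  then show ?thesis using * assms(2) by (simp del: of_real_diff)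
qed

text \<open>In terms of the norm criterion with radius \<open>norm a + norm b\<close>, the claim is
  the triangle inequality.\<close>

lemma cpos_add: assumes "cpos a" "cpos b" shows "cpos (a + b)"
proof (rule cposI)
  have "of_real (norm a + norm b) - (a + b) = (of_real (norm a) - a) + (of_real (norm b) - b)" by simp
  then show "norm (of_real (norm a + norm b) - (a + b)) \<le> norm a + norm b"
    using norm_diff_cpos[OF assms(1) order_refl] norm_diff_cpos[OF assms(2) order_refl]
    by (metis add_mono norm_triangle_le)
qed (use assms in \<open>simp add: star_add cpos_star\<close>)

lemma cpos_zero: "cpos 0" by (auto simp: cpos_def star_zero intro: exI[of _ 0])

lemma cpos_scaleR: "cpos a \<Longrightarrow> r \<ge> 0 \<Longrightarrow> cpos (r *\<^sub>R a)"
  unfolding cpos_def by (elim exE, rule_tac x = "sqrt r *\<^sub>R s" in exI) (auto simp: star_scaleR)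

lemma cpos_sum_list: "(\<And>x. x \<in> set xs \<Longrightarrow> cpos (f x)) \<Longrightarrow> cpos (\<Sum>x\<leftarrow>xs. f x)"
  by (induction xs) (auto simp: cpos_zero cpos_add)

text \<open>The norm criterion with the norm of the element as radius is a closed condition.\<close>

lemma cpos_closed:
  assumes "\<And>e. e > 0 \<Longrightarrow> \<exists>a'. cpos a' \<and> norm (a - a') < e"
  shows "cpos a"
proof -
  have "\<exists>a'. cpos a' \<and> norm (a - a') < 1 / Suc n" for n by (rule assms) simp
  then obtain u where u: "\<And>n. cpos (u n)" "\<And>n. norm (a - u n) < 1 / Suc n" by metis
  have "(\<lambda>n. a - u n) \<longlonglongrightarrow> 0"
    by (rule LIMSEQ_norm_0) (use u(2) in \<open>simp add: inverse_eq_divide\<close>)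
  then have "(\<lambda>n. a - (a - u n)) \<longlonglongrightarrow> a - 0" by (intro tendsto_intros)
  then have lim: "u \<longlonglongrightarrow> a" by simp
  have "(\<lambda>n. star (u n)) \<longlonglongrightarrow> star a" by (rule tendsto_star[OF lim])
  then have "star a = a" using lim LIMSEQ_unique cpos_star[OF u(1)] by simp
  moreover have "norm (of_real (norm a) - a) \<le> norm a"
  proof (rule LIMSEQ_le)
    show "(\<lambda>n. norm (of_real (norm (u n)) - u n)) \<longlonglongrightarrow> norm (of_real (norm a) - a)"
      by (intro tendsto_intros lim)
    show "(\<lambda>n. norm (u n)) \<longlonglongrightarrow> norm a" by (intro tendsto_intros lim)
  qed (use norm_diff_cpos[OF u(1) order_refl] in blast)
  ultimately show ?thesis by (rule cposI)
qed

lemma cpos_norm_minus: "star a = a \<Longrightarrow> norm a \<le> r \<Longrightarrow> cpos (of_real r - a)"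
  by (rule cposI[of _ r]) (auto simp: star_diff star_of_real)

text \<open>The roots of \<open>u\<close> and of \<open>of_real r - u\<close> commute and their
  squares add up to r, so \<open>norm_le_sum_squares\<close> applies.\<close>

lemma norm_le_of_cpos:
  assumes u: "cpos u" and v: "cpos (of_real r - u)" and "r \<ge> 0"
  shows "norm u \<le> r"
proof -
  obtain s where s: "star s = s" "u = s * s" using u by (auto simp: cpos_def)
  obtain t where t: "star t = t" "t * t = of_real r - u"
      "\<And>z. z * (of_real r - u) = (of_real r - u) * z \<Longrightarrow> z * t = t * z"
    using cpos_sqrt[OF cpos_star[OF v] norm_diff_cpos[OF v order_refl]] by metis
  have "s * t = t * s"
    by (rule t(3)) (simp add: s(2) algebra_simps of_real_commute)
  then have "(norm s)\<^sup>2 \<le> norm (s * s + t * t)" using norm_le_sum_squares s t by blast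
  also have "s * s + t * t = of_real r" by (simp add: t(2) s(2))
  finally show ?thesis using norm_square_selfadjoint[OF s(1)] \<open>r \<ge> 0\<close> by (simp add: s(2))
qed

lemma cpos_norm_mono:
  assumes u: "cpos u" and v: "cpos (v - u)"
  shows "norm u \<le> norm v"
proof -
  have "cpos v" using cpos_add[OF u v] by simp
  then have "cpos (of_real (norm v) - v)" by (intro cpos_norm_minus) (auto simp: cpos_star)
  from cpos_add[OF this v] have "cpos (of_real (norm v) - u)" by simp
  then show ?thesis by (rule norm_le_of_cpos[OF u]) simp
qed

lemma cpos_antisym: "cpos a \<Longrightarrow> cpos (- a) \<Longrightarrow> a = 0"
  using cpos_norm_mono[of a 0] by simp

lemma star_mult_self_eq_0: "star x * x = 0 \<Longrightarrow> x = (0::'b::cstar_algebra)"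
  using cstar_identity[of x] by simp

text \<open>Replaces the equality of the nonzero spectra of \<open>star d * d\<close> and \<open>d * star d\<close>: the powers of
  \<open>1 - star d * d\<close> grow at most linearly.\<close>

lemma cpos_swap:
  fixes d :: "'b::cstar_algebra"
  assumes "cpos (d * star d)"
  shows "cpos (star d * d)"
proof (cases "d = 0")
  case True
  then show ?thesis by (simp add: cpos_zero)
next
  case False
  define c where "c = (1 / norm d) *\<^sub>R d"
  have nc: "norm c = 1" using False by (simp add: c_def)
  have "cpos (c * star c)"
    using cpos_scaleR[OF assms, of "(1 / norm d) * (1 / norm d)"] by (simp add: c_def star_scaleR)
  moreover have "norm (c * star c) \<le> 1"
    using norm_mult_ineq[of c "star c"] by (simp add: norm_star nc)
  ultimately have n: "norm (1 - c * star c) \<le> 1" using norm_diff_cpos[of "c * star c" 1] by simp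
  define h where "h = 1 - star c * c"
  have sh: "star h = h" by (simp add: h_def star_diff star_one star_mult star_star)
  \<comment> \<open>The induction builds G = \<Sum>i<m. (1 - c * star c) ^ i; each summand has norm
    at most 1, since \<open>c * star c\<close> is positive of norm at most 1.\<close>
  have "\<exists>G. h ^ m = 1 - star c * G * c \<and> norm G \<le> m" for m
  proof (induction m)
    case 0
    show ?case by (rule exI[of _ 0]) simp
  next
    case (Suc m)
    then obtain G where G: "h ^ m = 1 - star c * G * c" "norm G \<le> m" by blast
    have "h ^ Suc m = h ^ m * h" by (simp add: power_commutes)
    also have "\<dots> = 1 - star c * (1 + G * (1 - c * star c)) * c"
      unfolding G(1) unfolding h_def by (simp add: algebra_simps)
    finally have "h ^ Suc m = 1 - star c * (1 + G * (1 - c * star c)) * c" .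
    moreover have "norm (1 + G * (1 - c * star c)) \<le> Suc m"
    proof -
      have "norm (G * (1 - c * star c)) \<le> real m * 1"
        by (rule order.trans[OF norm_mult_ineq mult_mono]) (use G n in auto)
      then show ?thesis using norm_triangle_ineq[of 1 "G * (1 - c * star c)"] by simp
    qed
    ultimately show ?case by blast
  qed note pow = this
  have bound: "norm h ^ (2 ^ k) \<le> 1 + 2 ^ k" for k :: nat
  proof -
    obtain G where G: "h ^ (2 ^ k) = 1 - star c * G * c" "norm G \<le> real (2 ^ k)" using pow by blast
    have "norm (star c * G * c) \<le> norm (star c) * norm G * norm c"
      by (meson norm_mult_ineq order.trans mult_right_mono norm_ge_zero)
    then have "norm (h ^ (2 ^ k)) \<le> 1 + 2 ^ k"
      unfolding G(1) using G(2) norm_triangle_ineq4[of 1 "star c * G * c"]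
      by (simp add: norm_star nc)
    then show ?thesis using norm_power_selfadjoint[OF sh] by simp
  qed
  \<comment> \<open>For self-adjoint \<open>h\<close> and n = 2 ^ k the norm of \<open>h ^ n\<close>
    is \<open>norm h ^ n\<close>; with \<open>norm h\<close> > 1 this outgrows the linear bound 1 +
    n.\<close>
  have "norm h \<le> 1"
  proof (rule ccontr)
    assume "\<not> norm h \<le> 1"
    then have "(\<lambda>n. real n / norm h ^ n) \<longlonglongrightarrow> 0" "(\<lambda>n. 1 / norm h ^ n) \<longlonglongrightarrow> 0"
      by (auto intro!: lim_n_over_pown LIMSEQ_divide_realpow_zero simp: not_le)
    from tendsto_add[OF this] have "(\<lambda>n. (1 + real n) / norm h ^ n) \<longlonglongrightarrow> 0"
      by (simp add: add_divide_distrib add.commute)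
    then have "\<forall>\<^sub>F n in sequentially. (1 + real n) / norm h ^ n < 1"
      by (rule order_tendstoD) simp
    then obtain n0 where n0: "\<And>n. n \<ge> n0 \<Longrightarrow> (1 + real n) / norm h ^ n < 1"
      by (auto simp: eventually_sequentially)
    have "n0 \<le> 2 ^ n0" by (simp add: less_imp_le)
    moreover have "0 < norm h ^ 2 ^ n0" using \<open>\<not> norm h \<le> 1\<close> by (intro zero_less_power) linarith
    ultimately show False using n0[of "2 ^ n0"] bound[of n0] by (simp add: divide_less_eq)
  qed
  then have "cpos (star c * c)"
    by (intro cposI[of _ 1]) (auto simp: star_mult star_star h_def)
  then have "cpos ((norm d * norm d) *\<^sub>R (star c * c))" by (rule cpos_scaleR) simp
  then show ?thesis using False by (simp add: c_def star_scaleR)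
qed

text \<open>Compare a = \<open>star c * c\<close> with its absolute value b, the root of a * a. The
  difference e = b - a is twice the negative part of a, and d = c * e makes
  \<open>star d * d\<close> negative. As \<open>d * star d + star d * d\<close> is positive, so is
  \<open>d * star d\<close>, and by \<open>cpos_swap\<close> also \<open>star d * d\<close>; this
  forces d = 0 and then e = 0.\<close>

theorem cpos_star_mult:
  fixes c :: "'b::cstar_algebra"
  shows "cpos (star c * c)"
proof -
  define a where "a = star c * c"
  have sa: "star a = a" by (simp add: a_def star_mult star_star)
  have "cpos (a * a)" using sa by (auto simp: cpos_def)
  from cpos_sqrt[OF cpos_star[OF this] norm_diff_cpos[OF this order_refl]]
  obtain b where b: "star b = b" "b * b = a * a" "norm (of_real (sqrt (norm (a * a))) - b) \<le> sqrt (norm (a * a))"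
    "\<And>z. z * (a * a) = a * a * z \<Longrightarrow> z * b = b * z" by metis
  have ab: "a * b = b * a" by (rule b(4)) (simp add: mult.assoc)
  have "cpos b" by (rule cposI[OF b(1) b(3)])
  from cpos_sqrt[OF cpos_star[OF this] norm_diff_cpos[OF this order_refl]]
  obtain q where q: "star q = q" "q * q = b" "\<And>z. z * b = b * z \<Longrightarrow> z * q = q * z" by metis
  define e where "e = b - a"
  have se: "star e = e" by (simp add: e_def star_diff b sa)
  have ae: "a * e = - (b * e)" by (simp add: e_def algebra_simps ab b)
  have eb: "e * b = b * e" by (simp add: e_def algebra_simps ab)
  have ea: "e * a = a * e" by (simp add: e_def algebra_simps ab)
  have qe: "e * q = q * e" by (rule q(3)[OF eb])
  define d where "d = c * e"
  have dd: "star d * d = e * (a * e)" by (simp add: d_def star_mult se a_def mult.assoc)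
  \<comment> \<open>With \<open>a * e = - (b * e)\<close> and b = q * q, the commuting factors
    regroup into minus the square of the self-adjoint \<open>q * e\<close>.\<close>
  also have "\<dots> = - ((q * e) * (q * e))"
    unfolding ae using q(2) qe eb by (metis (no_types, opaque_lifting) mult.assoc mult_minus_right)
  finally have neg: "- (star d * d) = (q * e) * (q * e)" by simp
  have "star (q * e) = q * e" by (simp add: star_mult se q(1) qe)
  with neg have pneg: "cpos (- (star d * d))" unfolding cpos_def by blast
  \<comment> \<open>Real and imaginary part of \<open>d\<close>: twice the sum of their squares is
    the sum of \<open>d * star d\<close> and \<open>star d * d\<close>.\<close>
  define x where "x = (1/2) *\<^sub>R (d + star d)"
  define y where "y = (1/2) *\<^sub>R scaleC \<i> (star d - d)"
  have sx: "star x = x" by (simp add: x_def star_scaleR star_add star_star add.commute)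
  have sy: "star y = y"
    by (simp add: y_def star_scaleR star_scaleC star_diff star_star scaleC_minus_left
        scaleC_diff_right)
  have "2 *\<^sub>R (x * x) + 2 *\<^sub>R (y * y) =
      (1/2) *\<^sub>R ((d + star d) * (d + star d) - (star d - d) * (star d - d))"
    by (simp add: x_def y_def scaleC_mult_left scaleC_mult_right scaleC_i_i scaleR_diff_right
        scaleC_scaleR)
  also have "(d + star d) * (d + star d) - (star d - d) * (star d - d) =
      2 *\<^sub>R (d * star d + star d * d)"
    by (simp add: algebra_simps scaleR_2)
  finally have "d * star d + star d * d = 2 *\<^sub>R (x * x) + 2 *\<^sub>R (y * y)" by simp
  then have "cpos (d * star d + star d * d)"
    using cpos_add[OF cpos_scaleR cpos_scaleR, of "x * x" 2 "y * y" 2] sx sy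
    by (auto simp: cpos_def)
  from cpos_add[OF this pneg] have "cpos (d * star d)" by simp
  then have "cpos (star d * d)" by (rule cpos_swap)
  then have "star d * d = 0" using cpos_antisym pneg by blast
  then have "d = 0" by (rule star_mult_self_eq_0)
  then have "a * e = 0" by (simp add: a_def d_def mult.assoc)
  then have "b * e = 0" using ae by simp
  then have "star e * e = 0" using \<open>a * e = 0\<close> unfolding se by (simp add: e_def left_diff_distrib)
  then have "e = 0" by (rule star_mult_self_eq_0)
  then show ?thesis using \<open>cpos b\<close> by (simp add: e_def a_def)
qed

section \<open>Gram kernels and semi-inner products\<close>

text \<open>Limits of Gram matrices replace the positive elements of \<open>M\<^sub>m(B)\<close>, so that no norm on matrices is
  needed.\<close>

definition gram :: "'i set \<Rightarrow> ('i \<Rightarrow> 'i \<Rightarrow> 'b::cstar_algebra) \<Rightarrow> bool" where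
  "gram F K \<longleftrightarrow> (\<forall>e>0. \<exists>D. \<forall>i\<in>F. \<forall>j\<in>F. norm (K i j - (\<Sum>c\<leftarrow>D. star (c i) * c j)) < e)"

lemma gramI:
  "(\<And>e. e > 0 \<Longrightarrow> \<exists>D. \<forall>i\<in>F. \<forall>j\<in>F. norm (K i j - (\<Sum>c\<leftarrow>D. star (c i) * c j)) < e) \<Longrightarrow> gram F K"
  by (simp add: gram_def)

lemma gramD:
  "gram F K \<Longrightarrow> e > 0 \<Longrightarrow>
    \<exists>D. \<forall>i\<in>F. \<forall>j\<in>F. norm (K i j - (\<Sum>c\<leftarrow>D. star (c i) * c j)) < e"
  by (simp add: gram_def)

lemma gramE:
  assumes "gram F K" "e > 0"
  obtains D where "\<And>i j. i \<in> F \<Longrightarrow> j \<in> F \<Longrightarrow> norm (K i j - (\<Sum>c\<leftarrow>D. star (c i) * c j)) < e"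
  using gramD[OF assms] by blast

lemma gram_exact: "(\<And>i j. i \<in> F \<Longrightarrow> j \<in> F \<Longrightarrow> K i j = (\<Sum>c\<leftarrow>D. star (c i) * c j)) \<Longrightarrow> gram F K"
  unfolding gram_def by (intro allI impI exI[of _ D]) simp

lemma gram_cong: "gram F K \<Longrightarrow> (\<And>i j. i \<in> F \<Longrightarrow> j \<in> F \<Longrightarrow> K i j = K' i j) \<Longrightarrow> gram F K'"
  by (simp add: gram_def)

lemma gram_pullback:
  assumes "gram (f ` F) K"
  shows "gram F (\<lambda>i j. K (f i) (f j))"
proof (rule gramI)
  fix e :: real assume "e > 0"
  then obtain D where "\<forall>i\<in>f ` F. \<forall>j\<in>f ` F. norm (K i j - (\<Sum>c\<leftarrow>D. star (c i) * c j)) < e"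
    using gramD[OF assms] by blast
  then show "\<exists>D. \<forall>i\<in>F. \<forall>j\<in>F. norm (K (f i) (f j) - (\<Sum>c\<leftarrow>D. star (c i) * c j)) < e"
    by (intro exI[of _ "map (\<lambda>c. c \<circ> f) D"]) (simp add: comp_def)
qed

lemma gram_limit:
  assumes "\<And>e. e > 0 \<Longrightarrow> \<exists>K'. gram F K' \<and> (\<forall>i\<in>F. \<forall>j\<in>F. norm (K i j - K' i j) < e)"
  shows "gram F K"
proof (rule gramI)
  fix e :: real assume "e > 0"
  then obtain K' where K': "gram F K'" "\<forall>i\<in>F. \<forall>j\<in>F. norm (K i j - K' i j) < e / 2"
    using assms[of "e / 2"] by auto
  have "e / 2 > 0" using \<open>e > 0\<close> by simp
  then obtain D where
    D: "\<And>i j. i \<in> F \<Longrightarrow> j \<in> F \<Longrightarrow> norm (K' i j - (\<Sum>c\<leftarrow>D. star (c i) * c j)) < e / 2"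
    using gramE[OF K'(1)] by blast
  have "norm (K i j - (\<Sum>c\<leftarrow>D. star (c i) * c j)) < e" if "i \<in> F" "j \<in> F" for i j
    using K'(2)[rule_format, OF that] D[OF that]
      norm_triangle_ineq[of "K i j - K' i j" "K' i j - (\<Sum>c\<leftarrow>D. star (c i) * c j)"]
    by simp
  then show "\<exists>D. \<forall>i\<in>F. \<forall>j\<in>F. norm (K i j - (\<Sum>c\<leftarrow>D. star (c i) * c j)) < e" by blast
qed

lemma gram_add:
  assumes "gram F K" "gram F K'"
  shows "gram F (\<lambda>i j. K i j + K' i j)"
proof (rule gramI)
  fix e :: real assume "e > 0"
  then have e: "e / 2 > 0" by simp
  obtain D where D: "\<And>i j. i \<in> F \<Longrightarrow> j \<in> F \<Longrightarrow> norm (K i j - (\<Sum>c\<leftarrow>D. star (c i) * c j)) < e / 2"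
    using gramE[OF assms(1) e] by blast
  obtain D' where D': "\<And>i j. i \<in> F \<Longrightarrow> j \<in> F \<Longrightarrow> norm (K' i j - (\<Sum>c\<leftarrow>D'. star (c i) * c j)) < e / 2"
    using gramE[OF assms(2) e] by blast
  have "norm (K i j + K' i j - (\<Sum>c\<leftarrow>D @ D'. star (c i) * c j)) < e" if "i \<in> F" "j \<in> F" for i j
  proof -
    have "K i j + K' i j - (\<Sum>c\<leftarrow>D @ D'. star (c i) * c j) =
      (K i j - (\<Sum>c\<leftarrow>D. star (c i) * c j)) + (K' i j - (\<Sum>c\<leftarrow>D'. star (c i) * c j))" by simp
    also have "norm \<dots> < e"
      using D[OF that] D'[OF that] by (intro order.strict_trans1[OF norm_triangle_ineq]) simp
    finally show ?thesis .
  qed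
  then show "\<exists>D. \<forall>i\<in>F. \<forall>j\<in>F. norm (K i j + K' i j - (\<Sum>c\<leftarrow>D. star (c i) * c j)) < e" by blast
qed

lemma gram_zero: "gram F (\<lambda>i j. 0)"
  by (rule gram_exact[of _ _ "[]"]) simp

lemma gram_sum_list:
  "(\<And>x. x \<in> set xs \<Longrightarrow> gram F (K x)) \<Longrightarrow> gram F (\<lambda>i j. \<Sum>x\<leftarrow>xs. K x i j)"
  by (induction xs) (auto simp: gram_zero gram_add)

lemma gram_sum:
  "finite I \<Longrightarrow> (\<And>x. x \<in> I \<Longrightarrow> gram F (K x)) \<Longrightarrow> gram F (\<lambda>i j. \<Sum>x\<in>I. K x i j)"
  by (induction rule: finite_induct) (auto simp: gram_zero gram_add)

text \<open>Extending the approximating functions by zero cuts out a diagonal block; sums over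
  blocks then treat words with different first letters separately.\<close>

lemma gram_mask:
  assumes "gram {i \<in> F. P i} K"
  shows "gram F (\<lambda>i j. if P i \<and> P j then K i j else 0)"
proof (rule gramI)
  fix e :: real assume e: "e > 0"
  obtain D where D: "\<And>i j. i \<in> F \<Longrightarrow> P i \<Longrightarrow> j \<in> F \<Longrightarrow> P j \<Longrightarrow> norm (K i j - (\<Sum>c\<leftarrow>D. star (c i) * c j)) < e"
    using gramD[OF assms e] by auto
  have "(\<Sum>c\<leftarrow>map (\<lambda>c i. if P i then c i else 0) D. star (c i) * c j) =
      (if P i \<and> P j then \<Sum>c\<leftarrow>D. star (c i) * c j else 0)" for i j
    by (induction D) (auto simp: star_zero)
  with D e show "\<exists>D. \<forall>i\<in>F. \<forall>j\<in>F. norm ((if P i \<and> P j then K i j else 0)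
      - (\<Sum>c\<leftarrow>D. star (c i) * c j)) < e"
    by (intro exI[of _ "map (\<lambda>c i. if P i then c i else 0) D"]) auto
qed

lemma norm_sum_list_le:
  "(\<And>x. x \<in> set xs \<Longrightarrow> norm (f x) \<le> c) \<Longrightarrow> norm (\<Sum>x\<leftarrow>xs. f x :: 'b::real_normed_vector) \<le> real (length xs) * (c::real)"
proof (induction xs)
  case (Cons x xs)
  have "norm (f x + (\<Sum>x\<leftarrow>xs. f x)) \<le> c + length xs * c"
    using Cons by (intro norm_triangle_le add_mono) auto
  then show ?case by (simp add: algebra_simps)
qed simp

lemma sum_list_swap:
  "(\<Sum>x\<leftarrow>xs. \<Sum>y\<leftarrow>ys. f x y :: 'b::comm_monoid_add) = (\<Sum>y\<leftarrow>ys. \<Sum>x\<leftarrow>xs. f x y)"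
  by (induction xs) (auto simp: sum_list_addf)

text \<open>Functions on the entries extend to lists by summation, which carries the Gram property
  from elementary tensors to formal sums; the lengths are bounded on the finite set
  \<open>F\<close>, so the errors stay small.\<close>

lemma gram_lists:
  assumes fin: "finite F" and g: "gram (\<Union>(set ` F)) K"
  shows "gram F (\<lambda>us vs. \<Sum>u\<leftarrow>us. \<Sum>v\<leftarrow>vs. K u v)"
proof (rule gramI)
  fix e :: real assume e: "e > 0"
  define L where "L = Max (insert 0 (length ` F))"
  have L: "length us \<le> L" if "us \<in> F" for us using fin that by (auto simp: L_def intro: Max_ge)
  \<comment> \<open>A pair of lists has at most L * L pairs of entries; the summand 1 avoids a
    division by 0 when all lists are empty.\<close>
  define d where "d = e / (2 * (real L * real L + 1))"
  have pos: "real L * real L + 1 > 0" by (simp add: add_nonneg_pos)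
  then have d: "d > 0" using e by (simp add: d_def)
  then obtain D where
    D: "\<And>u v. u \<in> \<Union>(set ` F) \<Longrightarrow> v \<in> \<Union>(set ` F) \<Longrightarrow> norm (K u v - (\<Sum>c\<leftarrow>D. star (c u) * c v)) < d"
    using gramE[OF g] by blast
  define D' where "D' = map (\<lambda>c us. \<Sum>u\<leftarrow>us. c u) D"
  have D'_eq: "(\<Sum>c\<leftarrow>D'. star (c us) * c vs) = (\<Sum>u\<leftarrow>us. \<Sum>v\<leftarrow>vs. \<Sum>c\<leftarrow>D. star (c u) * c v)" for us vs
  proof -
    have "(\<Sum>c\<leftarrow>D'. star (c us) * c vs) = (\<Sum>c\<leftarrow>D. \<Sum>u\<leftarrow>us. \<Sum>v\<leftarrow>vs. star (c u) * c v)"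
      by (simp add: D'_def star_sum_list comp_def sum_list_const_mult flip: sum_list_mult_const)
    also have "\<dots> = (\<Sum>u\<leftarrow>us. \<Sum>c\<leftarrow>D. \<Sum>v\<leftarrow>vs. star (c u) * c v)" by (rule sum_list_swap)
    also have "\<dots> = (\<Sum>u\<leftarrow>us. \<Sum>v\<leftarrow>vs. \<Sum>c\<leftarrow>D. star (c u) * c v)" by (simp add: sum_list_swap[of _ _ D])
    finally show ?thesis .
  qed
  have "norm ((\<Sum>u\<leftarrow>us. \<Sum>v\<leftarrow>vs. K u v) - (\<Sum>c\<leftarrow>D'. star (c us) * c vs)) < e"
    if us: "us \<in> F" and vs: "vs \<in> F" for us vs
  proof -
    have "(\<Sum>u\<leftarrow>us. \<Sum>v\<leftarrow>vs. K u v) - (\<Sum>c\<leftarrow>D'. star (c us) * c vs) =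
       (\<Sum>u\<leftarrow>us. \<Sum>v\<leftarrow>vs. K u v - (\<Sum>c\<leftarrow>D. star (c u) * c v))"
      by (simp add: D'_eq sum_list_subtractf)
    also have "norm \<dots> \<le> length us * (length vs * d)"
      by (intro norm_sum_list_le less_imp_le[OF D]) (use us vs in auto)
    also have "\<dots> \<le> L * (L * d)"
      using L[OF us] L[OF vs] d by (intro mult_mono) auto
    also have "\<dots> < e"
    proof -
      have "z * (e / (2 * (z + 1))) < e" if "z \<ge> 0" for z :: real
      proof -
        have "z * e < e * (2 * (z + 1))" using e that by (simp add: algebra_simps add_nonneg_pos)
        then show ?thesis using that by (simp add: pos_divide_less_eq)
      qed
      from this[of "real L * real L"] show ?thesis by (simp add: d_def mult.assoc)
    qed
    finally show ?thesis .
  qed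
  then show "\<exists>D. \<forall>us\<in>F. \<forall>vs\<in>F. norm ((\<Sum>u\<leftarrow>us. \<Sum>v\<leftarrow>vs. K u v)
      - (\<Sum>c\<leftarrow>D. star (c us) * c vs)) < e" by blast
qed

lemma gram_star:
  assumes g: "gram F K" and ij: "i \<in> F" "j \<in> F"
  shows "star (K i j) = K j i"
proof -
  have "norm (star (K i j) - K j i) \<le> e" if "e > 0" for e :: real
  proof -
    have "e / 2 > 0" using that by simp
    then obtain D where
      D: "\<And>i j. i \<in> F \<Longrightarrow> j \<in> F \<Longrightarrow> norm (K i j - (\<Sum>c\<leftarrow>D. star (c i) * c j)) < e / 2"
      using gramE[OF g] by blast
    define S where "S i j = (\<Sum>c\<leftarrow>D. star (c i) * c j)" for i j
    have S: "star (S i j) = S j i" by (simp add: S_def star_sum_list star_mult star_star)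
    have "norm (star (K i j) - star (S i j)) < e / 2"
      using D ij by (simp add: S_def norm_star flip: star_diff)
    moreover have "norm (S j i - K j i) < e / 2" using D ij by (simp add: S_def norm_minus_commute)
    ultimately show ?thesis
      using norm_triangle_ineq[of "star (K i j) - star (S i j)" "S j i - K j i"] by (simp add: S)
  qed
  then have "norm (star (K i j) - K j i) \<le> 0" by (rule dense_ge)
  then show ?thesis by simp
qed

lemma gram_cpos:
  assumes g: "gram F K" and i: "i \<in> F"
  shows "cpos (K i i)"
proof (rule cpos_closed)
  fix e :: real assume "e > 0"
  then obtain D where "norm (K i i - (\<Sum>c\<leftarrow>D. star (c i) * c i)) < e" using gramD[OF g] i by meson
  moreover have "cpos (\<Sum>c\<leftarrow>D. star (c i) * c i)" by (intro cpos_sum_list cpos_star_mult)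
  ultimately show "\<exists>a'. cpos a' \<and> norm (K i i - a') < e" by blast
qed

text \<open>Module laws are required only after pairing with a vector, because formal sums of
  elementary tensors satisfy them only up to null vectors. Positivity is required of all finite Gram
  kernels, a form that tensor products and completions inherit; Hermitian symmetry follows from
  it.\<close>

locale pre_correspondence =
  fixes V :: "('b::cstar_algebra, 'v) corr"
  assumes zero_closed [simp]: "hzero V \<in> hcarrier V"
    and add_closed [simp]: "h \<in> hcarrier V \<Longrightarrow> k \<in> hcarrier V \<Longrightarrow> hadd V h k \<in> hcarrier V"
    and lact_closed [simp]: "h \<in> hcarrier V \<Longrightarrow> hlact V a h \<in> hcarrier V"
    and ract_closed [simp]: "h \<in> hcarrier V \<Longrightarrow> hract V h a \<in> hcarrier V"
    and ip_add_right: "g \<in> hcarrier V \<Longrightarrow> h \<in> hcarrier V \<Longrightarrow> k \<in> hcarrier V \<Longrightarrow>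
      hip V g (hadd V h k) = hip V g h + hip V g k"
    and ip_zero_right: "g \<in> hcarrier V \<Longrightarrow> hip V g (hzero V) = 0"
    and ip_ract_right: "g \<in> hcarrier V \<Longrightarrow> h \<in> hcarrier V \<Longrightarrow> hip V g (hract V h b) = hip V g h * b"
    and ip_lact_left: "g \<in> hcarrier V \<Longrightarrow> h \<in> hcarrier V \<Longrightarrow>
      hip V (hlact V a g) h = hip V g (hlact V (star a) h)"
    and ip_lact_add: "g \<in> hcarrier V \<Longrightarrow> h \<in> hcarrier V \<Longrightarrow>
      hip V g (hlact V (a + b) h) = hip V g (hlact V a h) + hip V g (hlact V b h)"
    and ip_lact_mult: "g \<in> hcarrier V \<Longrightarrow> h \<in> hcarrier V \<Longrightarrow>
      hip V g (hlact V (a * b) h) = hip V g (hlact V a (hlact V b h))"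
    and ip_lact_one: "g \<in> hcarrier V \<Longrightarrow> h \<in> hcarrier V \<Longrightarrow> hip V g (hlact V 1 h) = hip V g h"
    and ip_lact_scaleC: "g \<in> hcarrier V \<Longrightarrow> h \<in> hcarrier V \<Longrightarrow>
      hip V g (hlact V (scaleC c 1) h) = scaleC c (hip V g h)"
    and gram_ip: "finite F \<Longrightarrow> F \<subseteq> hcarrier V \<Longrightarrow> gram F (hip V)"
begin

lemma ip_star: "g \<in> hcarrier V \<Longrightarrow> h \<in> hcarrier V \<Longrightarrow> star (hip V g h) = hip V h g"
  using gram_star[OF gram_ip[of "{g, h}"]] by simp

lemma ip_cpos: "h \<in> hcarrier V \<Longrightarrow> cpos (hip V h h)"
  using gram_cpos[OF gram_ip[of "{h}"]] by simp

lemma ip_add_left: "g \<in> hcarrier V \<Longrightarrow> h \<in> hcarrier V \<Longrightarrow> k \<in> hcarrier V \<Longrightarrow>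
    hip V (hadd V g h) k = hip V g k + hip V h k"
  using arg_cong[of _ _ star, OF ip_add_right[of k g h]] by (simp add: star_add ip_star)

lemma ip_zero_left: "g \<in> hcarrier V \<Longrightarrow> hip V (hzero V) g = 0"
  by (metis ip_star ip_zero_right star_zero zero_closed)

lemma ip_ract_left: "g \<in> hcarrier V \<Longrightarrow> h \<in> hcarrier V \<Longrightarrow> hip V (hract V g b) h = star b * hip V g h"
  using arg_cong[of _ _ star, OF ip_ract_right[of h g b]] by (simp add: star_mult ip_star)

lemma ip_lact_right: "g \<in> hcarrier V \<Longrightarrow> h \<in> hcarrier V \<Longrightarrow>
    hip V g (hlact V a h) = hip V (hlact V (star a) g) h"
  by (simp add: ip_lact_left star_star)

lemma ip_lact_hadd: "g \<in> hcarrier V \<Longrightarrow> h \<in> hcarrier V \<Longrightarrow> k \<in> hcarrier V \<Longrightarrow>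
    hip V g (hlact V a (hadd V h k)) = hip V g (hlact V a h) + hip V g (hlact V a k)"
  by (simp add: ip_lact_right ip_add_right)

lemma diff_closed [simp]: "g \<in> hcarrier V \<Longrightarrow> h \<in> hcarrier V \<Longrightarrow> hdiff V g h \<in> hcarrier V"
  by (simp add: hdiff_def)

lemma ip_diff_right: "g \<in> hcarrier V \<Longrightarrow> h \<in> hcarrier V \<Longrightarrow> k \<in> hcarrier V \<Longrightarrow>
    hip V g (hdiff V h k) = hip V g h - hip V g k"
  by (simp add: hdiff_def ip_add_right ip_ract_right)

lemma ip_diff_left: "g \<in> hcarrier V \<Longrightarrow> h \<in> hcarrier V \<Longrightarrow> k \<in> hcarrier V \<Longrightarrow>
    hip V (hdiff V g h) k = hip V g k - hip V h k"
  by (simp add: hdiff_def ip_add_left ip_ract_left star_minus star_one)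

lemma ip_lact_of_real: "g \<in> hcarrier V \<Longrightarrow> h \<in> hcarrier V \<Longrightarrow>
    hip V g (hlact V (of_real r) h) = r *\<^sub>R hip V g h"
  using ip_lact_scaleC[of g h "complex_of_real r"]
  by (simp only: scaleC_of_real of_real_def[symmetric, where 'a = 'b])

lemma ip_lact_zero: "g \<in> hcarrier V \<Longrightarrow> h \<in> hcarrier V \<Longrightarrow> hip V g (hlact V 0 h) = 0"
  using ip_lact_of_real[of g h 0] by simp

lemma ip_lact_minus: "g \<in> hcarrier V \<Longrightarrow> h \<in> hcarrier V \<Longrightarrow>
    hip V g (hlact V (- a) h) = - hip V g (hlact V a h)"
  using ip_lact_add[of g h a "- a"] by (simp add: ip_lact_zero eq_neg_iff_add_eq_0 add.commute)

lemma ip_lact_diff: "g \<in> hcarrier V \<Longrightarrow> h \<in> hcarrier V \<Longrightarrow>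
    hip V g (hlact V (a - b) h) = hip V g (hlact V a h) - hip V g (hlact V b h)"
  using ip_lact_add[of g h a "- b"] by (simp add: ip_lact_minus)

lemma hnorm_nonneg [simp]: "hnorm V h \<ge> 0"
  by (simp add: hnorm_def)

lemma hnorm_power2: "(hnorm V h)\<^sup>2 = norm (hip V h h)"
  by (simp add: hnorm_def)

text \<open>The vector k - h t x with x = \<langle>h, k\<rangle> has positive square; in it
  \<open>star x * A * x\<close> is replaced by its upper bound r \<open>star x * x\<close>, and
  norms are taken. The real parameter t is kept free in order to cover null vectors \<open>h\<close>
  as well.\<close>

theorem Cauchy_Schwarz:
  assumes h: "h \<in> hcarrier V" and k: "k \<in> hcarrier V"
  shows "norm (hip V h k) \<le> hnorm V h * hnorm V k"
proof -
  define x where "x = hip V h k"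
  define A where "A = hip V h h"
  define r where "r = norm A"
  have key: "(2 * t - t * t * r) * (norm x)\<^sup>2 \<le> norm (hip V k k)" if t: "2 * t - t * t * r \<ge> 0" for t
  proof -
    have "cpos (of_real r - A)"
      by (intro cpos_norm_minus cpos_star) (auto simp: A_def r_def ip_cpos h)
    then obtain s where s: "star s = s" "of_real r - A = s * s" by (auto simp: cpos_def)
    have "star x * (of_real r - A) * x = star (s * x) * (s * x)"
      by (simp add: s star_mult mult.assoc)
    also have "star x * (of_real r - A) * x = r *\<^sub>R (star x * x) - star x * A * x"
      by (simp add: of_real_def algebra_simps)
    finally have c1: "cpos (r *\<^sub>R (star x * x) - star x * A * x)" by (simp add: cpos_star_mult)
    define v where "v = hadd V (hract V h (- (t *\<^sub>R x))) k"
    have v: "v \<in> hcarrier V" using h k by (simp add: v_def)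
    have "hip V v v = (t * t) *\<^sub>R (star x * A * x) - (2 * t) *\<^sub>R (star x * x) + hip V k k"
    proof -
      have "hip V k h = star x" by (simp add: x_def ip_star h k)
      then show ?thesis
        using h k by (simp add: v_def ip_add_left ip_add_right ip_ract_left ip_ract_right star_minus
            star_scaleR flip: x_def A_def)
          (simp add: algebra_simps flip: scaleR_2 scaleR_add_left)
    qed
    then have c2: "cpos ((t * t) *\<^sub>R (star x * A * x) - (2 * t) *\<^sub>R (star x * x) + hip V k k)"
      using ip_cpos[OF v] by simp
    have "(t * t) *\<^sub>R (star x * A * x) - (2 * t) *\<^sub>R (star x * x) + hip V k k
        + (t * t) *\<^sub>R (r *\<^sub>R (star x * x) - star x * A * x)
      = hip V k k - (2 * t - t * t * r) *\<^sub>R (star x * x)"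
      by (simp add: algebra_simps)
    note eq = this
    have "cpos (hip V k k - (2 * t - t * t * r) *\<^sub>R (star x * x))"
      using cpos_add[OF c2 cpos_scaleR[OF c1, of "t * t"]] unfolding eq by simp
    then have "norm ((2 * t - t * t * r) *\<^sub>R (star x * x)) \<le> norm (hip V k k)"
      by (intro cpos_norm_mono cpos_scaleR cpos_star_mult t)
    then show ?thesis using t by (simp add: cstar_identity)
  qed
  have "(norm x)\<^sup>2 \<le> r * norm (hip V k k)"
  proof (cases "r = 0")
    case True
    have "norm x = 0"
    proof (rule ccontr)
      assume "norm x \<noteq> 0"
      then have pos: "(norm x)\<^sup>2 > 0" by simp
      \<comment> \<open>For r = 0 the factor in \<open>key\<close> is 2 * t, and this t makes the
        left side exceed the right one by 1.\<close>
      define t where "t = (norm (hip V k k) + 1) / (2 * (norm x)\<^sup>2)"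
      have "(2 * t - t * t * r) * (norm x)\<^sup>2 \<le> norm (hip V k k)"
        by (rule key) (simp add: t_def True)
      then show False using pos by (simp add: t_def True)
    qed
    then show ?thesis by (simp add: True)
  next
    case False
    then have r: "r > 0" by (simp add: r_def)
    have "(2 * (1/r) - (1/r) * (1/r) * r) * (norm x)\<^sup>2 \<le> norm (hip V k k)"
      by (rule key) (use r in simp)
    then have "(1 / r) * (norm x)\<^sup>2 \<le> norm (hip V k k)" using r by simp
    then show ?thesis using r by (simp add: field_simps)
  qed
  also have "r * norm (hip V k k) = (hnorm V h * hnorm V k)\<^sup>2"
    by (simp add: r_def A_def power_mult_distrib hnorm_power2)
  finally show ?thesis unfolding x_def by (rule power2_le_imp_le) simp
qed

lemma hnorm_add:
  assumes "h \<in> hcarrier V" "k \<in> hcarrier V"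
  shows "hnorm V (hadd V h k) \<le> hnorm V h + hnorm V k"
proof -
  have "hip V (hadd V h k) (hadd V h k) = (hip V h h + hip V k k) + (hip V h k + hip V k h)"
    using assms by (simp add: ip_add_left ip_add_right)
  then have "norm (hip V (hadd V h k) (hadd V h k)) \<le>
      (norm (hip V h h) + norm (hip V k k)) + (norm (hip V h k) + norm (hip V k h))"
    by (simp only:) (intro order.trans[OF norm_triangle_ineq] add_mono norm_triangle_ineq)
  also have "\<dots> \<le> (hnorm V h + hnorm V k)\<^sup>2"
    using Cauchy_Schwarz[OF assms] Cauchy_Schwarz[OF assms(2,1)]
    unfolding power2_sum hnorm_power2 by (simp add: mult.commute[of "hnorm V k"])
  finally show ?thesis unfolding hnorm_power2[symmetric] by (rule power2_le_imp_le) simp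
qed

lemma hnorm_ract:
  assumes "h \<in> hcarrier V"
  shows "hnorm V (hract V h b) \<le> hnorm V h * norm b"
proof (rule power2_le_imp_le)
  have "hip V (hract V h b) (hract V h b) = star b * hip V h h * b"
    using assms by (simp add: ip_ract_left ip_ract_right mult.assoc)
  also have "norm \<dots> \<le> norm (star b) * norm (hip V h h) * norm b"
    by (meson norm_mult_ineq order.trans mult_right_mono norm_ge_zero)
  finally show "(hnorm V (hract V h b))\<^sup>2 \<le> (hnorm V h * norm b)\<^sup>2"
    by (simp add: hnorm_power2 power_mult_distrib norm_star) (simp add: power2_eq_square ac_simps)
qed simp

lemma hnorm_diff_commute:
  "h \<in> hcarrier V \<Longrightarrow> k \<in> hcarrier V \<Longrightarrow> hnorm V (hdiff V h k) = hnorm V (hdiff V k h)"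
  by (simp add: hnorm_def ip_diff_left ip_diff_right algebra_simps)

text \<open>For r = \<open>(norm a)\<^sup>2\<close> and \<open>of_real r - star a * a\<close> = s *
  s, the difference of r \<langle>h, h\<rangle> and \<langle>a h, a h\<rangle> is \<langle>s h, s
  h\<rangle>, hence positive.\<close>

lemma hnorm_lact:
  assumes h: "h \<in> hcarrier V"
  shows "hnorm V (hlact V a h) \<le> norm a * hnorm V h"
proof (rule power2_le_imp_le)
  define r where "r = (norm a)\<^sup>2"
  have "cpos (of_real r - star a * a)"
    by (rule cpos_norm_minus) (auto simp: star_mult star_star cstar_identity r_def)
  then obtain s where s: "star s = s" "of_real r - star a * a = s * s" by (auto simp: cpos_def)
  have "hip V h (hlact V (s * s) h) = hip V (hlact V s h) (hlact V s h)"
    using h by (simp add: ip_lact_mult ip_lact_left s)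
  moreover have "hip V h (hlact V (of_real r - star a * a) h) = r *\<^sub>R hip V h h - hip V (hlact V a h) (hlact V a h)"
    using h by (simp add: ip_lact_diff ip_lact_of_real ip_lact_mult ip_lact_left)
  ultimately have "cpos (r *\<^sub>R hip V h h - hip V (hlact V a h) (hlact V a h))"
    using ip_cpos[of "hlact V s h"] h by (simp add: s)
  then have "norm (hip V (hlact V a h) (hlact V a h)) \<le> norm (r *\<^sub>R hip V h h)"
    using h by (intro cpos_norm_mono ip_cpos) auto
  then show "(hnorm V (hlact V a h))\<^sup>2 \<le> (norm a * hnorm V h)\<^sup>2"
    by (simp add: power_mult_distrib hnorm_power2 r_def)
qed simp

text \<open>The substitute for an equation between vectors before separation.\<close>

lemma hnorm_eqI:
  assumes "h \<in> hcarrier V" "k \<in> hcarrier V" "\<And>g. g \<in> hcarrier V \<Longrightarrow> hip V g h = hip V g k"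
  shows "hnorm V h = hnorm V k"
  unfolding hnorm_def using assms by (metis ip_star)

lemma hnorm_zero: "hnorm V (hzero V) = 0"
  by (simp add: hnorm_def ip_zero_left)

lemma hnorm_diff_triangle:
  assumes "g \<in> hcarrier V" "h \<in> hcarrier V" "k \<in> hcarrier V"
  shows "hnorm V (hdiff V g k) \<le> hnorm V (hdiff V g h) + hnorm V (hdiff V h k)"
proof -
  have "hnorm V (hdiff V g k) = hnorm V (hadd V (hdiff V g h) (hdiff V h k))"
    using assms by (intro hnorm_eqI) (auto simp: ip_diff_right ip_add_right)
  then show ?thesis using hnorm_add assms by simp
qed

lemma hnorm_le_diff:
  assumes "h \<in> hcarrier V" "k \<in> hcarrier V"
  shows "hnorm V h \<le> hnorm V (hdiff V h k) + hnorm V k"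
proof -
  have "hnorm V h = hnorm V (hadd V (hdiff V h k) k)"
    using assms by (intro hnorm_eqI) (auto simp: ip_diff_right ip_add_right)
  then show ?thesis using hnorm_add assms by simp
qed

section \<open>Symmetric operators of geometric growth\<close>

lemma symmetric_power:
  assumes X: "\<And>h. h \<in> hcarrier V \<Longrightarrow> X h \<in> hcarrier V"
    and sym: "\<And>g h. g \<in> hcarrier V \<Longrightarrow> h \<in> hcarrier V \<Longrightarrow> hip V (X g) h = hip V g (X h)"
    and g: "g \<in> hcarrier V" and h: "h \<in> hcarrier V"
  shows "(X ^^ n) h \<in> hcarrier V \<and> hip V ((X ^^ n) g) h = hip V g ((X ^^ n) h)"
proof -
  have c: "(X ^^ n) k \<in> hcarrier V" if "k \<in> hcarrier V" for k n using that X by (induction n) auto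
  show ?thesis
  proof (intro conjI c h)
    show "hip V ((X ^^ n) g) h = hip V g ((X ^^ n) h)"
      using h g by (induction n arbitrary: h) (auto simp: sym c X simp flip: funpow_swap1)
  qed
qed

text \<open>For a symmetric operator, Cauchy-Schwarz makes \<open>n \<mapsto> hnorm V (X\<^sup>n h)\<close> logarithmically convex, so
  that geometric growth with some constant depending on \<open>h\<close> already bounds the first step.\<close>

lemma symmetric_bounded:
  assumes X: "\<And>h. h \<in> hcarrier V \<Longrightarrow> X h \<in> hcarrier V"
    and sym: "\<And>g h. g \<in> hcarrier V \<Longrightarrow> h \<in> hcarrier V \<Longrightarrow> hip V (X g) h = hip V g (X h)"
    and R: "R > 0" and h: "h \<in> hcarrier V"
    and growth: "\<And>n. hnorm V ((X ^^ n) h) \<le> c * R ^ n"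
  shows "hnorm V (X h) \<le> R * hnorm V h"
proof -
  define a where "a n = hnorm V ((X ^^ n) h)" for n
  have a2: "(a n)\<^sup>2 \<le> a 0 * a (2 * n)" for n
  proof -
    have c: "(X ^^ m) h \<in> hcarrier V" for m using symmetric_power[OF X sym h h] by blast
    have "hip V ((X ^^ n) h) ((X ^^ n) h) = hip V h ((X ^^ n) ((X ^^ n) h))"
      using symmetric_power[OF X sym h c[of n]] by blast
    also have "(X ^^ n) ((X ^^ n) h) = (X ^^ (2 * n)) h" by (simp add: mult_2 funpow_add)
    finally have "(a n)\<^sup>2 = norm (hip V h ((X ^^ (2 * n)) h))" by (simp add: a_def hnorm_power2)
    then show ?thesis using Cauchy_Schwarz[OF h c[of "2 * n"]] by (simp add: a_def)
  qed
  show ?thesis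
  proof (cases "a 0 = 0")
    case True
    then have "a 1 = 0" using a2[of 1] by simp
    then show ?thesis using True by (simp add: a_def)
  next
    case False
    then have a0: "a 0 > 0" by (simp add: a_def less_le)
    define q where "q = a 1 / a 0"
    have q0: "q \<ge> 0" using a0 by (simp add: q_def a_def)
    \<comment> \<open>Squaring the bound and applying \<open>a2\<close> doubles the exponent, so
      powers of two are the exponents within reach; they suffice to refute q > R by comparing
      growth.\<close>
    have pow: "q ^ (2 ^ k) \<le> a (2 ^ k) / a 0" for k :: nat
    proof (induction k)
      case (Suc k)
      have "q ^ (2 ^ Suc k) = (q ^ (2 ^ k))\<^sup>2" by (simp add: mult.commute flip: power_mult)
      also have "\<dots> \<le> (a (2 ^ k) / a 0)\<^sup>2" by (rule power_mono[OF Suc]) (simp add: q0)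
      also have "\<dots> \<le> a (2 ^ Suc k) / a 0"
        using a2[of "2 ^ k"] a0 by (simp add: power_divide divide_le_eq power2_eq_square mult.commute)
      finally show ?case .
    qed (simp add: q_def)
    have "q \<le> R"
    proof (rule ccontr)
      assume "\<not> q \<le> R"
      then have "1 < q / R" using R by simp
      then obtain n where n: "c / a 0 < (q / R) ^ n" using real_arch_pow by blast
      have "(q / R) ^ n \<le> (q / R) ^ (2 ^ n)"
        using \<open>1 < q / R\<close> by (intro power_increasing) (auto simp: less_imp_le)
      also have "\<dots> = q ^ (2 ^ n) / R ^ (2 ^ n)" by (simp add: power_divide)
      also have "\<dots> \<le> (c * R ^ (2 ^ n) / a 0) / R ^ (2 ^ n)"
        using a0 R growth[of "2 ^ n"]
        by (intro divide_right_mono order.trans[OF pow[of n]]) (auto simp: a_def)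
      also have "\<dots> = c / a 0" using R by simp
      finally show False using n by simp
    qed
    then show ?thesis using a0 by (simp add: q_def a_def divide_le_eq)
  qed
qed

end

section \<open>Separation and completion\<close>

lemma tendsto_zero_sandwich:
  fixes a b :: "nat \<Rightarrow> real"
  assumes "b \<longlonglongrightarrow> 0" "\<And>n. 0 \<le> a n" "\<And>n. a n \<le> b n"
  shows "a \<longlonglongrightarrow> 0"
  using assms by (intro tendsto_sandwich[OF _ _ tendsto_const assms(1)]) auto

lemma adjointable_closed: "x \<in> adjointables H \<Longrightarrow> h \<in> hcarrier H \<Longrightarrow> x h \<in> hcarrier H"
  by (auto simp: adjointables_def)

lemma adjointable_undefined: "x \<in> adjointables H \<Longrightarrow> h \<notin> hcarrier H \<Longrightarrow> x h = undefined"
  by (auto simp: adjointables_def PiE_def extensional_def)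

lemma adjointable_add: "x \<in> adjointables H \<Longrightarrow> h \<in> hcarrier H \<Longrightarrow> k \<in> hcarrier H \<Longrightarrow>
    x (hadd H h k) = hadd H (x h) (x k)"
  by (auto simp: adjointables_def)

lemma adjointable_ract: "x \<in> adjointables H \<Longrightarrow> h \<in> hcarrier H \<Longrightarrow> x (hract H h b) = hract H (x h) b"
  by (auto simp: adjointables_def)

lemma adjointable_bound:
  assumes "x \<in> adjointables H"
  obtains K where "K > 0" "\<And>h. h \<in> hcarrier H \<Longrightarrow> hnorm H (x h) \<le> K * hnorm H h"
proof -
  obtain K where K: "\<And>h. h \<in> hcarrier H \<Longrightarrow> hnorm H (x h) \<le> K * hnorm H h"
    using assms unfolding adjointables_def by blast
  have "hnorm H (x h) \<le> (\<bar>K\<bar> + 1) * hnorm H h" if "h \<in> hcarrier H" for h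
    by (rule order.trans[OF K[OF that]], rule mult_right_mono) (auto simp: hnorm_def)
  then show ?thesis by (intro that[of "\<bar>K\<bar> + 1"]) auto
qed

lemma adjointable_adjoint:
  assumes "x \<in> adjointables H"
  obtains y where "\<And>h. h \<in> hcarrier H \<Longrightarrow> y h \<in> hcarrier H"
    "\<And>h k. h \<in> hcarrier H \<Longrightarrow> k \<in> hcarrier H \<Longrightarrow> hip H (x h) k = hip H h (y k)"
proof -
  obtain y where "y \<in> hcarrier H \<rightarrow> hcarrier H"
    "\<forall>h\<in>hcarrier H. \<forall>k\<in>hcarrier H. hip H (x h) k = hip H h (y k)"
    using assms unfolding adjointables_def by blast
  then show ?thesis using that by blast
qed

text \<open>Separation in weak form: the module laws, known only for pairings, become equations
  between vectors.\<close>

locale correspondence = pre_correspondence V for V :: "('b::cstar_algebra, 'v) corr" +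
  assumes separated: "h \<in> hcarrier V \<Longrightarrow> k \<in> hcarrier V \<Longrightarrow>
    (\<And>g. g \<in> hcarrier V \<Longrightarrow> hip V g h = hip V g k) \<Longrightarrow> h = k"

context pre_correspondence
begin

abbreviation cl :: "(nat \<Rightarrow> 'v) \<Rightarrow> (nat \<Rightarrow> 'v) set" where
  "cl f \<equiv> cauchy_rel V `` {f}"

lemma cauchyD: "f \<in> cauchy_seqs V \<Longrightarrow> f n \<in> hcarrier V"
  by (simp add: cauchy_seqs_def)

lemma cauchyE:
  assumes "f \<in> cauchy_seqs V" "e > 0"
  obtains M where "\<And>m n. m \<ge> M \<Longrightarrow> n \<ge> M \<Longrightarrow> hnorm V (hdiff V (f m) (f n)) < e"
  using assms unfolding cauchy_seqs_def by blast

lemma cauchyI: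
  assumes "\<And>n. f n \<in> hcarrier V"
    "\<And>e. e > 0 \<Longrightarrow> \<exists>M. \<forall>m\<ge>M. \<forall>n\<ge>M. hnorm V (hdiff V (f m) (f n)) < e"
  shows "f \<in> cauchy_seqs V"
  using assms by (simp add: cauchy_seqs_def)

lemma cauchy_const: "v \<in> hcarrier V \<Longrightarrow> (\<lambda>n. v) \<in> cauchy_seqs V"
  by (rule cauchyI) (auto simp: hnorm_def ip_diff_right)

lemma cauchy_bounded:
  assumes f: "f \<in> cauchy_seqs V"
  obtains B where "B > 0" "\<And>n. hnorm V (f n) \<le> B"
proof -
  obtain M where M: "\<And>m n. m \<ge> M \<Longrightarrow> n \<ge> M \<Longrightarrow> hnorm V (hdiff V (f m) (f n)) < 1"
    using cauchyE[OF f zero_less_one] by blast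
  define B where "B = Max ((\<lambda>n. hnorm V (f n)) ` {..M}) + 1"
  have Max: "hnorm V (f n) \<le> B - 1" if "n \<le> M" for n
    using that by (auto simp: B_def intro!: Max_ge)
  have "hnorm V (f n) \<le> B" for n
  proof (cases "n \<le> M")
    case True then show ?thesis using Max[of n] by simp
  next
    case False
    then show ?thesis
      using M[of n M] hnorm_le_diff[OF cauchyD[OF f] cauchyD[OF f], of n M] Max[of M] by simp
  qed
  moreover have "B > 0" using Max[of 0] hnorm_nonneg[of "f 0"] by linarith
  ultimately show ?thesis using that by blast
qed

lemma norm_ip_diff:
  assumes "f \<in> hcarrier V" "g \<in> hcarrier V" "f' \<in> hcarrier V" "g' \<in> hcarrier V"
  shows "norm (hip V f g - hip V f' g') \<le>
    hnorm V (hdiff V f f') * hnorm V g + hnorm V f' * hnorm V (hdiff V g g')"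
proof -
  have "hip V f g - hip V f' g' = hip V (hdiff V f f') g + hip V f' (hdiff V g g')"
    using assms by (simp add: ip_diff_left ip_diff_right)
  then show ?thesis
    using Cauchy_Schwarz assms diff_closed
    by (metis (no_types, lifting) add_mono norm_triangle_le)
qed

lemma ip_convergent:
  assumes f: "f \<in> cauchy_seqs V" and g: "g \<in> cauchy_seqs V"
  shows "convergent (\<lambda>n. hip V (f n) (g n))"
proof -
  obtain B C where B: "B > 0" "\<And>n. hnorm V (f n) \<le> B" and C: "C > 0" "\<And>n. hnorm V (g n) \<le> C"
    using cauchy_bounded f g by metis
  have "Cauchy (\<lambda>n. hip V (f n) (g n))"
  proof (rule CauchyI)
    fix e :: real assume e: "e > 0"
    obtain M where M: "\<And>m n. m \<ge> M \<Longrightarrow> n \<ge> M \<Longrightarrow> hnorm V (hdiff V (f m) (f n)) < e / (2 * C)"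
      using cauchyE[OF f, of "e / (2 * C)"] e C by auto
    obtain L where L: "\<And>m n. m \<ge> L \<Longrightarrow> n \<ge> L \<Longrightarrow> hnorm V (hdiff V (g m) (g n)) < e / (2 * B)"
      using cauchyE[OF g, of "e / (2 * B)"] e B by auto
    show "\<exists>M. \<forall>m\<ge>M. \<forall>n\<ge>M. norm (hip V (f m) (g m) - hip V (f n) (g n)) < e"
    proof (intro exI allI impI)
      fix m n assume m: "m \<ge> max M L" and n: "n \<ge> max M L"
      have "hnorm V (hdiff V (f m) (f n)) * hnorm V (g m) \<le> hnorm V (hdiff V (f m) (f n)) * C"
        by (intro mult_left_mono C) simp
      also have "\<dots> < e / (2 * C) * C" using m n C by (intro mult_strict_right_mono M) auto
      finally have 1: "hnorm V (hdiff V (f m) (f n)) * hnorm V (g m) < e / 2" using C by simp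
      have "hnorm V (f n) * hnorm V (hdiff V (g m) (g n)) \<le> B * hnorm V (hdiff V (g m) (g n))"
        by (intro mult_right_mono B) simp
      also have "\<dots> < B * (e / (2 * B))" using m n B by (intro mult_strict_left_mono L) auto
      finally have 2: "hnorm V (f n) * hnorm V (hdiff V (g m) (g n)) < e / 2" using B by simp
      show "norm (hip V (f m) (g m) - hip V (f n) (g n)) < e"
        using norm_ip_diff[OF cauchyD[OF f] cauchyD[OF g] cauchyD[OF f] cauchyD[OF g], of m m n n] 1 2
        by linarith
    qed
  qed
  then show ?thesis by (rule Cauchy_convergent)
qed

definition ip_lim :: "(nat \<Rightarrow> 'v) \<Rightarrow> (nat \<Rightarrow> 'v) \<Rightarrow> 'b" where
  "ip_lim f g = lim (\<lambda>n. hip V (f n) (g n))"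

lemma ip_lim: "f \<in> cauchy_seqs V \<Longrightarrow> g \<in> cauchy_seqs V \<Longrightarrow> (\<lambda>n. hip V (f n) (g n)) \<longlonglongrightarrow> ip_lim f g"
  using ip_convergent convergent_LIMSEQ_iff by (auto simp: ip_lim_def)

lemma ip_limI: "(\<lambda>n. hip V (f n) (g n)) \<longlonglongrightarrow> c \<Longrightarrow> ip_lim f g = c"
  by (simp add: ip_lim_def limI)

lemma equiv_cauchy_rel: "equiv (cauchy_seqs V) (cauchy_rel V)"
proof (rule equivI)
  show "cauchy_rel V \<subseteq> cauchy_seqs V \<times> cauchy_seqs V" by (auto simp: cauchy_rel_def)
  show "refl_on (cauchy_seqs V) (cauchy_rel V)"
    by (rule refl_onI) (auto simp: cauchy_rel_def hnorm_def ip_diff_right cauchyD)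
  show "sym (cauchy_rel V)"
    by (rule symI) (auto simp: cauchy_rel_def hnorm_diff_commute[OF cauchyD cauchyD])
  show "trans (cauchy_rel V)"
  proof (rule transI)
    fix f g h assume fg: "(f, g) \<in> cauchy_rel V" and gh: "(g, h) \<in> cauchy_rel V"
    then have c: "f \<in> cauchy_seqs V" "g \<in> cauchy_seqs V" "h \<in> cauchy_seqs V"
      by (auto simp: cauchy_rel_def)
    have "(\<lambda>n. hnorm V (hdiff V (f n) (g n)) + hnorm V (hdiff V (g n) (h n))) \<longlonglongrightarrow> 0"
      using fg gh by (intro tendsto_add_zero) (auto simp: cauchy_rel_def)
    then have "(\<lambda>n. hnorm V (hdiff V (f n) (h n))) \<longlonglongrightarrow> 0"
      by (rule tendsto_zero_sandwich) (intro hnorm_nonneg hnorm_diff_triangle cauchyD c)+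
    then show "(f, h) \<in> cauchy_rel V" using c by (simp add: cauchy_rel_def)
  qed
qed

lemma carrier_completion: "hcarrier (completion V) = cauchy_seqs V // cauchy_rel V"
  by (simp add: completion_def)

lemma cl_in [simp]: "f \<in> cauchy_seqs V \<Longrightarrow> cl f \<in> hcarrier (completion V)"
  by (simp add: carrier_completion quotientI)

lemma cl_cases:
  assumes "A \<in> hcarrier (completion V)"
  obtains f where "f \<in> cauchy_seqs V" "A = cl f"
  using assms by (auto simp: carrier_completion elim: quotientE)

lemma ip_lim_cong:
  assumes ff: "(f, f') \<in> cauchy_rel V" and gg: "(g, g') \<in> cauchy_rel V"
  shows "(\<lambda>n. hip V (f' n) (g' n)) \<longlonglongrightarrow> ip_lim f g"
proof -
  have c: "f \<in> cauchy_seqs V" "f' \<in> cauchy_seqs V" "g \<in> cauchy_seqs V" "g' \<in> cauchy_seqs V"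
    using ff gg by (auto simp: cauchy_rel_def)
  obtain B C where B: "\<And>n. hnorm V (f n) \<le> B" and C: "\<And>n. hnorm V (g' n) \<le> C"
    using cauchy_bounded c by metis
  have "(\<lambda>n. hip V (f' n) (g' n) - hip V (f n) (g n)) \<longlonglongrightarrow> 0"
  proof (rule Lim_null_comparison)
    have ff': "(f', f) \<in> cauchy_rel V" "(g', g) \<in> cauchy_rel V"
      using ff gg equiv_cauchy_rel by (meson equivE symE)+
    then have "(\<lambda>n. hnorm V (hdiff V (f' n) (f n)) * C + B * hnorm V (hdiff V (g' n) (g n))) \<longlonglongrightarrow> 0 * C + B * 0"
      by (intro tendsto_intros) (auto simp: cauchy_rel_def)
    then show "(\<lambda>n. hnorm V (hdiff V (f' n) (f n)) * C + B * hnorm V (hdiff V (g' n) (g n))) \<longlonglongrightarrow> 0"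
      by simp
    show "\<forall>\<^sub>F n in sequentially. norm (hip V (f' n) (g' n) - hip V (f n) (g n)) \<le>
        hnorm V (hdiff V (f' n) (f n)) * C + B * hnorm V (hdiff V (g' n) (g n))"
      by (intro always_eventually allI order.trans[OF norm_ip_diff] add_mono mult_left_mono
          mult_right_mono B C cauchyD c hnorm_nonneg)
  qed
  from tendsto_add[OF this ip_lim[OF c(1) c(3)]] show ?thesis by simp
qed

lemma hip_cl:
  assumes f: "f \<in> cauchy_seqs V" and g: "g \<in> cauchy_seqs V"
  shows "hip (completion V) (cl f) (cl g) = ip_lim f g"
proof -
  have refl: "(f, f) \<in> cauchy_rel V" "(g, g) \<in> cauchy_rel V"
    using f g equiv_cauchy_rel by (meson equivE refl_onD)+
  have "(THE c. \<forall>f'\<in>cl f. \<forall>g'\<in>cl g. (\<lambda>n. hip V (f' n) (g' n)) \<longlonglongrightarrow> c) = ip_lim f g"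
  proof (rule the_equality)
    show "\<forall>f'\<in>cl f. \<forall>g'\<in>cl g. (\<lambda>n. hip V (f' n) (g' n)) \<longlonglongrightarrow> ip_lim f g"
      by (auto intro: ip_lim_cong)
    fix c assume "\<forall>f'\<in>cl f. \<forall>g'\<in>cl g. (\<lambda>n. hip V (f' n) (g' n)) \<longlonglongrightarrow> c"
    then have "(\<lambda>n. hip V (f n) (g n)) \<longlonglongrightarrow> c" using refl by blast
    then show "c = ip_lim f g" by (simp add: ip_limI)
  qed
  then show ?thesis by (simp add: completion_def)
qed

lemma cl_eqI:
  assumes "f \<in> cauchy_seqs V" "g \<in> cauchy_seqs V" "(\<lambda>n. hnorm V (hdiff V (f n) (g n))) \<longlonglongrightarrow> 0"
  shows "cl f = cl g"
  using equiv_class_eq[OF equiv_cauchy_rel] assms by (simp add: cauchy_rel_def)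

lemma cl_eqI':
  assumes "f \<in> cauchy_seqs V" "g \<in> cauchy_seqs V"
    "\<And>n h. h \<in> hcarrier V \<Longrightarrow> hip V h (f n) = hip V h (g n)"
  shows "cl f = cl g"
proof (rule cl_eqI)
  have "hnorm V (hdiff V (f n) (g n)) = 0" for n
    unfolding hnorm_def by (subst ip_diff_right) (auto simp: assms cauchyD)
  then show "(\<lambda>n. hnorm V (hdiff V (f n) (g n))) \<longlonglongrightarrow> 0" by simp
qed (use assms in auto)

text \<open>The bound is put on differences, since maps on formal sums respect the additive
  structure only up to null vectors.\<close>

lemma cauchy_image:
  assumes X: "\<And>h. h \<in> hcarrier V \<Longrightarrow> X h \<in> hcarrier V"
    and b: "\<And>h k. h \<in> hcarrier V \<Longrightarrow> k \<in> hcarrier V \<Longrightarrow>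
      hnorm V (hdiff V (X h) (X k)) \<le> R * hnorm V (hdiff V h k)"
  shows "f \<in> cauchy_seqs V \<Longrightarrow> (\<lambda>n. X (f n)) \<in> cauchy_seqs V"
    and "(f, g) \<in> cauchy_rel V \<Longrightarrow> ((\<lambda>n. X (f n)), (\<lambda>n. X (g n))) \<in> cauchy_rel V"
proof -
  show seq: "(\<lambda>n. X (f n)) \<in> cauchy_seqs V" if f: "f \<in> cauchy_seqs V" for f
  proof (rule cauchyI)
    fix e :: real assume "e > 0"
    then have "e / (\<bar>R\<bar> + 1) > 0" by (simp add: add_nonneg_pos)
    then obtain M where M: "\<And>m n. m \<ge> M \<Longrightarrow> n \<ge> M \<Longrightarrow> hnorm V (hdiff V (f m) (f n)) < e / (\<bar>R\<bar> + 1)"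
      using cauchyE[OF f] by blast
    have "hnorm V (hdiff V (X (f m)) (X (f n))) < e" if "m \<ge> M" "n \<ge> M" for m n
    proof -
      have "hnorm V (hdiff V (X (f m)) (X (f n))) \<le> R * hnorm V (hdiff V (f m) (f n))"
        by (intro b cauchyD f)
      also have "\<dots> \<le> (\<bar>R\<bar> + 1) * hnorm V (hdiff V (f m) (f n))"
        by (intro mult_right_mono) auto
      also have "\<dots> < e" using M[OF that] by (simp add: pos_less_divide_eq mult.commute add_nonneg_pos)
      finally show ?thesis .
    qed
    then show "\<exists>M. \<forall>m\<ge>M. \<forall>n\<ge>M. hnorm V (hdiff V (X (f m)) (X (f n))) < e" by blast
  qed (use X cauchyD[OF f] in auto)
  assume fg: "(f, g) \<in> cauchy_rel V"
  then have c: "f \<in> cauchy_seqs V" "g \<in> cauchy_seqs V" by (auto simp: cauchy_rel_def)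
  have "(\<lambda>n. R * hnorm V (hdiff V (f n) (g n))) \<longlonglongrightarrow> 0"
    using fg by (intro tendsto_mult_right_zero) (auto simp: cauchy_rel_def)
  then have "(\<lambda>n. hnorm V (hdiff V (X (f n)) (X (g n)))) \<longlonglongrightarrow> 0"
    by (rule tendsto_zero_sandwich) (intro hnorm_nonneg b cauchyD c)+
  then show "((\<lambda>n. X (f n)), (\<lambda>n. X (g n))) \<in> cauchy_rel V"
    using seq c by (simp add: cauchy_rel_def)
qed

lemma cl_image:
  assumes X: "\<And>h. h \<in> hcarrier V \<Longrightarrow> X h \<in> hcarrier V"
    and b: "\<And>h k. h \<in> hcarrier V \<Longrightarrow> k \<in> hcarrier V \<Longrightarrow>
      hnorm V (hdiff V (X h) (X k)) \<le> R * hnorm V (hdiff V h k)"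
    and f: "f \<in> cauchy_seqs V"
  shows "(\<Union>f\<in>cl f. cl (\<lambda>n. X (f n))) = cl (\<lambda>n. X (f n))"
proof (rule UN_equiv_class[OF equiv_cauchy_rel _ f])
  show "(\<lambda>f. cl (\<lambda>n. X (f n))) respects cauchy_rel V"
    by (intro congruentI equiv_class_eq[OF equiv_cauchy_rel] cauchy_image[OF X b])
qed

lemma lact_diff_bound: "h \<in> hcarrier V \<Longrightarrow> k \<in> hcarrier V \<Longrightarrow>
    hnorm V (hdiff V (hlact V b h) (hlact V b k)) \<le> norm b * hnorm V (hdiff V h k)"
  by (rule order.trans[OF eq_refl[OF hnorm_eqI[where k = "hlact V b (hdiff V h k)"]] hnorm_lact])
    (auto simp: ip_diff_right ip_lact_right)

lemma ract_diff_bound: "h \<in> hcarrier V \<Longrightarrow> k \<in> hcarrier V \<Longrightarrow>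
    hnorm V (hdiff V (hract V h b) (hract V k b)) \<le> norm b * hnorm V (hdiff V h k)"
  by (rule order.trans[OF eq_refl[OF hnorm_eqI[where k = "hract V (hdiff V h k) b"]]
        order.trans[OF hnorm_ract]])
    (auto simp: ip_diff_right ip_ract_right mult.commute left_diff_distrib)

lemma cauchy_lact: "f \<in> cauchy_seqs V \<Longrightarrow> (\<lambda>n. hlact V b (f n)) \<in> cauchy_seqs V"
  by (rule cauchy_image(1)[OF _ lact_diff_bound]) auto

lemma cauchy_ract: "f \<in> cauchy_seqs V \<Longrightarrow> (\<lambda>n. hract V (f n) b) \<in> cauchy_seqs V"
  by (rule cauchy_image(1)[OF _ ract_diff_bound]) auto

lemma hlact_cl: "f \<in> cauchy_seqs V \<Longrightarrow> hlact (completion V) b (cl f) = cl (\<lambda>n. hlact V b (f n))"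
  by (simp add: completion_def cl_image[OF _ lact_diff_bound])

lemma hract_cl: "f \<in> cauchy_seqs V \<Longrightarrow> hract (completion V) (cl f) b = cl (\<lambda>n. hract V (f n) b)"
  by (simp add: completion_def cl_image[OF _ ract_diff_bound])

lemma hnorm_add_diff:
  assumes "f \<in> hcarrier V" "g \<in> hcarrier V" "f' \<in> hcarrier V" "g' \<in> hcarrier V"
  shows "hnorm V (hdiff V (hadd V f g) (hadd V f' g')) \<le> hnorm V (hdiff V f f') + hnorm V (hdiff V g g')"
  by (rule order.trans[OF eq_refl[OF hnorm_eqI[where k = "hadd V (hdiff V f f') (hdiff V g g')"]] hnorm_add])
    (use assms in \<open>auto simp: ip_diff_right ip_add_right\<close>)

lemma cauchy_add:
  assumes f: "f \<in> cauchy_seqs V" and g: "g \<in> cauchy_seqs V"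
  shows "(\<lambda>n. hadd V (f n) (g n)) \<in> cauchy_seqs V"
proof (rule cauchyI)
  fix e :: real assume "e > 0"
  then have e: "e / 2 > 0" by simp
  obtain M where M: "\<And>m n. m \<ge> M \<Longrightarrow> n \<ge> M \<Longrightarrow> hnorm V (hdiff V (f m) (f n)) < e / 2"
    using cauchyE[OF f e] by blast
  obtain L where L: "\<And>m n. m \<ge> L \<Longrightarrow> n \<ge> L \<Longrightarrow> hnorm V (hdiff V (g m) (g n)) < e / 2"
    using cauchyE[OF g e] by blast
  show "\<exists>M. \<forall>m\<ge>M. \<forall>n\<ge>M. hnorm V (hdiff V (hadd V (f m) (g m)) (hadd V (f n) (g n))) < e"
  proof (intro exI allI impI)
    fix m n assume "m \<ge> max M L" "n \<ge> max M L"
    then show "hnorm V (hdiff V (hadd V (f m) (g m)) (hadd V (f n) (g n))) < e"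
      using M[of m n] L[of m n]
        hnorm_add_diff[OF cauchyD[OF f] cauchyD[OF g] cauchyD[OF f] cauchyD[OF g], of m m n n] by simp
  qed
qed (simp add: cauchyD f g)

lemma hadd_cl:
  assumes f: "f \<in> cauchy_seqs V" and g: "g \<in> cauchy_seqs V"
  shows "hadd (completion V) (cl f) (cl g) = cl (\<lambda>n. hadd V (f n) (g n))"
proof -
  have "(\<Union>f\<in>cl f. \<Union>g\<in>cl g. cl (\<lambda>n. hadd V (f n) (g n))) = cl (\<lambda>n. hadd V (f n) (g n))"
  proof (rule UN_equiv_class2[OF equiv_cauchy_rel equiv_cauchy_rel _ f g])
    show "congruent2 (cauchy_rel V) (cauchy_rel V) (\<lambda>f g. cl (\<lambda>n. hadd V (f n) (g n)))"
    proof (rule congruent2I')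
      fix f f' g g' assume ff: "(f, f') \<in> cauchy_rel V" and gg: "(g, g') \<in> cauchy_rel V"
      then have c: "f \<in> cauchy_seqs V" "f' \<in> cauchy_seqs V" "g \<in> cauchy_seqs V" "g' \<in> cauchy_seqs V"
        by (auto simp: cauchy_rel_def)
      have "(\<lambda>n. hnorm V (hdiff V (f n) (f' n)) + hnorm V (hdiff V (g n) (g' n))) \<longlonglongrightarrow> 0"
        using ff gg by (intro tendsto_add_zero) (auto simp: cauchy_rel_def)
      then have "(\<lambda>n. hnorm V (hdiff V (hadd V (f n) (g n)) (hadd V (f' n) (g' n)))) \<longlonglongrightarrow> 0"
        by (rule tendsto_zero_sandwich) (intro hnorm_nonneg hnorm_add_diff cauchyD c)+
      then show "cl (\<lambda>n. hadd V (f n) (g n)) = cl (\<lambda>n. hadd V (f' n) (g' n))"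
        by (intro cl_eqI cauchy_add c)
    qed
  qed
  then show ?thesis by (simp add: completion_def)
qed

lemma hzero_cl: "hzero (completion V) = cl (\<lambda>n. hzero V)"
  by (simp add: completion_def)

lemma completion_correspondence: "correspondence (completion V)"
proof (unfold_locales, goal_cases)
  case 1 show ?case by (simp add: hzero_cl cauchy_const)
next
  case (2 A B)
  then show ?case by (auto elim!: cl_cases simp: hadd_cl cauchy_add)
next
  case (3 A a)
  then show ?case by (auto elim!: cl_cases simp: hlact_cl cauchy_lact)
next
  case (4 A a)
  then show ?case by (auto elim!: cl_cases simp: hract_cl cauchy_ract)
next
  case (5 G A B)
  then obtain f g h where c: "f \<in> cauchy_seqs V" "g \<in> cauchy_seqs V" "h \<in> cauchy_seqs V"
    and eq: "G = cl f" "A = cl g" "B = cl h" by (meson cl_cases)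
  show ?case unfolding eq using c
    by (simp add: hadd_cl hip_cl cauchy_add)
      (intro ip_limI, simp add: ip_add_right cauchyD tendsto_add ip_lim)
next
  case (6 G)
  then obtain f where c: "f \<in> cauchy_seqs V" and eq: "G = cl f" by (meson cl_cases)
  show ?case unfolding eq using c
    by (simp add: hzero_cl hip_cl cauchy_const) (intro ip_limI, simp add: ip_zero_right cauchyD)
next
  case (7 G A b)
  then obtain f g where c: "f \<in> cauchy_seqs V" "g \<in> cauchy_seqs V"
    and eq: "G = cl f" "A = cl g" by (meson cl_cases)
  show ?case unfolding eq using c
    by (simp add: hract_cl hip_cl cauchy_ract)
      (intro ip_limI, simp add: ip_ract_right cauchyD tendsto_mult_right ip_lim)
next
  case (8 G A a)
  then obtain f g where c: "f \<in> cauchy_seqs V" "g \<in> cauchy_seqs V"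
    and eq: "G = cl f" "A = cl g" by (meson cl_cases)
  show ?case unfolding eq using c
    by (simp add: hlact_cl hip_cl cauchy_lact) (simp add: ip_lim_def ip_lact_left cauchyD)
next
  case (9 G A a b)
  then obtain f g where c: "f \<in> cauchy_seqs V" "g \<in> cauchy_seqs V"
    and eq: "G = cl f" "A = cl g" by (meson cl_cases)
  have "(\<lambda>n. hip V (f n) (hlact V a (g n)) + hip V (f n) (hlact V b (g n)))
      \<longlonglongrightarrow> ip_lim f (\<lambda>n. hlact V a (g n)) + ip_lim f (\<lambda>n. hlact V b (g n))"
    using c by (intro tendsto_add ip_lim cauchy_lact)
  then show ?case unfolding eq using c
    by (simp add: hlact_cl hip_cl cauchy_lact) (intro ip_limI, simp add: ip_lact_add cauchyD)
next
  case (10 G A a b)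
  then obtain f g where c: "f \<in> cauchy_seqs V" "g \<in> cauchy_seqs V"
    and eq: "G = cl f" "A = cl g" by (meson cl_cases)
  show ?case unfolding eq using c
    by (simp add: hlact_cl hip_cl cauchy_lact) (simp add: ip_lim_def ip_lact_mult cauchyD)
next
  case (11 G A)
  then obtain f g where c: "f \<in> cauchy_seqs V" "g \<in> cauchy_seqs V"
    and eq: "G = cl f" "A = cl g" by (meson cl_cases)
  show ?case unfolding eq using c
    by (simp add: hlact_cl hip_cl cauchy_lact) (simp add: ip_lim_def ip_lact_one cauchyD)
next
  case (12 G A c)
  then obtain f g where fg: "f \<in> cauchy_seqs V" "g \<in> cauchy_seqs V"
    and eq: "G = cl f" "A = cl g" by (meson cl_cases)
  have "(\<lambda>n. scaleC c 1 * hip V (f n) (g n)) \<longlonglongrightarrow> scaleC c 1 * ip_lim f g"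
    using fg by (intro tendsto_mult_left ip_lim)
  then show ?case unfolding eq using fg
    by (simp add: hlact_cl hip_cl cauchy_lact)
      (intro ip_limI, simp add: ip_lact_scaleC cauchyD scaleC_mult_left)
next
  case (13 F)
  have "\<forall>A\<in>F. \<exists>f. f \<in> cauchy_seqs V \<and> A = cl f" using 13(2) by (meson cl_cases subsetD)
  then obtain r where r: "\<And>A. A \<in> F \<Longrightarrow> r A \<in> cauchy_seqs V" "\<And>A. A \<in> F \<Longrightarrow> A = cl (r A)"
    by metis
  have ip: "hip (completion V) A B = ip_lim (r A) (r B)" if "A \<in> F" "B \<in> F" for A B
    using hip_cl[OF r(1) r(1), OF that] r(2) that by metis
  show ?case
  \<comment> \<open>For finitely many classes one index n serves all pairs, and the n-th terms of
    the representatives have a Gram kernel close to that of the classes.\<close>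
  proof (rule gram_limit)
    fix e :: real assume e: "e > 0"
    have "\<forall>\<^sub>F n in sequentially. norm (hip V (r A n) (r B n) - ip_lim (r A) (r B)) < e"
      if "A \<in> F" "B \<in> F" for A B
      using tendstoD[OF ip_lim[OF r(1) r(1), OF that] e] by (simp add: dist_norm)
    then have "\<forall>\<^sub>F n in sequentially. \<forall>A\<in>F. \<forall>B\<in>F. norm (hip V (r A n) (r B n) - ip_lim (r A) (r B)) < e"
      using 13(1) by (intro eventually_ball_finite ballI)
    then obtain n where n: "\<And>A B. A \<in> F \<Longrightarrow> B \<in> F \<Longrightarrow>
        norm (hip V (r A n) (r B n) - ip_lim (r A) (r B)) < e"
      by (auto simp: eventually_sequentially)
    have "gram F (\<lambda>A B. hip V (r A n) (r B n))"
      by (rule gram_pullback, rule gram_ip) (use 13(1) r(1) cauchyD in auto)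
    then show "\<exists>K'. gram F K' \<and> (\<forall>i\<in>F. \<forall>j\<in>F. norm (hip (completion V) i j - K' i j) < e)"
      using n by (intro exI conjI) (auto simp: ip norm_minus_commute)
  qed
next
  case (14 A B)
  then obtain f g where c: "f \<in> cauchy_seqs V" "g \<in> cauchy_seqs V"
    and eq: "A = cl f" "B = cl g" by (meson cl_cases)
  define d where "d n = hdiff V (f n) (g n)" for n
  have d: "d \<in> cauchy_seqs V"
    unfolding d_def hdiff_def by (intro cauchy_add cauchy_ract c)
  have "hip (completion V) (cl d) (cl f) = hip (completion V) (cl d) (cl g)"
    using 14(3)[OF cl_in[OF d]] by (simp add: eq)
  then have "ip_lim d f = ip_lim d g" using c d by (simp add: hip_cl)
  then have "(\<lambda>n. hip V (d n) (f n) - hip V (d n) (g n)) \<longlonglongrightarrow> 0"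
    using tendsto_diff[OF ip_lim[OF d c(1)] ip_lim[OF d c(2)]] by simp
  then have "(\<lambda>n. hip V (d n) (d n)) \<longlonglongrightarrow> 0"
    using c by (simp add: d_def ip_diff_right cauchyD)
  then have "(\<lambda>n. sqrt (norm (hip V (d n) (d n)))) \<longlonglongrightarrow> sqrt (norm (0::'b))"
    by (intro tendsto_intros)
  then show ?case unfolding eq using c by (intro cl_eqI) (auto simp: hnorm_def d_def)
qed

section \<open>Classes of constant sequences and their density\<close>

lemma cls_eq: "cls V v = cl (\<lambda>n. v)"
  by (simp add: cls_def)

lemma cls_in [simp]: "v \<in> hcarrier V \<Longrightarrow> cls V v \<in> hcarrier (completion V)"
  by (simp add: cls_eq cauchy_const)

lemma hip_cls: "v \<in> hcarrier V \<Longrightarrow> w \<in> hcarrier V \<Longrightarrow> hip (completion V) (cls V v) (cls V w) = hip V v w"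
  by (simp add: cls_eq hip_cl cauchy_const ip_limI)

lemma hlact_cls: "v \<in> hcarrier V \<Longrightarrow> hlact (completion V) b (cls V v) = cls V (hlact V b v)"
  by (simp add: cls_eq hlact_cl cauchy_const)

lemma hract_cls: "v \<in> hcarrier V \<Longrightarrow> hract (completion V) (cls V v) b = cls V (hract V v b)"
  by (simp add: cls_eq hract_cl cauchy_const)

lemma hadd_cls: "v \<in> hcarrier V \<Longrightarrow> w \<in> hcarrier V \<Longrightarrow>
    hadd (completion V) (cls V v) (cls V w) = cls V (hadd V v w)"
  by (simp add: cls_eq hadd_cl cauchy_const)

lemma hzero_cls: "hzero (completion V) = cls V (hzero V)"
  by (simp add: cls_eq hzero_cl)

lemma cls_eqI: "v \<in> hcarrier V \<Longrightarrow> w \<in> hcarrier V \<Longrightarrow>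
    (\<And>h. h \<in> hcarrier V \<Longrightarrow> hip V h v = hip V h w) \<Longrightarrow> cls V v = cls V w"
  unfolding cls_eq by (intro cl_eqI' cauchy_const)

text \<open>The class of \<open>f n\<close> tends in norm to the class of \<open>f\<close>, because
  the Cauchy condition bounds the limit of the seminorms of \<open>f n\<close> - \<open>f m\<close>
  over m.\<close>

lemma hip_cl_limit:
  assumes f: "f \<in> cauchy_seqs V" and G: "G \<in> hcarrier (completion V)"
  shows "(\<lambda>n. hip (completion V) G (cls V (f n))) \<longlonglongrightarrow> hip (completion V) G (cl f)"
proof -
  interpret Q: correspondence "completion V" by (rule completion_correspondence)
  have le: "hnorm (completion V) (hdiff (completion V) (cls V (f n)) (cl f)) \<le> e"
    if M: "\<And>m. m \<ge> M \<Longrightarrow> hnorm V (hdiff V (f n) (f m)) < e" for n M e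
  proof -
    have d: "(\<lambda>m. hdiff V (f n) (f m)) \<in> cauchy_seqs V"
      unfolding hdiff_def by (intro cauchy_add cauchy_ract f cauchy_const cauchyD)
    have "hdiff (completion V) (cls V (f n)) (cl f) = cl (\<lambda>m. hdiff V (f n) (f m))"
      unfolding hdiff_def cls_eq using f
      by (simp add: hract_cl hadd_cl cauchy_const cauchy_ract cauchyD)
    then have "hnorm (completion V) (hdiff (completion V) (cls V (f n)) (cl f)) =
        sqrt (norm (ip_lim (\<lambda>m. hdiff V (f n) (f m)) (\<lambda>m. hdiff V (f n) (f m))))"
      using d by (simp add: hnorm_def hip_cl)
    moreover have "(\<lambda>m. hnorm V (hdiff V (f n) (f m))) \<longlonglongrightarrow> \<dots>"
      unfolding hnorm_def by (intro tendsto_intros ip_lim d)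
    ultimately show ?thesis using M
      by (intro LIMSEQ_le_const2[where X = "\<lambda>m. hnorm V (hdiff V (f n) (f m))"]) (auto intro: less_imp_le)
  qed
  have lim: "(\<lambda>n. hnorm (completion V) (hdiff (completion V) (cls V (f n)) (cl f))) \<longlonglongrightarrow> 0"
  proof (rule LIMSEQ_I)
    fix e :: real assume "e > 0"
    then have "e / 2 > 0" by simp
    then obtain M where M: "\<And>m n. m \<ge> M \<Longrightarrow> n \<ge> M \<Longrightarrow> hnorm V (hdiff V (f m) (f n)) < e / 2"
      using cauchyE[OF f] by blast
    have "norm (hnorm (completion V) (hdiff (completion V) (cls V (f n)) (cl f)) - 0) < e" if "n \<ge> M" for n
      using le[of M n "e / 2"] M[OF that] \<open>e > 0\<close> by simp
    then show "\<exists>no. \<forall>n\<ge>no. norm (hnorm (completion V) (hdiff (completion V) (cls V (f n)) (cl f)) - 0) < e"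
      by blast
  qed
  have "(\<lambda>n. hip (completion V) G (cls V (f n)) - hip (completion V) G (cl f)) \<longlonglongrightarrow> 0"
  proof (rule Lim_null_comparison)
    show "\<forall>\<^sub>F n in sequentially. norm (hip (completion V) G (cls V (f n)) - hip (completion V) G (cl f))
       \<le> hnorm (completion V) G * hnorm (completion V) (hdiff (completion V) (cls V (f n)) (cl f))"
    proof (intro always_eventually allI)
      fix n
      show "norm (hip (completion V) G (cls V (f n)) - hip (completion V) G (cl f))
       \<le> hnorm (completion V) G * hnorm (completion V) (hdiff (completion V) (cls V (f n)) (cl f))"
        using Q.Cauchy_Schwarz[OF G, of "hdiff (completion V) (cls V (f n)) (cl f)"] f G
        by (simp add: Q.ip_diff_right cauchyD)
    qed
    show "(\<lambda>n. hnorm (completion V) G * hnorm (completion V) (hdiff (completion V) (cls V (f n)) (cl f))) \<longlonglongrightarrow> 0"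
      using tendsto_mult_left[OF lim, of "hnorm (completion V) G"] by simp
  qed
  then show ?thesis by (simp add: LIM_zero_iff)
qed

text \<open>Density is enough because an adjointable operator can be moved to the other side of the
  pairing, where the limit is taken. This is the uniqueness behind the definite descriptions of
  \<open>L2_X\<close> and \<open>tree_lambda\<close>.\<close>

lemma adjointables_eqI:
  assumes x: "x \<in> adjointables (completion V)" and y: "y \<in> adjointables (completion V)"
    and eq: "\<And>v. v \<in> hcarrier V \<Longrightarrow> x (cls V v) = y (cls V v)"
  shows "x = y"
proof
  interpret Q: correspondence "completion V" by (rule completion_correspondence)
  fix A
  show "x A = y A"
  proof (cases "A \<in> hcarrier (completion V)")
    case False
    then show ?thesis using x y by (auto simp: adjointables_def PiE_def extensional_def)
  next
    case True
    then obtain f where f: "f \<in> cauchy_seqs V" "A = cl f" by (meson cl_cases)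
    have lim: "(\<lambda>n. hip (completion V) G (z (cls V (f n)))) \<longlonglongrightarrow> hip (completion V) G (z A)"
      if z: "z \<in> adjointables (completion V)" and G: "G \<in> hcarrier (completion V)" for z G
    proof -
      obtain w where w: "\<And>h. h \<in> hcarrier (completion V) \<Longrightarrow> w h \<in> hcarrier (completion V)"
        "\<And>h k. h \<in> hcarrier (completion V) \<Longrightarrow> k \<in> hcarrier (completion V) \<Longrightarrow>
          hip (completion V) (z h) k = hip (completion V) h (w k)"
        using adjointable_adjoint[OF z] by blast
      note zc = adjointable_closed[OF z]
      have adj: "hip (completion V) G (z h) = hip (completion V) (w G) h"
        if "h \<in> hcarrier (completion V)" for h
        using w(2)[OF that G] Q.ip_star w(1) zc that G by metis
      show ?thesis
        using hip_cl_limit[OF f(1) w(1)[OF G]] f True by (simp add: adj cauchyD)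
    qed
    show ?thesis
    proof (rule Q.separated)
      show "x A \<in> hcarrier (completion V)" "y A \<in> hcarrier (completion V)"
        using x y True by (auto simp: adjointables_def)
      fix G assume "G \<in> hcarrier (completion V)"
      then show "hip (completion V) G (x A) = hip (completion V) G (y A)"
        using lim[OF x] lim[OF y] eq f by (simp add: cauchyD) (meson LIMSEQ_unique)
    qed
  qed
qed

end

section \<open>Polynomials in an adjointable operator\<close>

context correspondence
begin

text \<open>Additivity and right modularity follow from the existence of an adjoint, by
  separation.\<close>

lemma adjointableI:
  assumes x: "x \<in> hcarrier V \<rightarrow>\<^sub>E hcarrier V"
    and bound: "\<And>h. h \<in> hcarrier V \<Longrightarrow> hnorm V (x h) \<le> K * hnorm V h"
    and y: "\<And>h. h \<in> hcarrier V \<Longrightarrow> y h \<in> hcarrier V"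
    and adj: "\<And>h k. h \<in> hcarrier V \<Longrightarrow> k \<in> hcarrier V \<Longrightarrow> hip V (x h) k = hip V h (y k)"
  shows "x \<in> adjointables V"
proof -
  have xc: "x h \<in> hcarrier V" if "h \<in> hcarrier V" for h using x that by auto
  have adj': "hip V k (x h) = hip V (y k) h" if "h \<in> hcarrier V" "k \<in> hcarrier V" for h k
    using arg_cong[OF adj[OF that], of star] that by (simp add: ip_star xc y)
  have "x (hadd V h k) = hadd V (x h) (x k)" if "h \<in> hcarrier V" "k \<in> hcarrier V" for h k
    using that by (intro separated) (auto simp: xc adj' ip_add_right y)
  moreover have "x (hract V h b) = hract V (x h) b" if "h \<in> hcarrier V" for h b
    using that by (intro separated) (auto simp: xc adj' ip_ract_right y)
  moreover have "\<exists>K. \<forall>h\<in>hcarrier V. hnorm V (x h) \<le> K * hnorm V h" using bound by blast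
  moreover have "\<exists>y \<in> hcarrier V \<rightarrow> hcarrier V. \<forall>h\<in>hcarrier V. \<forall>k\<in>hcarrier V. hip V (x h) k = hip V h (y k)"
    using y adj by (intro bexI[of _ y]) auto
  ultimately show ?thesis using x by (simp add: adjointables_def)
qed

lemma adjointable_eqI:
  assumes "x \<in> adjointables V" "y \<in> adjointables V"
    "\<And>h k. h \<in> hcarrier V \<Longrightarrow> k \<in> hcarrier V \<Longrightarrow> hip V k (x h) = hip V k (y h)"
  shows "x = y"
proof
  fix h show "x h = y h"
  proof (cases "h \<in> hcarrier V")
    case True
    then show ?thesis
      by (intro separated adjointable_closed[OF assms(1)] adjointable_closed[OF assms(2)] assms(3))
  next
    case False
    then show ?thesis using assms(1,2) by (simp add: adjointable_undefined)
  qed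
qed

definition lact_op :: "'b \<Rightarrow> 'v \<Rightarrow> 'v" where
  "lact_op b = (\<lambda>h\<in>hcarrier V. hlact V b h)"

definition add_op :: "('v \<Rightarrow> 'v) \<Rightarrow> ('v \<Rightarrow> 'v) \<Rightarrow> 'v \<Rightarrow> 'v" where
  "add_op x y = (\<lambda>h\<in>hcarrier V. hadd V (x h) (y h))"

lemma lact_op_adjointable: "lact_op b \<in> adjointables V"
  by (rule adjointableI[of _ "norm b" "hlact V (star b)"])
    (auto simp: lact_op_def hnorm_lact ip_lact_left)

lemma add_op_adjointable:
  assumes x: "x \<in> adjointables V" and y: "y \<in> adjointables V"
  shows "add_op x y \<in> adjointables V"
proof -
  obtain x' where x': "\<And>h. h \<in> hcarrier V \<Longrightarrow> x' h \<in> hcarrier V"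
    "\<And>h k. h \<in> hcarrier V \<Longrightarrow> k \<in> hcarrier V \<Longrightarrow> hip V (x h) k = hip V h (x' k)"
    using adjointable_adjoint[OF x] by blast
  obtain y' where y': "\<And>h. h \<in> hcarrier V \<Longrightarrow> y' h \<in> hcarrier V"
    "\<And>h k. h \<in> hcarrier V \<Longrightarrow> k \<in> hcarrier V \<Longrightarrow> hip V (y h) k = hip V h (y' k)"
    using adjointable_adjoint[OF y] by blast
  obtain K where K: "\<And>h. h \<in> hcarrier V \<Longrightarrow> hnorm V (x h) \<le> K * hnorm V h"
    using adjointable_bound[OF x] by blast
  obtain L where L: "\<And>h. h \<in> hcarrier V \<Longrightarrow> hnorm V (y h) \<le> L * hnorm V h"
    using adjointable_bound[OF y] by blast
  note c = adjointable_closed[OF x] adjointable_closed[OF y]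
  show ?thesis
  proof (rule adjointableI[of _ "K + L" "\<lambda>h. hadd V (x' h) (y' h)"])
    fix h assume h: "h \<in> hcarrier V"
    show "hnorm V (add_op x y h) \<le> (K + L) * hnorm V h"
      using hnorm_add[OF c, OF h h] K[OF h] L[OF h] h by (simp add: add_op_def algebra_simps)
  qed (auto simp: add_op_def ip_add_left ip_add_right c x' y')
qed

lemma compose_adjointable:
  assumes x: "x \<in> adjointables V" and y: "y \<in> adjointables V"
  shows "compose (hcarrier V) x y \<in> adjointables V"
proof -
  obtain x' where x': "\<And>h. h \<in> hcarrier V \<Longrightarrow> x' h \<in> hcarrier V"
    "\<And>h k. h \<in> hcarrier V \<Longrightarrow> k \<in> hcarrier V \<Longrightarrow> hip V (x h) k = hip V h (x' k)"
    using adjointable_adjoint[OF x] by blast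
  obtain y' where y': "\<And>h. h \<in> hcarrier V \<Longrightarrow> y' h \<in> hcarrier V"
    "\<And>h k. h \<in> hcarrier V \<Longrightarrow> k \<in> hcarrier V \<Longrightarrow> hip V (y h) k = hip V h (y' k)"
    using adjointable_adjoint[OF y] by blast
  obtain K where K: "K > 0" "\<And>h. h \<in> hcarrier V \<Longrightarrow> hnorm V (x h) \<le> K * hnorm V h"
    using adjointable_bound[OF x] by blast
  obtain L where L: "\<And>h. h \<in> hcarrier V \<Longrightarrow> hnorm V (y h) \<le> L * hnorm V h"
    using adjointable_bound[OF y] by blast
  note c = adjointable_closed[OF x] adjointable_closed[OF y]
  show ?thesis
  proof (rule adjointableI[of _ "K * L" "\<lambda>h. y' (x' h)"])
    fix h assume h: "h \<in> hcarrier V"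
    have "hnorm V (x (y h)) \<le> K * hnorm V (y h)" by (intro K c h)
    also have "\<dots> \<le> K * (L * hnorm V h)" using K by (intro mult_left_mono L h) auto
    finally show "hnorm V (compose (hcarrier V) x y h) \<le> (K * L) * hnorm V h"
      using h by (simp add: compose_def mult.assoc)
  qed (auto simp: compose_def c x' y')
qed

primrec expr_op :: "('v \<Rightarrow> 'v) \<Rightarrow> 'b ncexpr \<Rightarrow> 'v \<Rightarrow> 'v" where
  "expr_op x (EConst b) = lact_op b"
| "expr_op x EVar = x"
| "expr_op x (EAdd p q) = add_op (expr_op x p) (expr_op x q)"
| "expr_op x (EMul p q) = compose (hcarrier V) (expr_op x p) (expr_op x q)"

lemma expr_op_adjointable: "x \<in> adjointables V \<Longrightarrow> expr_op x p \<in> adjointables V"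
  by (induction p) (auto simp: lact_op_adjointable add_op_adjointable compose_adjointable)

lemma lact_scalar: "h \<in> hcarrier V \<Longrightarrow> hlact V (scaleC c 1) h = hract V h (scaleC c 1)"
  by (intro separated) (auto simp: ip_lact_scaleC ip_ract_right scaleC_mult_right)

lemma lact_one: "h \<in> hcarrier V \<Longrightarrow> hlact V 1 h = h"
  by (intro separated) (auto simp: ip_lact_one)

text \<open>Each generating relation becomes an identity of inner products. Centrality of the
  scalars comes from their acting on the left as on the right, together with the right modularity of
  the operators.\<close>

lemma expr_op_cong:
  assumes x: "x \<in> adjointables V"
  shows "ncrel p q \<Longrightarrow> expr_op x p = expr_op x q"
proof (induction rule: ncrel.induct)
  case (scalar_central c p)
  note A = expr_op_adjointable[OF x, of p]
  show ?case
    by (rule adjointable_eqI[OF expr_op_adjointable[OF x] expr_op_adjointable[OF x]])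
      (simp add: compose_def lact_op_def lact_scalar adjointable_ract[OF A] adjointable_closed[OF A])
qed (simp_all only: expr_op.simps, (rule adjointable_eqI, (intro expr_op_adjointable[OF x]
      add_op_adjointable compose_adjointable lact_op_adjointable)+,
      simp add: add_op_def compose_def lact_op_def adjointable_closed[OF expr_op_adjointable[OF x]]
        adjointable_add[OF expr_op_adjointable[OF x]]
        ip_add_right ip_lact_add ip_lact_mult lact_one ip_lact_zero ip_lact_minus ip_lact_hadd)+)

lemma abs_rep: "abs_ncpoly (rep_ncpoly p) = p"
  by (rule Quotient_abs_rep[OF Quotient_ncpoly])

lemma rep_abs: "ncrel (rep_ncpoly (abs_ncpoly e)) e"
  by (rule Quotient_rep_abs[OF Quotient_ncpoly nc_refl])

definition is_poly_eval :: "('v \<Rightarrow> 'v) \<Rightarrow> ('b ncpoly \<Rightarrow> 'v \<Rightarrow> 'v) \<Rightarrow> bool" where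
  "is_poly_eval x \<pi> \<longleftrightarrow> (\<forall>p. \<pi> p \<in> adjointables V) \<and>
     (\<forall>b. \<pi> (ncconst b) = lact_op b) \<and> \<pi> ncX = x \<and>
     (\<forall>p q. \<pi> (p + q) = add_op (\<pi> p) (\<pi> q)) \<and>
     (\<forall>p q. \<pi> (p * q) = compose (hcarrier V) (\<pi> p) (\<pi> q))"

lemma is_poly_eval_unique:
  assumes \<pi>: "is_poly_eval x \<pi>"
  shows "\<pi> p = expr_op x (rep_ncpoly p)"
proof -
  have "\<pi> (abs_ncpoly e) = expr_op x e" for e
  proof (induction e)
    case (EConst b)
    then show ?case using \<pi> by (simp add: is_poly_eval_def ncconst.abs_eq[symmetric])
  next
    case EVar
    then show ?case using \<pi> by (simp add: is_poly_eval_def ncX.abs_eq[symmetric])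
  next
    case (EAdd p q)
    then show ?case using \<pi> by (simp add: is_poly_eval_def plus_ncpoly.abs_eq[symmetric])
  next
    case (EMul p q)
    then show ?case using \<pi> by (simp add: is_poly_eval_def times_ncpoly.abs_eq[symmetric])
  qed
  from this[of "rep_ncpoly p"] show ?thesis by (simp add: abs_rep)
qed

lemma is_poly_eval_exists:
  assumes x: "x \<in> adjointables V"
  shows "is_poly_eval x (\<lambda>p. expr_op x (rep_ncpoly p))"
proof -
  have c: "expr_op x (rep_ncpoly (abs_ncpoly e)) = expr_op x e" for e
    by (rule expr_op_cong[OF x rep_abs])
  have "expr_op x (rep_ncpoly (p + q)) = expr_op x (EAdd (rep_ncpoly p) (rep_ncpoly q))" for p q
    using c[of "EAdd (rep_ncpoly p) (rep_ncpoly q)"] by (simp add: plus_ncpoly.abs_eq[symmetric] abs_rep)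
  moreover have "expr_op x (rep_ncpoly (p * q)) = expr_op x (EMul (rep_ncpoly p) (rep_ncpoly q))" for p q
    using c[of "EMul (rep_ncpoly p) (rep_ncpoly q)"] by (simp add: times_ncpoly.abs_eq[symmetric] abs_rep)
  moreover have "expr_op x (rep_ncpoly (ncconst b)) = lact_op b" for b
    using c[of "EConst b"] by (simp add: ncconst.abs_eq)
  moreover have "expr_op x (rep_ncpoly ncX) = x"
    using c[of EVar] by (simp add: ncX.abs_eq)
  ultimately show ?thesis by (simp add: is_poly_eval_def expr_op_adjointable x)
qed

text \<open>Evaluating representatives gives one such homomorphism, and the values on the constants
  and on X determine it.\<close>

lemma poly_eval: "x \<in> adjointables V \<Longrightarrow> is_poly_eval x (poly_eval V x)"
  unfolding poly_eval_def is_poly_eval_def[symmetric] lact_op_def[symmetric] add_op_def[symmetric]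
  by (rule theI[of "is_poly_eval x"], erule is_poly_eval_exists) (intro ext is_poly_eval_unique)

end

context pre_correspondence
begin

lemma hnorm_cl_limit:
  assumes f: "f \<in> cauchy_seqs V"
  shows "(\<lambda>n. hnorm V (f n)) \<longlonglongrightarrow> hnorm (completion V) (cl f)"
  unfolding hnorm_def hip_cl[OF f f] by (intro tendsto_intros ip_lim f)

text \<open>A symmetric operator is its own adjoint, so its continuous extension is adjointable at
  once.\<close>

lemma symmetric_extension:
  assumes X: "\<And>h. h \<in> hcarrier V \<Longrightarrow> X h \<in> hcarrier V"
    and sym: "\<And>g h. g \<in> hcarrier V \<Longrightarrow> h \<in> hcarrier V \<Longrightarrow> hip V (X g) h = hip V g (X h)"
    and R: "R \<ge> 0" and bound: "\<And>h. h \<in> hcarrier V \<Longrightarrow> hnorm V (X h) \<le> R * hnorm V h"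
  obtains x where "x \<in> adjointables (completion V)"
    "\<And>v. v \<in> hcarrier V \<Longrightarrow> x (cls V v) = cls V (X v)"
    "\<And>g h. g \<in> hcarrier (completion V) \<Longrightarrow> h \<in> hcarrier (completion V) \<Longrightarrow>
      hip (completion V) (x g) h = hip (completion V) g (x h)"
    "\<And>h. h \<in> hcarrier (completion V) \<Longrightarrow> hnorm (completion V) (x h) \<le> R * hnorm (completion V) h"
proof -
  interpret Q: correspondence "completion V" by (rule completion_correspondence)
  define x where "x = (\<lambda>A\<in>hcarrier (completion V). \<Union>f\<in>A. cl (\<lambda>n. X (f n)))"
  \<comment> \<open>Symmetry makes \<open>X\<close> additive and homogeneous up to null vectors, so
    the bound passes to differences.\<close>
  have b: "hnorm V (hdiff V (X h) (X k)) \<le> R * hnorm V (hdiff V h k)"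
    if "h \<in> hcarrier V" "k \<in> hcarrier V" for h k
  proof -
    have "hnorm V (hdiff V (X h) (X k)) = hnorm V (X (hdiff V h k))"
      using that by (intro hnorm_eqI) (auto simp: X ip_diff_right simp flip: sym)
    then show ?thesis using bound that by simp
  qed
  have xcl: "x (cl f) = cl (\<lambda>n. X (f n))" and Xf: "(\<lambda>n. X (f n)) \<in> cauchy_seqs V"
    if "f \<in> cauchy_seqs V" for f
    using that cl_image[OF X b that] cauchy_image(1)[OF X b that] by (auto simp: x_def)
  have xs: "hip (completion V) (x G) H = hip (completion V) G (x H)"
    if GH: "G \<in> hcarrier (completion V)" "H \<in> hcarrier (completion V)" for G H
  proof -
    obtain g h where c: "g \<in> cauchy_seqs V" "h \<in> cauchy_seqs V" and eq: "G = cl g" "H = cl h"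
      using cl_cases[OF GH(1)] cl_cases[OF GH(2)] by metis
    show ?thesis unfolding eq using c by (simp add: xcl hip_cl Xf ip_lim_def sym cauchyD)
  qed
  have xb: "hnorm (completion V) (x H) \<le> R * hnorm (completion V) H"
    if H: "H \<in> hcarrier (completion V)" for H
  proof -
    obtain h where c: "h \<in> cauchy_seqs V" and eq: "H = cl h" using cl_cases[OF H] by metis
    have "hnorm (completion V) (cl (\<lambda>n. X (h n))) \<le> R * hnorm (completion V) (cl h)"
      by (rule LIMSEQ_le[OF hnorm_cl_limit[OF Xf[OF c]] tendsto_mult_left[OF hnorm_cl_limit[OF c]]])
        (use bound cauchyD[OF c] in blast)
    then show ?thesis unfolding eq using c by (simp add: xcl)
  qed
  have xc: "x H \<in> hcarrier (completion V)" if "H \<in> hcarrier (completion V)" for H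
    using that by (auto elim!: cl_cases simp: xcl Xf)
  show ?thesis
  proof (rule that)
    show "x \<in> adjointables (completion V)"
    proof (rule Q.adjointableI[OF _ xb xc xs])
      show "x \<in> hcarrier (completion V) \<rightarrow>\<^sub>E hcarrier (completion V)"
        by (rule PiE_I, rule xc) (simp_all add: x_def)
    qed
    show "x (cls V v) = cls V (X v)" if "v \<in> hcarrier V" for v
      unfolding cls_eq using that by (simp add: xcl cauchy_const)
  qed (use xs xb in auto)
qed

end

section \<open>The correspondence of a law\<close>

lemma ncconst_add: "ncconst (a + b) = ncconst a + ncconst b"
  by transfer (rule const_add)

lemma ncconst_mult: "ncconst (a * b) = ncconst a * ncconst b"
  by transfer (rule const_mul)

lemma ncconst_one: "ncconst 1 = 1"
  by transfer (rule nc_refl)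

lemma ncconst_zero: "ncconst 0 = 0"
  by transfer (rule nc_refl)

lemma ncconst_minus: "ncconst (- a) = - ncconst a"
  using ncconst_add[of a "- a"] by (simp add: ncconst_zero eq_neg_iff_add_eq_0 add.commute)

lemma ncconst_scaleC_commute: "ncconst (scaleC c 1) * p = p * ncconst (scaleC c 1)"
  by transfer (rule scalar_central)

lemma star_ncpoly_add: "star (p + q :: 'b::cstar_algebra ncpoly) = star p + star q"
  by transfer (simp add: nc_refl)

lemma star_ncpoly_mult: "star (p * q :: 'b::cstar_algebra ncpoly) = star q * star p"
  by transfer (simp add: nc_refl)

lemma star_ncconst: "star (ncconst b) = ncconst (star b)"
  by transfer (simp add: nc_refl)

lemma star_ncX: "star ncX = ncX"
  by transfer (simp add: nc_refl)

lemma star_star_ncpoly: "star (star (p :: 'b::cstar_algebra ncpoly)) = p"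
proof transfer
  fix p :: "'b ncexpr"
  have "estar (estar p) = p" by (induction p) (auto simp: star_star)
  then show "ncrel (estar (estar p)) p" by (simp add: nc_refl)
qed

lemma star_ncpoly_one: "star (1 :: 'b::cstar_algebra ncpoly) = 1"
  using star_ncconst[of 1] by (simp add: star_one ncconst_one)

lemma star_ncpoly_zero: "star (0 :: 'b::cstar_algebra ncpoly) = 0"
  using star_ncconst[of 0] by (simp add: star_zero ncconst_zero)

lemma ncpoly_induct [case_names const X add mult]:
  assumes "\<And>b. P (ncconst b)" "P ncX" "\<And>p q. P p \<Longrightarrow> P q \<Longrightarrow> P (p + q)"
    "\<And>p q. P p \<Longrightarrow> P q \<Longrightarrow> P (p * q)"
  shows "P p"
proof (induction p rule: ncpoly.abs_induct)
  case (1 e)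
  show ?case
    by (induction e) (use assms in \<open>simp_all flip: ncconst.abs_eq ncX.abs_eq plus_ncpoly.abs_eq times_ncpoly.abs_eq\<close>)
qed

section \<open>Monomials in X with coefficients in B\<close>

definition ncmono :: "'b::cstar_algebra list \<Rightarrow> 'b ncpoly" where
  "ncmono bs = (\<Prod>b\<leftarrow>bs. ncX * ncconst b)"

lemma ncmono_simps [simp]: "ncmono [] = 1" "ncmono (b # bs) = ncX * ncconst b * ncmono bs"
  "ncmono (bs @ cs) = ncmono bs * ncmono cs"
  by (simp_all add: ncmono_def)

inductive_set ncspan :: "'b::cstar_algebra ncpoly set" where
  mono: "ncconst b * ncmono bs \<in> ncspan"
| add: "p \<in> ncspan \<Longrightarrow> q \<in> ncspan \<Longrightarrow> p + q \<in> ncspan"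

text \<open>A constant on the right is absorbed into the last coefficient, which is the leading one
  when there is no X; a factor X on the right is appended with coefficient 1.\<close>

lemma ncspan_mult: "p \<in> ncspan \<Longrightarrow> p * q \<in> ncspan"
proof (induction q arbitrary: p rule: ncpoly_induct)
  case (const c)
  then show ?case
  proof (induction rule: ncspan.induct)
    case (mono b bs)
    show ?case
    proof (cases bs rule: rev_cases)
      case Nil
      then show ?thesis using ncspan.mono[of "b * c" "[]"] by (simp add: ncconst_mult)
    next
      case (snoc cs d)
      then show ?thesis using ncspan.mono[of b "cs @ [d * c]"] by (simp add: ncconst_mult mult.assoc)
    qed
  qed (auto simp: ring_distribs intro: ncspan.add)
next
  case X
  then show ?case
  proof (induction rule: ncspan.induct)
    case (mono b bs)
    show ?case using ncspan.mono[of b "bs @ [1]"] by (simp add: ncconst_one mult.assoc)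
  qed (auto simp: ring_distribs intro: ncspan.add)
next
  case (add q r)
  then show ?case by (simp add: ring_distribs ncspan.add)
next
  case (mult q r)
  then show ?case by (simp add: mult.assoc[symmetric])
qed

lemma ncspan_all: "p \<in> ncspan"
  using ncspan_mult[OF ncspan.mono[of 1 "[]"], of p] by (simp add: ncconst_one)

lemma ncpoly_mono_induct [case_names mono add]:
  assumes "\<And>b bs. P (ncconst b * ncmono bs)" "\<And>p q. P p \<Longrightarrow> P q \<Longrightarrow> P (p + q)"
  shows "P p"
  by (rule ncspan.induct[OF ncspan_all]) (use assms in auto)

lemma bimodule_map_add: "bimodule_map \<mu> \<Longrightarrow> \<mu> (p + q) = \<mu> p + \<mu> q"
  by (simp add: bimodule_map_def)

lemma bimodule_map_left: "bimodule_map \<mu> \<Longrightarrow> \<mu> (ncconst a * p) = a * \<mu> p"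
  using bimodule_map_def[of \<mu>] by (metis mult_1_right ncconst_one)

lemma bimodule_map_right: "bimodule_map \<mu> \<Longrightarrow> \<mu> (p * ncconst b) = \<mu> p * b"
  using bimodule_map_def[of \<mu>] by (metis mult_1_left ncconst_one)

lemma bimodule_map_zero: "bimodule_map \<mu> \<Longrightarrow> \<mu> 0 = 0"
  using bimodule_map_left[of \<mu> 0 0] by simp

lemma bimodule_map_minus: "bimodule_map \<mu> \<Longrightarrow> \<mu> (- p) = - \<mu> p"
  using bimodule_map_add[of \<mu> p "- p"] by (simp add: bimodule_map_zero eq_neg_iff_add_eq_0 add.commute)

lemma bimodule_map_diff: "bimodule_map \<mu> \<Longrightarrow> \<mu> (p - q) = \<mu> p - \<mu> q"
  using bimodule_map_add[of \<mu> p "- q"] by (simp add: bimodule_map_minus)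

lemma law_eqI:
  assumes "bimodule_map \<mu>" "bimodule_map \<nu>" "\<And>bs. \<mu> (ncmono bs) = \<nu> (ncmono bs)"
  shows "\<mu> = \<nu>"
proof
  fix p show "\<mu> p = \<nu> p"
    by (induction p rule: ncpoly_mono_induct)
      (simp_all add: assms(3) bimodule_map_add[OF assms(1)] bimodule_map_add[OF assms(2)]
        bimodule_map_left[OF assms(1)] bimodule_map_left[OF assms(2)])
qed

text \<open>What the construction of the product spaces needs of a law. Both complete positivity, with
  Gram matrices replaced by limits of Gram matrices, and boundedness of the multiplication by \<open>X\<close> are
  inherited by convolutions.\<close>

definition quasi_law :: "'b::cstar_algebra law \<Rightarrow> bool" where
  "quasi_law \<mu> \<longleftrightarrow> bimodule_map \<mu> \<and> \<mu> 1 = 1 \<and>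
     (\<forall>F. finite F \<longrightarrow> gram F (\<lambda>p q. \<mu> (star p * q))) \<and>
     (\<exists>R>0. \<forall>p. hnorm (pre_L2 \<mu>) (ncX * p) \<le> R * hnorm (pre_L2 \<mu>) p)"

lemma pre_L2_simps [simp]:
  "hcarrier (pre_L2 \<mu>) = UNIV" "hadd (pre_L2 \<mu>) = (+)" "hzero (pre_L2 \<mu>) = 0"
  "hlact (pre_L2 \<mu>) b p = ncconst b * p" "hract (pre_L2 \<mu>) p b = p * ncconst b"
  "hip (pre_L2 \<mu>) p q = \<mu> (star p * q)"
  by (simp_all add: pre_L2_def)

lemma pre_L2_pre_correspondence:
  assumes \<mu>: "bimodule_map \<mu>" and g: "\<And>F. finite F \<Longrightarrow> gram F (\<lambda>p q. \<mu> (star p * q))"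
  shows "pre_correspondence (pre_L2 \<mu>)"
proof (unfold_locales, goal_cases)
  case (12 p q c)
  have "\<mu> (star p * (ncconst (scaleC c 1) * q)) = \<mu> (star p * q * ncconst (scaleC c 1))"
    by (simp add: ncconst_scaleC_commute mult.assoc)
  then show ?case by (simp add: bimodule_map_right[OF \<mu>] scaleC_mult_right)
next
  case (13 F)
  have "hip (pre_L2 \<mu>) = (\<lambda>p q. \<mu> (star p * q))" by (intro ext) simp
  then show ?case using g[OF 13(1)] by simp
qed (simp_all add: ring_distribs bimodule_map_add[OF \<mu>] bimodule_map_zero[OF \<mu>]
    bimodule_map_right[OF \<mu>] star_ncpoly_mult star_ncconst ncconst_add ncconst_mult ncconst_one
    star_star mult.assoc flip: bimodule_map_right[OF \<mu>])

lemma completely_positive_gram: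
  assumes cp: "completely_positive \<mu>" and fin: "finite F"
  shows "gram F (\<lambda>p q. \<mu> (star p * q))"
proof -
  obtain ps where ps: "set ps = F" "distinct ps" using finite_distinct_list[OF fin] by blast
  define m where "m = length ps"
  show ?thesis
  proof (cases "m = 0")
    case True
    then show ?thesis using ps by (simp add: m_def gram_def)
  next
    case False
    \<comment> \<open>The matrix with the polynomials in its first row and zeros elsewhere;
      multiplying it by its adjoint gives the entries \<open>star (ps ! i) * ps ! j\<close>.\<close>
    define P where "P k i = (if k = 0 then ps ! i else 0)" for k i :: nat
    have "(\<Sum>k<m. star (P k i) * P k j) = star (ps ! i) * ps ! j" for i j
      using False by (subst sum.remove[of _ 0]) (auto simp: P_def star_ncpoly_zero)
    then have "mat_pos m (\<lambda>i j. \<mu> (star (ps ! i) * ps ! j))"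
      using cp[unfolded completely_positive_def, rule_format, of m P] by simp
    then obtain C where C: "\<And>i j. i < m \<Longrightarrow> j < m \<Longrightarrow>
        \<mu> (star (ps ! i) * ps ! j) = (\<Sum>k<m. star (C k i) * C k j)"
      unfolding mat_pos_def by blast
    have "\<forall>p\<in>F. \<exists>i. i < m \<and> ps ! i = p" using ps by (auto simp: in_set_conv_nth m_def)
    then obtain idx where idx: "\<And>p. p \<in> F \<Longrightarrow> idx p < m \<and> ps ! idx p = p" by metis
    show ?thesis
    proof (rule gram_exact[of _ _ "map (\<lambda>k p. C k (idx p)) [0..<m]"])
      fix p q assume "p \<in> F" "q \<in> F"
      then show "\<mu> (star p * q) = (\<Sum>c\<leftarrow>map (\<lambda>k p. C k (idx p)) [0..<m]. star (c p) * c q)"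
        using C[of "idx p" "idx q"] idx by (simp add: comp_def interv_sum_list_conv_sum_set_nat atLeast0LessThan)
    qed
  qed
qed

text \<open>Exponential boundedness makes \<mu>(p X^n q) grow at most like R^n, with a ratio that
  does not depend on p and q. For \<open>symmetric_bounded\<close> this is enough to bound
  multiplication by X by R.\<close>

lemma is_law_quasi_law:
  assumes "is_law \<mu>"
  shows "quasi_law \<mu>"
proof -
  have \<mu>: "bimodule_map \<mu>" "\<mu> 1 = 1" "completely_positive \<mu>" "exponentially_bounded \<mu>"
    using assms by (auto simp: is_law_def)
  interpret pre_correspondence "pre_L2 \<mu>"
    by (rule pre_L2_pre_correspondence[OF \<mu>(1) completely_positive_gram[OF \<mu>(3)]])
  obtain M R where MR: "M > 0" "R > 0"
    "\<And>b0 bs. norm (\<mu> (ncconst b0 * ncmono bs)) \<le> M * R ^ length bs * norm b0 * (\<Prod>b\<leftarrow>bs. norm b)"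
    using \<mu>(4) unfolding exponentially_bounded_def ncmono_def by blast
  have X_pow: "ncX ^ n = ncmono (replicate n 1)" for n
    by (induction n) (auto simp: ncconst_one)
  have "\<exists>c. \<forall>n. norm (\<mu> (p * ncX ^ n * q)) \<le> c * R ^ n" for p q
  proof (induction p rule: ncpoly_mono_induct)
    case (mono b bs)
    show ?case
    proof (induction q rule: ncpoly_mono_induct)
      case (mono d ds)
      define L where "L = bs @ [d] @ ds"
      \<comment> \<open>The first summand covers n = 0, where no X separates the coefficient
        \<open>d\<close> from the word before it.\<close>
      define c where "c = norm (\<mu> (ncconst b * ncmono bs * (ncconst d * ncmono ds))) +
        M * R ^ (length bs + length ds) * norm b * (\<Prod>b\<leftarrow>L. norm b)"
      have Lnn: "(\<Prod>b\<leftarrow>L. norm b) \<ge> 0" by (induction L) auto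
      have "norm (\<mu> (ncconst b * ncmono bs * ncX ^ n * (ncconst d * ncmono ds))) \<le> c * R ^ n" for n
      proof (cases n)
        case 0
        then show ?thesis using MR Lnn by (simp add: c_def)
      next
        case (Suc n')
        have "ncX ^ n * ncconst d = ncmono (replicate n' 1) * ncX * ncconst d"
          by (simp only: Suc power_Suc2 X_pow)
        then have "ncX ^ n * (ncconst d * ncmono ds) = ncmono (replicate n' 1 @ [d] @ ds)"
          by (simp add: mult.assoc[symmetric])
        then have eq: "ncconst b * ncmono bs * ncX ^ n * (ncconst d * ncmono ds) =
            ncconst b * ncmono (bs @ replicate n' 1 @ [d] @ ds)" by (simp add: mult.assoc)
        have pr: "(\<Prod>b\<leftarrow>bs @ replicate n' 1 @ [d] @ ds. norm b) = (\<Prod>b\<leftarrow>L. norm b)"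
          by (simp add: L_def)
        have "norm (\<mu> (ncconst b * ncmono bs * ncX ^ n * (ncconst d * ncmono ds))) \<le>
            M * R ^ length (bs @ replicate n' 1 @ [d] @ ds) * norm b * (\<Prod>b\<leftarrow>L. norm b)"
          unfolding eq using MR(3)[of b "bs @ replicate n' 1 @ [d] @ ds"] unfolding pr .
        also have "\<dots> = M * R ^ (length bs + length ds) * norm b * (\<Prod>b\<leftarrow>L. norm b) * R ^ n"
          by (simp add: Suc power_add)
        also have "\<dots> \<le> c * R ^ n" using MR by (intro mult_right_mono) (auto simp: c_def)
        finally show ?thesis .
      qed
      then show ?case by blast
    next
      case (add q r)
      then obtain c d where cd: "\<And>n. norm (\<mu> (ncconst b * ncmono bs * ncX ^ n * q)) \<le> c * R ^ n"
        "\<And>n. norm (\<mu> (ncconst b * ncmono bs * ncX ^ n * r)) \<le> d * R ^ n" by blast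
      have "norm (\<mu> (ncconst b * ncmono bs * ncX ^ n * (q + r))) \<le> (c + d) * R ^ n" for n
        using norm_triangle_le[OF add_mono[OF cd], of n n]
        by (simp add: ring_distribs bimodule_map_add[OF \<mu>(1)])
      then show ?case by blast
    qed
  next
    case (add p r)
    then obtain c d where cd: "\<And>n. norm (\<mu> (p * ncX ^ n * q)) \<le> c * R ^ n"
      "\<And>n. norm (\<mu> (r * ncX ^ n * q)) \<le> d * R ^ n" by blast
    have "norm (\<mu> ((p + r) * ncX ^ n * q)) \<le> (c + d) * R ^ n" for n
      using norm_triangle_le[OF add_mono[OF cd], of n n]
      by (simp add: ring_distribs bimodule_map_add[OF \<mu>(1)])
    then show ?case by blast
  qed note growth = this
  have "hnorm (pre_L2 \<mu>) (ncX * p) \<le> R * hnorm (pre_L2 \<mu>) p" for p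
  proof -
    obtain c where c: "\<And>n. norm (\<mu> (star p * ncX ^ n * p)) \<le> c * R ^ n" using growth by blast
    have c0: "c \<ge> 0" using order.trans[OF norm_ge_zero c[of 0]] by simp
    have pow: "((*) ncX ^^ n) q = ncX ^ n * q" for n and q :: "'a ncpoly"
      by (induction n) (auto simp: mult.assoc)
    \<comment> \<open>The square of the left side is the norm of a value of \<mu> with 2 * n inner
      factors X, hence the square root of c.\<close>
    have "hnorm (pre_L2 \<mu>) (((*) ncX ^^ n) p) \<le> sqrt c * R ^ n" for n
    proof -
      have "star (ncX ^ n * p) * (ncX ^ n * p) = star p * ncX ^ (2 * n) * p"
      proof -
        have "star (ncX ^ n :: 'a ncpoly) = ncX ^ n"
          by (induction n) (auto simp: star_ncpoly_one star_ncpoly_mult star_ncX power_commutes)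
        then show ?thesis by (simp add: star_ncpoly_mult mult_2 power_add mult.assoc)
      qed
      then have "(hnorm (pre_L2 \<mu>) (((*) ncX ^^ n) p))\<^sup>2 \<le> c * R ^ (2 * n)"
        using c[of "2 * n"] by (simp add: hnorm_power2 pow)
      also have "c * R ^ (2 * n) = (sqrt c * R ^ n)\<^sup>2"
        using c0 by (simp add: power_mult_distrib power_even_eq)
      finally show ?thesis
        by (rule power2_le_imp_le) (use c0 MR(2) in simp)
    qed
    then show ?thesis
      by (intro symmetric_bounded[where X = "(*) ncX" and c = "sqrt c"] MR)
        (auto simp: star_ncpoly_mult star_ncX mult.assoc)
  qed
  then show ?thesis
    using \<mu> completely_positive_gram[OF \<mu>(3)] MR(2) by (auto simp: quasi_law_def)
qed

section \<open>Laws of symmetric operators\<close>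

context correspondence
begin

lemma is_poly_evalD:
  assumes "x \<in> adjointables V"
  shows "poly_eval V x p \<in> adjointables V" "poly_eval V x (ncconst b) = lact_op b"
    "poly_eval V x ncX = x" "poly_eval V x (p + q) = add_op (poly_eval V x p) (poly_eval V x q)"
    "poly_eval V x (p * q) = compose (hcarrier V) (poly_eval V x p) (poly_eval V x q)"
  using poly_eval[OF assms] by (simp_all add: is_poly_eval_def)

lemma poly_eval_star:
  assumes x: "x \<in> adjointables V"
    and sym: "\<And>g h. g \<in> hcarrier V \<Longrightarrow> h \<in> hcarrier V \<Longrightarrow> hip V (x g) h = hip V g (x h)"
  shows "g \<in> hcarrier V \<Longrightarrow> h \<in> hcarrier V \<Longrightarrow>
    hip V (poly_eval V x p g) h = hip V g (poly_eval V x (star p) h)"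
proof (induction p arbitrary: g h rule: ncpoly_induct)
  case (const b)
  then show ?case by (simp add: is_poly_evalD[OF x] star_ncconst lact_op_def ip_lact_left)
next
  case X
  then show ?case by (simp add: is_poly_evalD[OF x] star_ncX sym)
next
  case (add p q)
  then show ?case
    by (simp add: is_poly_evalD(4)[OF x] star_ncpoly_add add_op_def ip_add_left ip_add_right
        adjointable_closed[OF is_poly_evalD(1)[OF x]])
next
  case (mult p q)
  then show ?case
    by (simp add: is_poly_evalD(5)[OF x] star_ncpoly_mult compose_def
        adjointable_closed[OF is_poly_evalD(1)[OF x]])
qed

text \<open>The map p \<mapsto> p(x) \<xi> preserves inner products between \<open>pre_L2\<close> of
  the law and \<open>V\<close>, so the Gram property and the bound on multiplication by X are
  inherited.\<close>

lemma law_of_quasi_law: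
  assumes x: "x \<in> adjointables V"
    and sym: "\<And>g h. g \<in> hcarrier V \<Longrightarrow> h \<in> hcarrier V \<Longrightarrow> hip V (x g) h = hip V g (x h)"
    and \<xi>: "\<xi> \<in> hcarrier V" "hip V \<xi> \<xi> = 1" "\<And>b. hlact V b \<xi> = hract V \<xi> b"
  shows "quasi_law (law_of V \<xi> x)"
proof -
  note pe = is_poly_evalD[OF x]
  note c = adjointable_closed[OF pe(1)]
  have "bimodule_map (law_of V \<xi> x)"
  proof (unfold bimodule_map_def, intro conjI allI)
    show "law_of V \<xi> x (p + q) = law_of V \<xi> x p + law_of V \<xi> x q" for p q
      by (simp add: law_of_def pe(4) add_op_def \<xi> ip_add_right c)
    show "law_of V \<xi> x (ncconst a * p * ncconst b) = a * law_of V \<xi> x p * b" for a p b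
      by (simp add: law_of_def pe(2,5) compose_def lact_op_def \<xi> c ip_lact_right
          adjointable_ract[OF pe(1)] ip_ract_right ip_ract_left star_star)
  qed
  moreover have "law_of V \<xi> x 1 = 1"
    using pe(2)[of 1] \<xi> by (simp add: law_of_def ncconst_one lact_op_def ip_ract_right)
  moreover have ip: "law_of V \<xi> x (star p * q) = hip V (poly_eval V x p \<xi>) (poly_eval V x q \<xi>)" for p q
    using poly_eval_star[OF x sym, of \<xi> "poly_eval V x q \<xi>" "star p"] \<xi> c
    by (simp add: law_of_def pe(5) compose_def star_star_ncpoly)
       (metis ip_star poly_eval_star[OF x sym] c \<xi>(1))
  moreover have "gram F (\<lambda>p q. law_of V \<xi> x (star p * q))" if "finite F" for F
    unfolding ip by (rule gram_pullback, rule gram_ip) (use that c \<xi> in auto)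
  moreover have "\<exists>R>0. \<forall>p. hnorm (pre_L2 (law_of V \<xi> x)) (ncX * p) \<le> R * hnorm (pre_L2 (law_of V \<xi> x)) p"
  proof -
    obtain R where R: "R > 0" "\<And>h. h \<in> hcarrier V \<Longrightarrow> hnorm V (x h) \<le> R * hnorm V h"
      using adjointable_bound[OF x] by blast
    have hn: "hnorm (pre_L2 (law_of V \<xi> x)) p = hnorm V (poly_eval V x p \<xi>)" for p
      by (simp add: hnorm_def ip)
    have "hnorm (pre_L2 (law_of V \<xi> x)) (ncX * p) \<le> R * hnorm (pre_L2 (law_of V \<xi> x)) p" for p
      using R(2)[OF c[OF \<xi>(1)], of p] \<xi> by (simp add: hn pe(3,5) compose_def)
    then show ?thesis using R(1) by blast
  qed
  ultimately show ?thesis by (simp add: quasi_law_def)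
qed

lemma law_of_ncmono_Cons:
  assumes x: "x \<in> adjointables V" and \<xi>: "\<xi> \<in> hcarrier V"
  shows "poly_eval V x (ncmono (b # bs)) \<xi> = x (hlact V b (poly_eval V x (ncmono bs) \<xi>))"
  using \<xi> adjointable_closed[OF is_poly_evalD(1)[OF x]]
  by (simp add: is_poly_evalD[OF x] compose_def lact_op_def)

end

section \<open>The space of a single functional and its multiplication operator\<close>

locale quasi =
  fixes \<mu> :: "'b::cstar_algebra law"
  assumes quasi_law: "quasi_law \<mu>"
begin

lemma bimodule: "bimodule_map \<mu>" and unital: "\<mu> 1 = 1"
  using quasi_law by (auto simp: quasi_law_def)

sublocale pre: pre_correspondence "pre_L2 \<mu>"
  using quasi_law by (intro pre_L2_pre_correspondence) (auto simp: quasi_law_def)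

sublocale L2: correspondence "L2 \<mu>"
  unfolding L2_def by (rule pre.completion_correspondence)

lemma cls_in_L2 [simp]: "cls (pre_L2 \<mu>) p \<in> hcarrier (L2 \<mu>)"
  unfolding L2_def by simp

lemma ip_L2_cls: "hip (L2 \<mu>) (cls (pre_L2 \<mu>) p) (cls (pre_L2 \<mu>) q) = \<mu> (star p * q)"
  unfolding L2_def by (simp add: pre.hip_cls)

lemma lact_L2_cls: "hlact (L2 \<mu>) b (cls (pre_L2 \<mu>) p) = cls (pre_L2 \<mu>) (ncconst b * p)"
  unfolding L2_def by (simp add: pre.hlact_cls)

lemma ract_L2_cls: "hract (L2 \<mu>) (cls (pre_L2 \<mu>) p) b = cls (pre_L2 \<mu>) (p * ncconst b)"
  unfolding L2_def by (simp add: pre.hract_cls)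

lemma add_L2_cls: "hadd (L2 \<mu>) (cls (pre_L2 \<mu>) p) (cls (pre_L2 \<mu>) q) = cls (pre_L2 \<mu>) (p + q)"
  unfolding L2_def by (simp add: pre.hadd_cls)

lemma L2_unit_in [simp]: "L2_unit \<mu> \<in> hcarrier (L2 \<mu>)"
  by (simp add: L2_unit_def)

lemma L2_unit_norm: "hip (L2 \<mu>) (L2_unit \<mu>) (L2_unit \<mu>) = 1"
  by (simp add: L2_unit_def ip_L2_cls unital star_ncpoly_one)

lemma L2_unit_central: "hlact (L2 \<mu>) b (L2_unit \<mu>) = hract (L2 \<mu>) (L2_unit \<mu>) b"
  by (simp add: L2_unit_def lact_L2_cls ract_L2_cls)

lemma L2_X:
  "L2_X \<mu> \<in> adjointables (L2 \<mu>) \<and> (\<forall>p. L2_X \<mu> (cls (pre_L2 \<mu>) p) = cls (pre_L2 \<mu>) (ncX * p)) \<and>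
   (\<forall>g\<in>hcarrier (L2 \<mu>). \<forall>h\<in>hcarrier (L2 \<mu>). hip (L2 \<mu>) (L2_X \<mu> g) h = hip (L2 \<mu>) g (L2_X \<mu> h))"
proof -
  obtain R where R: "R > 0" "\<And>p. hnorm (pre_L2 \<mu>) (ncX * p) \<le> R * hnorm (pre_L2 \<mu>) p"
    using quasi_law by (auto simp: quasi_law_def)
  have sym: "hip (pre_L2 \<mu>) (ncX * p) q = hip (pre_L2 \<mu>) p (ncX * q)" for p q
    by (simp add: star_ncpoly_mult star_ncX mult.assoc)
  have R0: "R \<ge> 0" using R by simp
  have "\<exists>x. x \<in> adjointables (L2 \<mu>) \<and> (\<forall>p. x (cls (pre_L2 \<mu>) p) = cls (pre_L2 \<mu>) (ncX * p)) \<and>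
    (\<forall>g\<in>hcarrier (L2 \<mu>). \<forall>h\<in>hcarrier (L2 \<mu>). hip (L2 \<mu>) (x g) h = hip (L2 \<mu>) g (x h))"
    by (rule pre.symmetric_extension[OF _ sym R0 R(2)]) (auto simp: L2_def)
  then obtain x where x: "x \<in> adjointables (L2 \<mu>)" "\<And>p. x (cls (pre_L2 \<mu>) p) = cls (pre_L2 \<mu>) (ncX * p)"
    "\<And>g h. g \<in> hcarrier (L2 \<mu>) \<Longrightarrow> h \<in> hcarrier (L2 \<mu>) \<Longrightarrow> hip (L2 \<mu>) (x g) h = hip (L2 \<mu>) g (x h)"
    by blast
  have "L2_X \<mu> = x"
    unfolding L2_X_def
  proof (rule the_equality)
    show "x \<in> adjointables (L2 \<mu>) \<and> (\<forall>p. x (cls (pre_L2 \<mu>) p) = cls (pre_L2 \<mu>) (ncX * p))"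
      using x by blast
    fix y assume "y \<in> adjointables (L2 \<mu>) \<and> (\<forall>p. y (cls (pre_L2 \<mu>) p) = cls (pre_L2 \<mu>) (ncX * p))"
    then show "y = x" using x unfolding L2_def by (intro pre.adjointables_eqI) auto
  qed
  then show ?thesis using x by simp
qed

end

section \<open>Inner products of elementary tensors\<close>

lemma scaleC_zero_right: "scaleC c (0::'b::cstar_algebra) = 0"
  using scaleC_add_right[of c 0 0] by simp

locale correspondence_family =
  fixes J :: "nat set" and H :: "nat \<Rightarrow> ('b::cstar_algebra, 'h) corr" and \<xi> :: "nat \<Rightarrow> 'h"
  assumes corr: "j \<in> J \<Longrightarrow> correspondence (H j)"
    and unit_in: "j \<in> J \<Longrightarrow> \<xi> j \<in> hcarrier (H j)"
    and unit_norm: "j \<in> J \<Longrightarrow> hip (H j) (\<xi> j) (\<xi> j) = 1"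
    and unit_central: "j \<in> J \<Longrightarrow> hlact (H j) b (\<xi> j) = hract (H j) (\<xi> j) b"
begin

lemma pre_corr: "j \<in> J \<Longrightarrow> pre_correspondence (H j)"
  using corr correspondence.axioms(1) by blast

text \<open>Larger than the set of words of a tree: the inner product formula is positive on all of
  these, and tails and words with changed vectors remain inside, as the inductions require.\<close>

definition words :: "(nat \<times> 'h) list set" where
  "words = {w. \<forall>(j, h)\<in>set w. j \<in> J \<and> h \<in> hcarrier (H j)}"

lemma words_simps [simp]: "[] \<in> words"
  "(j, h) # w \<in> words \<longleftrightarrow> j \<in> J \<and> h \<in> hcarrier (H j) \<and> w \<in> words"
  "v @ w \<in> words \<longleftrightarrow> v \<in> words \<and> w \<in> words"
  by (auto simp: words_def)

lemma word_ip_neq: "map fst u \<noteq> map fst v \<Longrightarrow> word_ip H a u v = 0"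
  by (induction H a u v rule: word_ip.induct) auto

lemma word_ip_add:
  "u \<in> words \<Longrightarrow> v \<in> words \<Longrightarrow> word_ip H (a + b) u v = word_ip H a u v + word_ip H b u v"
proof (induction u arbitrary: a b v)
  case (Cons p u)
  then show ?case
    by (cases p; cases v) (auto simp: pre_correspondence.ip_lact_add[OF pre_corr])
qed (case_tac v, auto)

lemma word_ip_zero: "u \<in> words \<Longrightarrow> v \<in> words \<Longrightarrow> word_ip H 0 u v = 0"
  using word_ip_add[of u v 0 0] by simp

lemma word_ip_minus: "u \<in> words \<Longrightarrow> v \<in> words \<Longrightarrow> word_ip H (- a) u v = - word_ip H a u v"
  using word_ip_add[of u v a "- a"] by (simp add: word_ip_zero eq_neg_iff_add_eq_0 add.commute)

lemma word_ip_diff: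
  "u \<in> words \<Longrightarrow> v \<in> words \<Longrightarrow> word_ip H (a - b) u v = word_ip H a u v - word_ip H b u v"
  using word_ip_add[of u v a "- b"] by (simp add: word_ip_minus)

lemma word_ip_scaleC:
  "u \<in> words \<Longrightarrow> v \<in> words \<Longrightarrow> word_ip H (scaleC c a) u v = scaleC c (word_ip H a u v)"
proof (induction u arbitrary: a v)
  case (Cons p u)
  have "hip (H i) h (hlact (H i) (scaleC c a) k) = scaleC c (hip (H i) h (hlact (H i) a k))"
    if "i \<in> J" "h \<in> hcarrier (H i)" "k \<in> hcarrier (H i)" for i h k
  proof -
    interpret pre_correspondence "H i" by (rule pre_corr[OF that(1)])
    have "scaleC c a = scaleC c 1 * a" by (simp add: scaleC_mult_left)
    then show ?thesis using that by (simp add: ip_lact_mult ip_lact_scaleC)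
  qed
  with Cons show ?case by (cases p; cases v) (auto simp: scaleC_zero_right)
qed (case_tac v, auto simp: scaleC_zero_right)

lemma word_ip_star:
  "u \<in> words \<Longrightarrow> v \<in> words \<Longrightarrow> star (word_ip H a u v) = word_ip H (star a) v u"
proof (induction u arbitrary: a v)
  case (Cons p u)
  have "star (hip (H i) h (hlact (H i) a k)) = hip (H i) k (hlact (H i) (star a) h)"
    if "i \<in> J" "h \<in> hcarrier (H i)" "k \<in> hcarrier (H i)" for i h k
  proof -
    interpret pre_correspondence "H i" by (rule pre_corr[OF that(1)])
    show ?thesis using that by (simp add: ip_star ip_lact_left)
  qed
  with Cons show ?case by (cases p; cases v) (auto simp: star_zero)
qed (case_tac v, auto simp: star_zero)

text \<open>The constant may depend on the words: the Gram approximation uses it for finitely many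
  at a time, and \<open>lam_growth\<close> for a single one.\<close>

lemma word_ip_bound:
  "u \<in> words \<Longrightarrow> v \<in> words \<Longrightarrow> \<exists>C. \<forall>a. norm (word_ip H a u v) \<le> C * norm a"
proof (induction u arbitrary: v)
  case (Cons p u)
  obtain i h where p: "p = (i, h)" by force
  show ?case
  proof (cases v)
    case Nil
    then show ?thesis by (auto simp: p intro!: exI[of _ 0])
  next
    case (Cons q v')
    obtain j k where q: "q = (j, k)" by force
    show ?thesis
    proof (cases "i = j")
      case False
      then show ?thesis by (auto simp: p q Cons intro!: exI[of _ 0])
    next
      case True
      interpret pre_correspondence "H j" using Cons.prems Cons q by (intro pre_corr) auto
      have w: "u \<in> words" "v' \<in> words" and hk: "h \<in> hcarrier (H j)" "k \<in> hcarrier (H j)"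
        using Cons.prems Cons q p True by auto
      obtain C where C: "\<And>a. norm (word_ip H a u v') \<le> C * norm a" using Cons.IH w by blast
      have C0: "C \<ge> 0" using order.trans[OF norm_ge_zero C[of 1]] by simp
      have "norm (word_ip H a (p # u) v) \<le> (C * (hnorm (H j) h * hnorm (H j) k)) * norm a" for a
      proof -
        have "norm (hip (H j) h (hlact (H j) a k)) \<le> hnorm (H j) h * (norm a * hnorm (H j) k)"
          by (rule order.trans[OF Cauchy_Schwarz mult_left_mono[OF hnorm_lact]]) (use hk in auto)
        then have "norm (word_ip H (hip (H j) h (hlact (H j) a k)) u v') \<le>
            C * (hnorm (H j) h * (norm a * hnorm (H j) k))"
          by (intro order.trans[OF C] mult_left_mono C0)
        then show ?thesis by (simp add: p q Cons True ac_simps)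
      qed
      then show ?thesis by blast
    qed
  qed
qed (case_tac v, auto intro: exI[of _ 1] exI[of _ 0])

lemma etensor_ip_lact_right:
  assumes "fst g \<in> words" "fst u \<in> words"
  shows "etensor_ip H g (etensor_lact H a u) = star (snd g) * word_ip H a (fst g) (fst u) * snd u"
proof -
  obtain w b where u: "u = (w, b)" by force
  show ?thesis
  proof (cases w)
    case Nil
    then show ?thesis by (cases "fst g") (auto simp: etensor_ip_def u mult.assoc)
  next
    case (Cons p v)
    obtain i k where p: "p = (i, k)" by force
    interpret pre_correspondence "H i" using assms by (intro pre_corr) (auto simp: u Cons p)
    show ?thesis using assms
      by (cases "fst g") (auto simp: etensor_ip_def u Cons p ip_lact_one)
  qed
qed

lemma fst_lact: "map fst (fst (etensor_lact H a u)) = map fst (fst u)"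
  by (induction H a u rule: etensor_lact.induct) auto

lemma length_lact: "length (fst (etensor_lact H a u)) = length (fst u)"
  using arg_cong[OF fst_lact, of length] by simp

lemma lact_words: "fst u \<in> words \<Longrightarrow> fst (etensor_lact H a u) \<in> words"
  by (cases u; cases "fst u") (auto simp: pre_correspondence.lact_closed[OF pre_corr])

lemma etensor_ip_lact_left:
  assumes "fst g \<in> words" "fst u \<in> words"
  shows "etensor_ip H (etensor_lact H a g) u = etensor_ip H g (etensor_lact H (star a) u)"
proof -
  have star: "star (etensor_ip H u g) = etensor_ip H g u" if "fst u \<in> words" "fst g \<in> words" for g u
    using that by (simp add: etensor_ip_def star_mult star_star word_ip_star star_one mult.assoc)
  show ?thesis
    using assms by (subst star[symmetric]) (simp_all add: lact_words etensor_ip_lact_right star_mult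
        word_ip_star star_star mult.assoc)
qed

lemma finite_common_bound:
  assumes "finite E" "\<And>u v. u \<in> E \<Longrightarrow> v \<in> E \<Longrightarrow> \<exists>C. \<forall>x. norm (f u v x) \<le> C * norm (x::'b)"
  shows "\<exists>C>0. \<forall>u\<in>E. \<forall>v\<in>E. \<forall>x. norm (f u v x :: 'b) \<le> C * norm x"
proof -
  obtain c where c: "\<And>u v x. u \<in> E \<Longrightarrow> v \<in> E \<Longrightarrow> norm (f u v x) \<le> c u v * norm x"
    using assms(2) by metis
  define C where "C = (\<Sum>p\<in>E \<times> E. \<bar>c (fst p) (snd p)\<bar>) + 1"
  have le: "c u v \<le> C" if "u \<in> E" "v \<in> E" for u v
    using member_le_sum[of "(u, v)" "E \<times> E" "\<lambda>p. \<bar>c (fst p) (snd p)\<bar>"] that assms(1)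
    by (auto simp: C_def)
  have "C > 0" unfolding C_def by (intro add_nonneg_pos sum_nonneg) auto
  moreover have "norm (f u v x) \<le> C * norm x" if "u \<in> E" "v \<in> E" for u v x
    by (rule order.trans[OF c[OF that] mult_right_mono[OF le[OF that]]]) simp
  ultimately show ?thesis by blast
qed

text \<open>Positivity of the tensor product over B by induction on the length. For a common first
  letter, \<langle>h \<otimes> u, k \<otimes> v\<rangle> = \<langle>u, \<langle>h, k\<rangle>
  v\<rangle>; approximating \<langle>h, k\<rangle> by sums of \<open>star (c h) * c k\<close> gives
  sums of kernels \<langle>c(h) u, c(k) v\<rangle> of shorter tensors.\<close>

lemma gram_etensors_bounded:
  "finite E \<Longrightarrow> (\<And>u. u \<in> E \<Longrightarrow> fst u \<in> words \<and> length (fst u) \<le> n) \<Longrightarrow> gram E (etensor_ip H)"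
proof (induction n arbitrary: E)
  case 0
  then show ?case
    by (intro gram_exact[of _ _ "[snd]"]) (auto simp: etensor_ip_def)
next
  case (Suc n)
  define hd' where "hd' u = snd (hd (fst u))" for u :: "('b, 'h) etensor"
  define tl' where "tl' u = (tl (fst u), snd u)" for u :: "('b, 'h) etensor"
  define lab where "lab u = fst (hd (fst u))" for u :: "('b, 'h) etensor"
  have split: "u = ((lab u, hd' u) # fst (tl' u), snd u)" if "fst u \<noteq> []" for u
    using that by (cases u; cases "fst u") (auto simp: lab_def hd'_def tl'_def)
  have part: "gram {u \<in> E. fst u \<noteq> [] \<and> lab u = i} (etensor_ip H)" for i
  proof (cases "{u \<in> E. fst u \<noteq> [] \<and> lab u = i} = {}")
    case True
    show ?thesis unfolding True by (simp add: gram_def)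
  next
    case False
    define E' where "E' = {u \<in> E. fst u \<noteq> [] \<and> lab u = i}"
    have fin: "finite E'" using Suc.prems by (simp add: E'_def)
    have E': "i \<in> J \<and> hd' u \<in> hcarrier (H i) \<and> fst (tl' u) \<in> words \<and> length (fst (tl' u)) \<le> n"
      if "u \<in> E'" for u
      using that Suc.prems(2)[of u] by (cases "fst u") (auto simp: E'_def hd'_def tl'_def lab_def)
    interpret pre_correspondence "H i" using E' False by (intro pre_corr) (auto simp: E'_def)
    have ip: "etensor_ip H u v =
        star (snd u) * word_ip H (hip (H i) (hd' u) (hd' v)) (fst (tl' u)) (fst (tl' v)) * snd v"
      if "u \<in> E'" "v \<in> E'" for u v
    proof -
      have "fst w = (i, hd' w) # fst (tl' w)" if "w \<in> E'" for w
        using split[of w] that by (simp add: E'_def) (metis fst_conv)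
      then show ?thesis
        using that E'[of u] E'[of v] by (simp add: etensor_ip_def ip_lact_one)
    qed
    have "\<exists>C. \<forall>x. norm (star (snd u) * word_ip H x (fst (tl' u)) (fst (tl' v)) * snd v) \<le> C * norm x"
      if uv: "u \<in> E'" "v \<in> E'" for u v
    proof -
      obtain C where C: "\<And>x. norm (word_ip H x (fst (tl' u)) (fst (tl' v))) \<le> C * norm x"
        using word_ip_bound[of "fst (tl' u)" "fst (tl' v)"] E'[OF uv(1)] E'[OF uv(2)] by blast
      have "norm (star (snd u) * word_ip H x (fst (tl' u)) (fst (tl' v)) * snd v) \<le>
          (norm (snd u) * C * norm (snd v)) * norm x" for x
      proof -
        have "norm (star (snd u) * word_ip H x (fst (tl' u)) (fst (tl' v)) * snd v) \<le>
            norm (star (snd u)) * norm (word_ip H x (fst (tl' u)) (fst (tl' v))) * norm (snd v)"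
          by (meson norm_mult_ineq order.trans mult_right_mono norm_ge_zero)
        also have "\<dots> \<le> norm (snd u) * (C * norm x) * norm (snd v)"
          by (intro mult_right_mono mult_mono C) (auto simp: norm_star intro: order.trans[OF norm_ge_zero C])
        finally show ?thesis by (simp add: ac_simps)
      qed
      then show ?thesis by blast
    qed
    note bound = this
    have "\<exists>C>0. \<forall>u\<in>E'. \<forall>v\<in>E'. \<forall>x.
        norm (star (snd u) * word_ip H x (fst (tl' u)) (fst (tl' v)) * snd v) \<le> C * norm x"
      by (rule finite_common_bound[OF fin bound])
    \<comment> \<open>A uniform \<open>C\<close> is needed since the accuracy e / C is fixed before
      \<open>D\<close>, on which the shorter tensors depend.\<close>
    then obtain C where C: "C > 0" "\<And>u v x. u \<in> E' \<Longrightarrow> v \<in> E' \<Longrightarrow>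
      norm (star (snd u) * word_ip H x (fst (tl' u)) (fst (tl' v)) * snd v) \<le> C * norm x"
      by blast
    have "gram E' (etensor_ip H)"
    proof (rule gram_limit)
      fix e :: real assume "e > 0"
      then have "e / C > 0" using C by simp
      moreover have "gram (hd' ` E') (hip (H i))" by (rule gram_ip) (use fin E' in auto)
      ultimately obtain D where D: "\<And>h k. h \<in> hd' ` E' \<Longrightarrow> k \<in> hd' ` E' \<Longrightarrow>
          norm (hip (H i) h k - (\<Sum>c\<leftarrow>D. star (c h) * c k)) < e / C"
        using gramE by blast
      define K' where "K' u v = (\<Sum>c\<leftarrow>D. etensor_ip H (etensor_lact H (c (hd' u)) (tl' u))
          (etensor_lact H (c (hd' v)) (tl' v)))" for u v
      have "gram E' (\<lambda>u v. etensor_ip H (etensor_lact H (c (hd' u)) (tl' u))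
          (etensor_lact H (c (hd' v)) (tl' v)))" for c
      proof (rule gram_pullback, rule Suc.IH)
        fix w assume "w \<in> (\<lambda>u. etensor_lact H (c (hd' u)) (tl' u)) ` E'"
        then obtain u where "u \<in> E'" "w = etensor_lact H (c (hd' u)) (tl' u)" by blast
        then show "fst w \<in> words \<and> length (fst w) \<le> n"
          using E'[of u] lact_words length_lact by metis
      qed (use fin in simp)
      then have "gram E' K'" unfolding K'_def by (intro gram_sum_list)
      moreover have "norm (etensor_ip H u v - K' u v) < e" if u: "u \<in> E'" and v: "v \<in> E'" for u v
      proof -
        have w: "fst (tl' u) \<in> words" "fst (tl' v) \<in> words" using E' u v by auto
        have sum: "word_ip H (\<Sum>c\<leftarrow>cs. f c) (fst (tl' u)) (fst (tl' v)) =
            (\<Sum>c\<leftarrow>cs. word_ip H (f c) (fst (tl' u)) (fst (tl' v)))" for cs and f :: "('h \<Rightarrow> 'b) \<Rightarrow> 'b"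
          by (induction cs) (auto simp: word_ip_zero word_ip_add w)
        have "etensor_ip H (etensor_lact H (c (hd' u)) (tl' u)) (etensor_lact H (c (hd' v)) (tl' v)) =
            star (snd u) * word_ip H (star (c (hd' u)) * c (hd' v)) (fst (tl' u)) (fst (tl' v)) * snd v" for c
        proof -
          have "etensor_ip H (etensor_lact H a (tl' u)) (etensor_lact H b (tl' v)) =
              star (snd u) * word_ip H (star a * b) (fst (tl' u)) (fst (tl' v)) * snd v" for a b
          proof (cases "fst (tl' u)")
            case Nil
            then show ?thesis
              by (cases "fst (tl' v)") (auto simp: tl'_def etensor_ip_def star_mult mult.assoc)
          next
            case (Cons p us)
            obtain k h where p: "p = (k, h)" by force
            interpret Hk: pre_correspondence "H k" using w Cons p by (intro pre_corr) auto
            show ?thesis using w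
              by (cases "fst (tl' v)") (auto simp: tl'_def Cons[unfolded tl'_def, simplified] p
                  etensor_ip_def Hk.ip_lact_one Hk.ip_lact_left Hk.ip_lact_mult)
          qed
          then show ?thesis .
        qed
        then have "K' u v = star (snd u) * word_ip H (\<Sum>c\<leftarrow>D. star (c (hd' u)) * c (hd' v))
            (fst (tl' u)) (fst (tl' v)) * snd v"
          by (simp add: K'_def sum sum_list_const_mult sum_list_mult_const)
        then have "etensor_ip H u v - K' u v = star (snd u) *
          word_ip H (hip (H i) (hd' u) (hd' v) - (\<Sum>c\<leftarrow>D. star (c (hd' u)) * c (hd' v)))
            (fst (tl' u)) (fst (tl' v)) * snd v"
          using u v by (simp add: ip word_ip_diff w algebra_simps)
        also have "norm \<dots> \<le> C * norm (hip (H i) (hd' u) (hd' v) - (\<Sum>c\<leftarrow>D. star (c (hd' u)) * c (hd' v)))"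
          by (rule C(2)[OF u v])
        also have "\<dots> < C * (e / C)" using u v C by (intro mult_strict_left_mono D) auto
        finally show ?thesis using C by simp
      qed
      ultimately show "\<exists>K'. gram E' K' \<and> (\<forall>u\<in>E'. \<forall>v\<in>E'. norm (etensor_ip H u v - K' u v) < e)" by blast
    qed
    then show ?thesis by (simp add: E'_def)
  qed
  have empty: "gram {u \<in> E. fst u = []} (etensor_ip H)"
    by (intro gram_exact[of _ _ "[snd]"]) (auto simp: etensor_ip_def)
  \<comment> \<open>The kernel is block diagonal: one block for the empty words and one for each
    first letter.\<close>
  have "gram E (\<lambda>u v. (if fst u = [] \<and> fst v = [] then etensor_ip H u v else 0) +
      (\<Sum>i\<in>lab ` E. if (fst u \<noteq> [] \<and> lab u = i) \<and> (fst v \<noteq> [] \<and> lab v = i) then etensor_ip H u v else 0))"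
    using Suc.prems(1) by (intro gram_add gram_sum gram_mask part empty) auto
  then show ?case
  proof (rule gram_cong)
    fix u v assume u: "u \<in> E" and v: "v \<in> E"
    show "(if fst u = [] \<and> fst v = [] then etensor_ip H u v else 0) +
      (\<Sum>i\<in>lab ` E. if (fst u \<noteq> [] \<and> lab u = i) \<and> (fst v \<noteq> [] \<and> lab v = i) then etensor_ip H u v else 0)
      = etensor_ip H u v"
    proof (cases "fst u \<noteq> [] \<and> fst v \<noteq> [] \<and> lab u = lab v")
      case True
      have "(\<Sum>i\<in>lab ` E. if (fst u \<noteq> [] \<and> lab u = i) \<and> (fst v \<noteq> [] \<and> lab v = i) then etensor_ip H u v else 0)
        = (\<Sum>i\<in>lab ` E. if i = lab u then etensor_ip H u v else 0)"
        using True by (intro sum.cong) auto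
      also have "\<dots> = etensor_ip H u v" using u Suc.prems(1) by simp
      finally show ?thesis using True by simp
    next
      case False
      then have "etensor_ip H u v = 0" if "\<not> (fst u = [] \<and> fst v = [])"
        using that by (cases "fst u"; cases "fst v") (auto simp: etensor_ip_def lab_def)
      moreover have "(\<Sum>i\<in>lab ` E. if (fst u \<noteq> [] \<and> lab u = i) \<and> (fst v \<noteq> [] \<and> lab v = i)
          then etensor_ip H u v else 0) = 0"
        using False by (intro sum.neutral) auto
      ultimately show ?thesis by auto
    qed
  qed
qed

lemma gram_etensors: "finite E \<Longrightarrow> fst ` E \<subseteq> words \<Longrightarrow> gram E (etensor_ip H)"
  by (rule gram_etensors_bounded[where n = "Max (insert 0 ((length \<circ> fst) ` E))"]) (auto intro: Max_ge)

end

section \<open>The operators on the product space of a tree\<close>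

text \<open>Connectedness enters as closure under removal of the first letter, the form supplied by
  \<open>Tree_subtree\<close>.\<close>

locale tree_family = correspondence_family J H \<xi>
  for J :: "nat set" and H :: "nat \<Rightarrow> ('b::cstar_algebra, 'h) corr" and \<xi> :: "nat \<Rightarrow> 'h" +
  fixes T :: "nat list set"
  assumes T_letters: "s \<in> T \<Longrightarrow> set s \<subseteq> J"
    and T_Nil: "[] \<in> T"
    and T_tail: "j # s \<in> T \<Longrightarrow> s \<in> T"
    and T_alternating: "j # s \<in> T \<Longrightarrow> s = [] \<or> hd s \<noteq> j"
begin

abbreviation P where "P \<equiv> pre_tree_space T H \<xi>"

definition E where "E = (\<Union>s\<in>T. etensors H \<xi> s)"

lemma in_E_iff: "(w, b) \<in> E \<longleftrightarrow> map fst w \<in> T \<and> (\<forall>(j, h)\<in>set w. h \<in> hcirc H \<xi> j)"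
  by (auto simp: E_def etensors_def)

lemma E_words: "u \<in> E \<Longrightarrow> fst u \<in> words"
  using T_letters by (cases u) (fastforce simp: in_E_iff words_def hcirc_def)

lemma hcircD: "h \<in> hcirc H \<xi> j \<Longrightarrow> h \<in> hcarrier (H j)"
  "h \<in> hcirc H \<xi> j \<Longrightarrow> hip (H j) h (\<xi> j) = 0"
  "j \<in> J \<Longrightarrow> h \<in> hcirc H \<xi> j \<Longrightarrow> hip (H j) (\<xi> j) h = 0"
proof -
  show c: "h \<in> hcirc H \<xi> j \<Longrightarrow> h \<in> hcarrier (H j)" and 0: "h \<in> hcirc H \<xi> j \<Longrightarrow> hip (H j) h (\<xi> j) = 0"
    by (auto simp: hcirc_def)
  assume "j \<in> J" and h: "h \<in> hcirc H \<xi> j"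
  interpret pre_correspondence "H j" by (rule pre_corr) fact
  show "hip (H j) (\<xi> j) h = 0"
    using ip_star[OF c[OF h] unit_in[OF \<open>j \<in> J\<close>]] 0[OF h] by (simp add: star_zero)
qed

lemma hcirc_lact: "j \<in> J \<Longrightarrow> h \<in> hcirc H \<xi> j \<Longrightarrow> hlact (H j) a h \<in> hcirc H \<xi> j"
proof -
  assume j: "j \<in> J" and h: "h \<in> hcirc H \<xi> j"
  interpret pre_correspondence "H j" by (rule pre_corr) fact
  show ?thesis using hcircD(1,2)[OF h] unit_in[OF j]
    by (auto simp: hcirc_def ip_lact_left unit_central[OF j] ip_ract_right)
qed

lemma lact_E: "u \<in> E \<Longrightarrow> etensor_lact H a u \<in> E"
  using T_letters by (cases u; cases "fst u") (fastforce simp: in_E_iff hcirc_lact)+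

lemma ract_E: "u \<in> E \<Longrightarrow> (\<lambda>(w, b). (w, b * a)) u \<in> E"
  by (cases u) (auto simp: in_E_iff)

lemma P_simps [simp]: "us \<in> hcarrier P \<longleftrightarrow> set us \<subseteq> E" "hadd P = (@)" "hzero P = []"
  "hlact P a us = map (etensor_lact H a) us" "hract P us a = map (\<lambda>(w, b). (w, b * a)) us"
  "hip P us vs = (\<Sum>u\<leftarrow>us. \<Sum>v\<leftarrow>vs. etensor_ip H u v)"
  by (simp_all add: pre_tree_space_def E_def)

lemma sum_list_cong: "(\<And>x. x \<in> set xs \<Longrightarrow> f x = g x) \<Longrightarrow> (\<Sum>x\<leftarrow>xs. f x) = (\<Sum>x\<leftarrow>xs. g x)"
  by (metis map_eq_conv)

lemma hip_pointwise:
  assumes "set us \<subseteq> E" "set vs \<subseteq> E" "\<And>u v. u \<in> E \<Longrightarrow> v \<in> E \<Longrightarrow> f u v = g u v"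
  shows "(\<Sum>u\<leftarrow>us. \<Sum>v\<leftarrow>vs. f u v) = (\<Sum>u\<leftarrow>us. \<Sum>v\<leftarrow>vs. g u v)"
  using assms by (intro sum_list_cong) blast

sublocale pre: pre_correspondence P
proof (unfold_locales, goal_cases)
  case 1 then show ?case by simp
next
  case 2 then show ?case by simp
next
  case 3 then show ?case using lact_E by auto
next
  case 4 then show ?case using ract_E by auto
next
  case 5 then show ?case by (simp add: sum_list_addf)
next
  case 6 then show ?case by simp
next
  case (7 g h b)
  have "etensor_ip H u ((\<lambda>(w, a). (w, a * b)) v) = etensor_ip H u v * b" for u v
    by (cases v) (simp add: etensor_ip_def mult.assoc)
  then show ?case by (simp add: comp_def sum_list_mult_const)
next
  case (8 g h a)
  then show ?case
    by (simp add: comp_def) (intro hip_pointwise, auto simp: etensor_ip_lact_left E_words)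
next
  case (9 g h a b)
  then have "hip P g (hlact P (a + b) h) = (\<Sum>u\<leftarrow>g. \<Sum>v\<leftarrow>h. etensor_ip H u (etensor_lact H a v) +
      etensor_ip H u (etensor_lact H b v))"
    by (simp add: comp_def) (intro hip_pointwise, auto simp: etensor_ip_lact_right E_words word_ip_add ring_distribs)
  then show ?case by (simp add: sum_list_addf comp_def)
next
  case (10 g h a b)
  have "etensor_ip H u (etensor_lact H (a * b) v) = etensor_ip H u (etensor_lact H a (etensor_lact H b v))"
    if u: "u \<in> E" and v: "v \<in> E" for u v
  proof (cases "fst v")
    case Nil
    then show ?thesis by (cases v) (simp add: etensor_ip_def mult.assoc)
  next
    case (Cons p w)
    obtain j h b' where v': "v = ((j, h) # w, b')" using Cons by (cases v; cases p) auto
    interpret Hj: pre_correspondence "H j"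
      using E_words[OF v] by (intro pre_corr) (simp add: v')
    show ?thesis using E_words[OF u] E_words[OF v]
      by (cases "fst u") (auto simp: v' etensor_ip_def Hj.ip_lact_one Hj.ip_lact_mult)
  qed
  with 10 show ?case by (simp add: comp_def) (intro hip_pointwise, auto)
next
  case (11 g h)
  then show ?case
    by (simp add: comp_def) (intro hip_pointwise, auto simp: etensor_ip_lact_right E_words, simp add: etensor_ip_def)
next
  case (12 g h c)
  have "etensor_ip H u (etensor_lact H (scaleC c 1) v) = scaleC c 1 * etensor_ip H u v"
    if "u \<in> E" "v \<in> E" for u v
    using that by (simp add: etensor_ip_lact_right E_words word_ip_scaleC)
      (simp add: etensor_ip_def scaleC_mult_left scaleC_mult_right)
  with 12 have "hip P g (hlact P (scaleC c 1) h) = (\<Sum>u\<leftarrow>g. \<Sum>v\<leftarrow>h. scaleC c 1 * etensor_ip H u v)"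
    by (simp add: comp_def) (intro hip_pointwise, auto)
  also have "\<dots> = scaleC c 1 * hip P g h" by (simp add: sum_list_const_mult)
  finally show ?case by (simp add: scaleC_mult_left)
next
  case (13 F)
  have "gram F (\<lambda>us vs. \<Sum>u\<leftarrow>us. \<Sum>v\<leftarrow>vs. etensor_ip H u v)"
  proof (intro gram_lists gram_etensors 13(1))
    have "\<Union>(set ` F) \<subseteq> E" using 13(2) P_simps(1) by blast
    then show "fst ` \<Union>(set ` F) \<subseteq> words" using E_words by blast
  qed (use 13(1) in auto)
  moreover have "hip P = (\<lambda>us vs. \<Sum>u\<leftarrow>us. \<Sum>v\<leftarrow>vs. etensor_ip H u v)" by (intro ext) simp
  ultimately show ?case by simp
qed

abbreviation K where "K \<equiv> tree_space T H \<xi>"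

sublocale K: correspondence K
  unfolding tree_space_def by (rule pre.completion_correspondence)

abbreviation unit where "unit \<equiv> tree_unit T H \<xi>"

lemma Nil_in_E [simp]: "([], b) \<in> E"
  by (simp add: in_E_iff T_Nil)

lemma unit_in_K [simp]: "unit \<in> hcarrier K"
  unfolding tree_unit_def tree_space_def by simp

lemma unit_norm_K: "hip K unit unit = 1"
  unfolding tree_unit_def tree_space_def by (subst pre.hip_cls) (simp_all add: etensor_ip_def star_one)

lemma unit_central_K: "hlact K b unit = hract K unit b"
  unfolding tree_unit_def tree_space_def by (simp add: pre.hlact_cls pre.hract_cls)

section \<open>Splitting off the first tensor factor\<close>

definition proj where "proj j h = hdiff (H j) h (hract (H j) (\<xi> j) (hip (H j) (\<xi> j) h))"

definition tens where
  "tens j h u = [etensor_lact H (hip (H j) (\<xi> j) h) u, ((j, proj j h) # fst u, snd u)]"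

lemma tree_tensor_eq: "tree_tensor T H \<xi> j h u = cls P (tens j h u)"
  by (simp add: tree_tensor_def tens_def proj_def)

lemma proj_hcirc: "j \<in> J \<Longrightarrow> h \<in> hcarrier (H j) \<Longrightarrow> proj j h \<in> hcirc H \<xi> j"
proof -
  assume j: "j \<in> J" and h: "h \<in> hcarrier (H j)"
  interpret pre_correspondence "H j" by (rule pre_corr[OF j])
  show ?thesis using h unit_in[OF j]
    by (simp add: proj_def hcirc_def ip_diff_left ip_ract_left unit_norm[OF j] ip_star)
qed

lemma proj_ip:
  assumes j: "j \<in> J" and h: "h \<in> hcarrier (H j)" and k: "k \<in> hcarrier (H j)"
  shows "hip (H j) (proj j h) (proj j k) = hip (H j) h k - hip (H j) h (\<xi> j) * hip (H j) (\<xi> j) k"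
proof -
  interpret pre_correspondence "H j" by (rule pre_corr[OF j])
  show ?thesis using h k unit_in[OF j]
    by (simp add: proj_def ip_diff_left ip_diff_right ip_ract_left ip_ract_right unit_norm[OF j] ip_star)
qed

definition base where "base j u \<longleftrightarrow> u \<in> E \<and> j # map fst (fst u) \<in> T"

lemma baseD:
  assumes "base j u"
  shows "u \<in> E" "j \<in> J" "fst u = [] \<or> fst (hd (fst u)) \<noteq> j" "fst u \<in> words"
  using assms T_alternating[of j "map fst (fst u)"] T_letters[of "j # map fst (fst u)"] E_words[of u]
  by (auto simp: base_def hd_map)

lemma base_lact: "base j u \<Longrightarrow> base j (etensor_lact H a u)"
  by (simp add: base_def lact_E fst_lact)

lemma tens_in: "base j u \<Longrightarrow> h \<in> hcarrier (H j) \<Longrightarrow> set (tens j h u) \<subseteq> E"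
  using baseD[of j u] proj_hcirc[of j h]
  by (cases u) (auto simp: tens_def lact_E in_E_iff base_def)

lemma word_ip_Cons_base:
  assumes "w = [] \<or> fst (hd w) \<noteq> j"
  shows "word_ip H a w ((j, h) # v) = 0" "word_ip H a ((j, h) # v) w = 0"
proof -
  show "word_ip H a w ((j, h) # v) = 0" using assms by (cases w) auto
  show "word_ip H a ((j, h) # v) w = 0" using assms by (cases w) auto
qed

text \<open>The splitting of H_j \<otimes> H_s into the summands for s and js is isometric:
  \<langle>h, k\<rangle> is \<langle>h, \<xi>_j\<rangle>\<langle>\<xi>_j, k\<rangle> plus the
  pairing of the centered parts, and the mixed terms vanish as only one of the two words begins with
  \<open>j\<close>.\<close>

lemma hip_tens_tens:
  assumes u: "base j u" and v: "base j v" and h: "h \<in> hcarrier (H j)" and k: "k \<in> hcarrier (H j)"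
  shows "hip P (tens j h u) (tens j k v) =
    star (snd u) * word_ip H (hip (H j) h k) (fst u) (fst v) * snd v"
proof -
  note bu = baseD[OF u] and bv = baseD[OF v]
  interpret Hj: pre_correspondence "H j" by (rule pre_corr[OF bu(2)])
  note \<xi> = unit_in[OF bu(2)]
  note ph = hcircD(1)[OF proj_hcirc[OF bu(2) h]] and pk = hcircD(1)[OF proj_hcirc[OF bu(2) k]]
  have 1: "etensor_ip H (etensor_lact H (hip (H j) (\<xi> j) h) u) (etensor_lact H (hip (H j) (\<xi> j) k) v) =
      star (snd u) * word_ip H (hip (H j) h (\<xi> j) * hip (H j) (\<xi> j) k) (fst u) (fst v) * snd v"
  proof (cases "fst v")
    case Nil
    then show ?thesis
    proof (cases "fst u")
      case Nil
      with \<open>fst v = []\<close> show ?thesis using h \<xi>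
        by (cases u; cases v) (simp add: etensor_ip_def star_mult Hj.ip_star mult.assoc)
    next
      case (Cons p us)
      with \<open>fst v = []\<close> show ?thesis by (cases u; cases v; cases p) (simp add: etensor_ip_def)
    qed
  next
    case (Cons p w)
    obtain i l b where v': "v = ((i, l) # w, b)" using Cons by (cases v; cases p) auto
    interpret Hi: pre_correspondence "H i" using bv(4) by (intro pre_corr) (simp add: v')
    show ?thesis
    proof (cases "fst u")
      case Nil
      then show ?thesis by (cases u) (simp add: v' etensor_ip_def)
    next
      case (Cons q us)
      obtain i' l' b' where u': "u = ((i', l') # us, b')" using Cons by (cases u; cases q) auto
      show ?thesis using bu(4) bv(4) h \<xi>
        by (auto simp: v' u' etensor_ip_def Hi.ip_lact_one Hi.ip_lact_left Hi.ip_lact_mult Hj.ip_star)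
    qed
  qed
  have f: "fst (etensor_lact H a u) = [] \<or> fst (hd (fst (etensor_lact H a u))) \<noteq> j"
    "fst (etensor_lact H a v) = [] \<or> fst (hd (fst (etensor_lact H a v))) \<noteq> j" for a
    using baseD(3)[OF base_lact[OF u]] baseD(3)[OF base_lact[OF v]] by blast+
  have "hip P (tens j h u) (tens j k v) =
      star (snd u) * word_ip H (hip (H j) h (\<xi> j) * hip (H j) (\<xi> j) k) (fst u) (fst v) * snd v +
      star (snd u) * word_ip H (hip (H j) (proj j h) (proj j k)) (fst u) (fst v) * snd v"
    using ph pk by (simp add: tens_def 1) (simp add: etensor_ip_def word_ip_Cons_base[OF f(1)] word_ip_Cons_base[OF f(2)] Hj.ip_lact_one)
  then show ?thesis
    by (simp add: proj_ip[OF bu(2) h k] word_ip_diff[OF bu(4) bv(4)] ring_distribs)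
qed

text \<open>The elementary tensors on which \<lambda>_j may be nonzero. They factor as
  \<open>head\<close> \<otimes> \<open>rest\<close>, where the head is \<xi>_j if the word does not
  begin with \<open>j\<close>.\<close>

definition active where
  "active j u \<longleftrightarrow> u \<in> E \<and> (fst u \<noteq> [] \<and> fst (hd (fst u)) = j \<or> j # map fst (fst u) \<in> T)"

definition head where
  "head j u = (if fst u \<noteq> [] \<and> fst (hd (fst u)) = j then snd (hd (fst u)) else \<xi> j)"

definition rest where
  "rest j u = (if fst u \<noteq> [] \<and> fst (hd (fst u)) = j then (tl (fst u), snd u) else u)"

lemma active_base:
  assumes "active j u"
  shows "base j (rest j u)" "head j u \<in> hcarrier (H j)" "j \<in> J"
proof -
  have "base j (rest j u) \<and> head j u \<in> hcarrier (H j) \<and> j \<in> J"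
  proof (cases "fst u \<noteq> [] \<and> fst (hd (fst u)) = j")
    case True
    then obtain h w b where u: "u = ((j, h) # w, b)" by (cases u; cases "fst u") auto
    have "u \<in> E" using assms by (simp add: active_def)
    then show ?thesis using T_tail[of j "map fst w"] T_letters[of "j # map fst w"]
      by (auto simp: u base_def rest_def head_def in_E_iff hcirc_def)
  next
    case False
    then have "base j u" using assms by (auto simp: active_def base_def)
    then show ?thesis using False baseD(2) unit_in by (auto simp: rest_def head_def)
  qed
  then show "base j (rest j u)" "head j u \<in> hcarrier (H j)" "j \<in> J" by auto
qed

text \<open>The factorisation reproduces \<open>u\<close> up to a null vector: a centered head has
  no component along \<xi>_j, and the head \<xi>_j has no centered component.\<close>

lemma hip_active:
  assumes u: "active j u" and g: "set g \<subseteq> E"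
  shows "hip P g (tens j (head j u) (rest j u)) = hip P g [u]"
    and "hip P (tens j (head j u) (rest j u)) g = hip P [u] g"
proof -
  note a = active_base[OF u]
  have uE: "u \<in> E" using u by (simp add: active_def)
  interpret Hj: correspondence "H j" by (rule corr[OF a(3)])
  have t: "set (tens j (head j u) (rest j u)) \<subseteq> E" by (rule tens_in[OF a(1,2)])
  have *: "(\<Sum>v\<leftarrow>tens j (head j u) (rest j u). etensor_ip H x v) = etensor_ip H x u" if x: "x \<in> E" for x
  proof (cases "fst u \<noteq> [] \<and> fst (hd (fst u)) = j")
    case True
    then obtain h w b where u': "u = ((j, h) # w, b)" by (cases u; cases "fst u") auto
    have h: "h \<in> hcirc H \<xi> j" using uE by (simp add: u' in_E_iff)
    note hD = hcircD(1)[OF h] hcircD(3)[OF a(3) h]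
    have "proj j h = h"
      unfolding proj_def using hD unit_in[OF a(3)]
      by (intro Hj.separated) (auto simp: Hj.ip_diff_right Hj.ip_ract_right)
    moreover have "etensor_ip H x (etensor_lact H 0 (w, b)) = 0"
      using E_words[OF x] baseD(4)[OF a(1)]
      by (subst etensor_ip_lact_right) (auto simp: word_ip_zero u' rest_def)
    ultimately show ?thesis by (simp add: tens_def u' head_def rest_def hD)
  next
    case False
    then have hr: "head j u = \<xi> j" "rest j u = u" by (auto simp: head_def rest_def)
    have "etensor_ip H x ((j, proj j (\<xi> j)) # fst u, snd u) = 0"
    proof -
      have "hip (H j) k (hlact (H j) a (proj j (\<xi> j))) = 0" if "k \<in> hcarrier (H j)" for k a
        using that unit_in[OF a(3)] by (simp add: proj_def unit_norm[OF a(3)] Hj.ip_lact_right Hj.ip_diff_right Hj.ip_ract_right)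
      then show ?thesis using E_words[OF x] E_words[OF uE]
        by (cases "fst x") (auto simp: etensor_ip_def word_ip_zero)
    qed
    moreover have "etensor_ip H x (etensor_lact H 1 u) = etensor_ip H x u"
      using E_words[OF x] E_words[OF uE] by (subst etensor_ip_lact_right) (auto simp: etensor_ip_def)
    ultimately show ?thesis by (simp add: tens_def hr unit_norm[OF a(3)])
  qed
  show 1: "hip P g (tens j (head j u) (rest j u)) = hip P g [u]"
    using g by (simp only: P_simps) (intro sum_list_cong, auto simp: *)
  show "hip P (tens j (head j u) (rest j u)) g = hip P [u] g"
    using pre.ip_star[of g "tens j (head j u) (rest j u)"] pre.ip_star[of g "[u]"] 1 g t uE by (simp del: P_simps(6))
qed

text \<open>The operator \<open>\<lambda>\<^sub>j(x)\<close> before separation and completion.\<close>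

definition lamb where
  "lamb j x u = (if active j u then tens j (x (head j u)) (rest j u) else [])"

definition lam where "lam j x us = concat (map (lamb j x) us)"

lemma lam_simps [simp]: "lam j x [] = []" "lam j x (us @ vs) = lam j x us @ lam j x vs"
  "lam j x (u # us) = lamb j x u @ lam j x us"
  by (simp_all add: lam_def)

section \<open>Symmetry and boundedness of one summand\<close>

context
  fixes j x
  assumes j: "j \<in> J" and x: "x \<in> adjointables (H j)"
    and sym: "\<And>g h. g \<in> hcarrier (H j) \<Longrightarrow> h \<in> hcarrier (H j) \<Longrightarrow> hip (H j) (x g) h = hip (H j) g (x h)"
begin

lemma lamb_in: "set (lamb j x u) \<subseteq> E"
  using active_base[of j u] by (auto simp: lamb_def dest!: tens_in[THEN subsetD, rotated -1] adjointable_closed[OF x])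

lemma lam_in: "set (lam j x us) \<subseteq> E"
  using lamb_in by (auto simp: lam_def)

text \<open>Inactive tensors are orthogonal to everything in the range of \<lambda>_j, so sending
  them to zero is compatible with symmetry.\<close>

lemma inactive_orthogonal:
  assumes u: "base j u" and v: "v \<in> E" "\<not> active j v" and h: "h \<in> hcarrier (H j)"
  shows "hip P (tens j h u) [v] = 0" "hip P [v] (tens j h u) = 0"
proof -
  have "map fst (fst v) \<noteq> map fst (fst u)" using u v by (auto simp: base_def active_def)
  then have "etensor_ip H (etensor_lact H a u) v = 0" for a
    by (simp add: etensor_ip_def word_ip_neq fst_lact)
  moreover have "etensor_ip H ((j, k) # fst u, snd u) v = 0" for k
    using v by (cases "fst v") (auto simp: etensor_ip_def active_def)
  ultimately show 0: "hip P (tens j h u) [v] = 0" by (simp add: tens_def)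
  show "hip P [v] (tens j h u) = 0"
    using pre.ip_star[of "tens j h u" "[v]"] 0 tens_in[OF u h] v by (simp del: P_simps(6) add: star_zero)
qed

text \<open>For two active tensors, isometry reduces the claim to the symmetry of \<open>x\<close>
  on H_j; in the other cases both sides vanish.\<close>

lemma lamb_sym:
  assumes u: "u \<in> E" and v: "v \<in> E"
  shows "hip P (lamb j x u) [v] = hip P [u] (lamb j x v)"
proof (cases "active j u")
  case True
  note a = active_base[OF True]
  note xh = adjointable_closed[OF x a(2)]
  show ?thesis
  proof (cases "active j v")
    case av: True
    note b = active_base[OF av]
    note xk = adjointable_closed[OF x b(2)]
    have "hip P (lamb j x u) [v] = hip P (tens j (x (head j u)) (rest j u)) (tens j (head j v) (rest j v))"
      using True tens_in[OF a(1) xh] by (simp add: lamb_def hip_active[OF av] del: P_simps(6))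
    also have "\<dots> = hip P (tens j (head j u) (rest j u)) (tens j (x (head j v)) (rest j v))"
      by (simp only: hip_tens_tens[OF a(1) b(1) xh b(2)] hip_tens_tens[OF a(1) b(1) a(2) xk] sym[OF a(2) b(2)])
    also have "\<dots> = hip P [u] (lamb j x v)"
      using av tens_in[OF b(1) xk] by (simp add: lamb_def hip_active[OF True] del: P_simps(6))
    finally show ?thesis .
  next
    case False
    then show ?thesis using inactive_orthogonal(1)[OF a(1) v False xh] True by (simp add: lamb_def del: P_simps(6)) simp
  qed
next
  case False
  show ?thesis
  proof (cases "active j v")
    case av: True
    note b = active_base[OF av]
    show ?thesis using inactive_orthogonal(2)[OF b(1) u False adjointable_closed[OF x b(2)]] False av
      by (simp add: lamb_def del: P_simps(6)) simp
  qed (use False in \<open>simp add: lamb_def\<close>)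
qed

lemma lam_sym:
  assumes "set us \<subseteq> E" "set vs \<subseteq> E"
  shows "hip P (lam j x us) vs = hip P us (lam j x vs)"
proof -
  have "hip P (lam j x us) vs = (\<Sum>u\<leftarrow>us. \<Sum>v\<leftarrow>vs. hip P (lamb j x u) [v])" for us vs
  proof (induction us)
    case (Cons u us)
    have "(\<Sum>a\<leftarrow>lamb j x u. \<Sum>v\<leftarrow>vs. etensor_ip H a v) = (\<Sum>v\<leftarrow>vs. \<Sum>a\<leftarrow>lamb j x u. etensor_ip H a v)"
      by (rule sum_list_swap)
    with Cons show ?case by simp
  qed simp
  moreover have "hip P us (lam j x vs) = (\<Sum>u\<leftarrow>us. \<Sum>v\<leftarrow>vs. hip P [u] (lamb j x v))"
  proof -
    have "(\<Sum>a\<leftarrow>lam j x vs. etensor_ip H u a) = (\<Sum>v\<leftarrow>vs. \<Sum>a\<leftarrow>lamb j x v. etensor_ip H u a)" for u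
      by (induction vs) auto
    then show ?thesis by simp
  qed
  ultimately show ?thesis
    using hip_pointwise[OF assms lamb_sym] by simp
qed

text \<open>Symmetry moves \<open>lam\<close> to the entries of \<open>g\<close>, so the two terms
  of \<open>tens j h u\<close> never have to be evaluated one by one.\<close>

lemma lam_tens:
  assumes u: "base j u" and h: "h \<in> hcarrier (H j)" and g: "set g \<subseteq> E"
  shows "hip P g (lam j x (tens j h u)) = hip P g (tens j (x h) u)"
proof -
  note xh = adjointable_closed[OF x h]
  have e: "hip P (lamb j x v) (tens j h u) = hip P [v] (tens j (x h) u)" if v: "v \<in> E" for v
  proof (cases "active j v")
    case True
    note a = active_base[OF True]
    have "hip P (lamb j x v) (tens j h u) = hip P (tens j (x (head j v)) (rest j v)) (tens j h u)"
      using True by (simp add: lamb_def)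
    also have "\<dots> = hip P (tens j (head j v) (rest j v)) (tens j (x h) u)"
      by (simp only: hip_tens_tens[OF a(1) u adjointable_closed[OF x a(2)] h] hip_tens_tens[OF a(1) u a(2) xh] sym[OF a(2) h])
    also have "\<dots> = hip P [v] (tens j (x h) u)" by (rule hip_active[OF True tens_in[OF u xh]])
    finally show ?thesis .
  next
    case False
    then show ?thesis using inactive_orthogonal(2)[OF u v False xh] by (simp add: lamb_def del: P_simps(6)) simp
  qed
  have "hip P g (lam j x (tens j h u)) = hip P (lam j x g) (tens j h u)"
    using lam_sym[OF g tens_in[OF u h]] by simp
  also have "\<dots> = hip P g (tens j (x h) u)"
    using g
  proof (induction g)
    case (Cons v g)
    then show ?case using e[of v] by simp
  qed simp
  finally show ?thesis .
qed

text \<open>On an active tensor the n-th power acts as the n-th power of \<open>x\<close> on the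
  head, so the ratio \<open>R\<close> is the same for all vectors; only the constant depends on the
  tensors, and constants add up along a list.\<close>

lemma lam_growth:
  assumes R: "R > 0" "\<And>h. h \<in> hcarrier (H j) \<Longrightarrow> hnorm (H j) (x h) \<le> R * hnorm (H j) h"
    and us: "set us \<subseteq> E"
  shows "\<exists>c. \<forall>n. hnorm P ((lam j x ^^ n) us) \<le> c * R ^ n"
  using us
proof (induction us)
  case Nil
  have "(lam j x ^^ n) [] = []" for n by (induction n) auto
  then show ?case by (intro exI[of _ 0]) (simp add: hnorm_def)
next
  case (Cons u us)
  have uE: "u \<in> E" using Cons.prems by simp
  have in_E: "set ((lam j x ^^ n) vs) \<subseteq> E" if "set vs \<subseteq> E" for n vs
    using that lam_in by (induction n) auto
  obtain c where c: "\<And>n. hnorm P ((lam j x ^^ n) us) \<le> c * R ^ n" using Cons by auto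
  have "\<exists>d. \<forall>n. hnorm P ((lam j x ^^ n) [u]) \<le> d * R ^ n"
  proof (cases "active j u")
    case False
    have "(lam j x ^^ n) [u] = []" if n0: "n > 0" for n
    proof -
      have "(lam j x ^^ m) [] = []" for m by (induction m) auto
      moreover obtain m where "n = Suc m" using n0 by (cases n) auto
      ultimately show ?thesis using False by (simp add: funpow_Suc_right lamb_def del: funpow.simps)
    qed
    then have "hnorm P ((lam j x ^^ n) [u]) \<le> hnorm P [u] * R ^ n" for n
      using R(1) by (cases "n = 0") (auto simp: hnorm_def)
    then show ?thesis by blast
  next
    case True
    note a = active_base[OF True]
    interpret Hj: pre_correspondence "H j" by (rule pre_corr[OF j])
    have xn: "(x ^^ n) (head j u) \<in> hcarrier (H j)" for n
      using a(2) adjointable_closed[OF x] by (induction n) auto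
    have eq: "hip P g ((lam j x ^^ n) [u]) = hip P g (tens j ((x ^^ n) (head j u)) (rest j u))"
      if "set g \<subseteq> E" for g n
      using that
    proof (induction n arbitrary: g)
      case 0
      then show ?case using hip_active(1)[OF True, of g] by (simp del: P_simps(6))
    next
      case (Suc n)
      have uu: "set [u] \<subseteq> E" using uE by simp
      have "hip P g ((lam j x ^^ Suc n) [u]) = hip P (lam j x g) ((lam j x ^^ n) [u])"
        using lam_sym[OF Suc.prems in_E[OF uu, of n]] by simp
      also have "\<dots> = hip P (lam j x g) (tens j ((x ^^ n) (head j u)) (rest j u))"
        by (rule Suc.IH[OF lam_in])
      also have "\<dots> = hip P g (lam j x (tens j ((x ^^ n) (head j u)) (rest j u)))"
        by (rule lam_sym[OF Suc.prems tens_in[OF a(1) xn]])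
      also have "\<dots> = hip P g (tens j ((x ^^ Suc n) (head j u)) (rest j u))"
        using lam_tens[OF a(1) xn Suc.prems] by simp
      finally show ?case .
    qed
    obtain C where C: "\<And>y. norm (word_ip H y (fst (rest j u)) (fst (rest j u))) \<le> C * norm y"
      using word_ip_bound baseD(4)[OF a(1)] by blast
    have C0: "C \<ge> 0" using order.trans[OF norm_ge_zero C[of 1]] by simp
    define b where "b = snd (rest j u)"
    define Z where "Z = norm b * C * norm b"
    define d where "d = sqrt Z * hnorm (H j) (head j u)"
    have xnb: "hnorm (H j) ((x ^^ n) (head j u)) \<le> R ^ n * hnorm (H j) (head j u)" for n
    proof (induction n)
      case (Suc n)
      have "hnorm (H j) ((x ^^ Suc n) (head j u)) \<le> R * hnorm (H j) ((x ^^ n) (head j u))"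
        using R(2)[OF xn[of n]] by simp
      also have "\<dots> \<le> R * (R ^ n * hnorm (H j) (head j u))" using R(1) Suc by (intro mult_left_mono) auto
      finally show ?case by simp
    qed simp
    have "hnorm P ((lam j x ^^ n) [u]) \<le> d * R ^ n" for n
    proof -
      let ?h = "(x ^^ n) (head j u)"
      have uu: "set [u] \<subseteq> E" using uE by simp
      have t: "set (tens j ?h (rest j u)) \<subseteq> E" by (rule tens_in[OF a(1) xn])
      have "hnorm P ((lam j x ^^ n) [u]) = hnorm P (tens j ?h (rest j u))"
        using in_E[OF uu] t by (intro pre.hnorm_eqI) (auto simp del: P_simps(6) intro: eq)
      also have "\<dots> = sqrt (norm (star b * word_ip H (hip (H j) ?h ?h) (fst (rest j u)) (fst (rest j u)) * b))"
        by (simp only: hnorm_def hip_tens_tens[OF a(1) a(1) xn xn] b_def)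
      also have "norm (star b * word_ip H (hip (H j) ?h ?h) (fst (rest j u)) (fst (rest j u)) * b) \<le>
          norm (star b) * norm (word_ip H (hip (H j) ?h ?h) (fst (rest j u)) (fst (rest j u))) * norm b"
        by (meson norm_mult_ineq order.trans mult_right_mono norm_ge_zero)
      also have "\<dots> \<le> norm b * (C * norm (hip (H j) ?h ?h)) * norm b"
        by (intro mult_right_mono mult_mono C) (auto simp: norm_star)
      also have "\<dots> = Z * (hnorm (H j) ?h)\<^sup>2" by (simp add: Z_def Hj.hnorm_power2)
      also have "\<dots> \<le> Z * (R ^ n * hnorm (H j) (head j u))\<^sup>2"
        using C0 by (intro mult_left_mono power_mono xnb) (auto simp: Z_def)
      finally have "hnorm P ((lam j x ^^ n) [u]) \<le> sqrt (Z * (R ^ n * hnorm (H j) (head j u))\<^sup>2)"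
        by simp
      then show ?thesis using R(1) by (simp add: real_sqrt_mult d_def ac_simps)
    qed
    then show ?thesis by blast
  qed
  then obtain d where d: "\<And>n. hnorm P ((lam j x ^^ n) [u]) \<le> d * R ^ n" by blast
  have app: "(lam j x ^^ n) (u # us) = (lam j x ^^ n) [u] @ (lam j x ^^ n) us" for n
  proof (induction n)
    case (Suc n)
    then show ?case by simp
  qed simp
  have "hnorm P ((lam j x ^^ n) (u # us)) \<le> (d + c) * R ^ n" for n
  proof -
    have "hnorm P ((lam j x ^^ n) (u # us)) \<le> hnorm P ((lam j x ^^ n) [u]) + hnorm P ((lam j x ^^ n) us)"
      unfolding app using pre.hnorm_add[of "(lam j x ^^ n) [u]" "(lam j x ^^ n) us"] in_E uE Cons.prems by simp
    then show ?thesis using c[of n] d[of n] by (simp add: ring_distribs)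
  qed
  then show ?case by blast
qed

text \<open>\<open>symmetric_bounded\<close> discards the constants of \<open>lam_growth\<close> and
  leaves the bound \<open>R\<close> of \<open>x\<close>.\<close>

lemma lam_extension:
  obtains y where "y \<in> adjointables K" "\<And>us. set us \<subseteq> E \<Longrightarrow> y (cls P us) = cls P (lam j x us)"
    "\<And>g h. g \<in> hcarrier K \<Longrightarrow> h \<in> hcarrier K \<Longrightarrow> hip K (y g) h = hip K g (y h)"
proof -
  obtain R where R: "R > 0" "\<And>h. h \<in> hcarrier (H j) \<Longrightarrow> hnorm (H j) (x h) \<le> R * hnorm (H j) h"
    using adjointable_bound[OF x] by blast
  have c: "lam j x us \<in> hcarrier P" for us using lam_in by simp
  have s: "hip P (lam j x us) vs = hip P us (lam j x vs)" if "us \<in> hcarrier P" "vs \<in> hcarrier P" for us vs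
    using lam_sym that by simp
  have b: "hnorm P (lam j x us) \<le> R * hnorm P us" if us: "us \<in> hcarrier P" for us
  proof -
    have "\<exists>d. \<forall>n. hnorm P ((lam j x ^^ n) us) \<le> d * R ^ n"
      using us by (intro lam_growth[OF R]) auto
    then obtain d where d: "\<And>n. hnorm P ((lam j x ^^ n) us) \<le> d * R ^ n" by blast
    show ?thesis by (rule pre.symmetric_bounded[OF c s R(1) us d])
  qed
  have R0: "R \<ge> 0" using R by simp
  have "\<exists>y. y \<in> adjointables K \<and> (\<forall>us. set us \<subseteq> E \<longrightarrow> y (cls P us) = cls P (lam j x us)) \<and>
      (\<forall>g\<in>hcarrier K. \<forall>h\<in>hcarrier K. hip K (y g) h = hip K g (y h))"
    by (rule pre.symmetric_extension[OF c s R0 b]) (auto simp: tree_space_def)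
  then show ?thesis using that by blast
qed

text \<open>The defining conditions fix the value on the class of every elementary tensor: active
  ones are of the form \<open>head\<close> \<otimes> \<open>rest\<close>, the others are sent to
  zero. Additivity and density then leave only the extension of \<open>lam\<close>.\<close>

lemma tree_lambda:
  "tree_lambda T H \<xi> j x \<in> adjointables K"
  "set us \<subseteq> E \<Longrightarrow> tree_lambda T H \<xi> j x (cls P us) = cls P (lam j x us)"
  "g \<in> hcarrier K \<Longrightarrow> h \<in> hcarrier K \<Longrightarrow> hip K (tree_lambda T H \<xi> j x g) h = hip K g (tree_lambda T H \<xi> j x h)"
proof -
  obtain y where y: "y \<in> adjointables K" "\<And>us. set us \<subseteq> E \<Longrightarrow> y (cls P us) = cls P (lam j x us)"
    "\<And>g h. g \<in> hcarrier K \<Longrightarrow> h \<in> hcarrier K \<Longrightarrow> hip K (y g) h = hip K g (y h)"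
    using lam_extension by blast
  let ?spec = "\<lambda>y. y \<in> adjointables K \<and>
     (\<forall>s\<in>T. (s = [] \<or> hd s \<noteq> j) \<longrightarrow> (\<forall>u\<in>etensors H \<xi> s.
        (j # s \<in> T \<longrightarrow> (\<forall>h\<in>hcarrier (H j).
            y (tree_tensor T H \<xi> j h u) = tree_tensor T H \<xi> j (x h) u)) \<and>
        (j # s \<notin> T \<longrightarrow> y (cls P [u]) = hzero K)))"
  have "(THE y. ?spec y) = y"
  proof (rule the_equality)
    show "?spec y"
    proof (intro conjI ballI impI y(1))
      fix s u h assume s: "s \<in> T" "u \<in> etensors H \<xi> s" "j # s \<in> T" and h: "h \<in> hcarrier (H j)"
      have b: "base j u" using s by (auto simp: base_def E_def etensors_def)
      show "y (tree_tensor T H \<xi> j h u) = tree_tensor T H \<xi> j (x h) u"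
        unfolding tree_tensor_eq y(2)[OF tens_in[OF b h]]
        using lam_in tens_in[OF b adjointable_closed[OF x h]] lam_tens[OF b h]
        by (intro pre.cls_eqI) (auto simp del: P_simps(6))
    next
      fix s u assume s: "s \<in> T" "s = [] \<or> hd s \<noteq> j" "u \<in> etensors H \<xi> s" "j # s \<notin> T"
      have "\<not> active j u" using s by (auto simp: active_def etensors_def hd_map)
      moreover have "u \<in> E" using s by (auto simp: E_def)
      ultimately show "y (cls P [u]) = hzero K"
        by (simp add: y(2) lamb_def tree_space_def pre.hzero_cls)
    qed
  next
    fix z assume z: "?spec z"
    then have zK: "z \<in> adjointables K" by blast
    have zu: "z (cls P [u]) = cls P (lamb j x u)" if u: "u \<in> E" for u
    proof (cases "active j u")
      case True
      note a = active_base[OF True]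
      obtain s where s: "s \<in> T" "rest j u \<in> etensors H \<xi> s" "j # s \<in> T" "s = [] \<or> hd s \<noteq> j"
      proof (rule that)
        show "map fst (fst (rest j u)) \<in> T" "rest j u \<in> etensors H \<xi> (map fst (fst (rest j u)))"
          "j # map fst (fst (rest j u)) \<in> T"
          using a(1) by (auto simp: base_def E_def etensors_def)
        show "map fst (fst (rest j u)) = [] \<or> hd (map fst (fst (rest j u))) \<noteq> j"
          using baseD(3)[OF a(1)] by (cases "fst (rest j u)") auto
      qed
      have "cls P [u] = cls P (tens j (head j u) (rest j u))"
        using u tens_in[OF a(1,2)] hip_active[OF True] by (intro pre.cls_eqI) (auto simp del: P_simps(6))
      also have "z \<dots> = cls P (tens j (x (head j u)) (rest j u))"
        using z s a(2) unfolding tree_tensor_eq by blast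
      finally show ?thesis using True by (simp add: lamb_def)
    next
      case False
      obtain s where s: "s \<in> T" "u \<in> etensors H \<xi> s" using u by (auto simp: E_def)
      have "s = [] \<or> hd s \<noteq> j" "j # s \<notin> T" using s False u by (auto simp: active_def etensors_def hd_map)
      then have "z (cls P [u]) = hzero K" using z s by blast
      then show ?thesis using False by (simp add: lamb_def tree_space_def pre.hzero_cls)
    qed
    have "z (cls P us) = cls P (lam j x us)" if "set us \<subseteq> E" for us
      using that
    proof (induction us)
      case Nil
      \<comment> \<open>That zero is fixed follows from right modularity, as zero is its own product
        with the scalar 0.\<close>
      have "z (hzero K) = hract K (z (hzero K)) 0"
      proof -
        have "hzero K = hract K (hzero K) 0"
          by (rule K.separated) (auto simp: K.ip_ract_right K.ip_zero_right)
        then show ?thesis using adjointable_ract[OF zK K.zero_closed, of 0] by simp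
      qed
      also have "\<dots> = hzero K"
        using adjointable_closed[OF zK K.zero_closed]
        by (intro K.separated) (auto simp: K.ip_ract_right K.ip_zero_right)
      finally show ?case by (simp add: tree_space_def pre.hzero_cls)
    next
      case (Cons u us)
      have "cls P (u # us) = hadd K (cls P [u]) (cls P us)"
        using Cons.prems by (simp add: tree_space_def pre.hadd_cls)
      moreover have "cls P [u] \<in> hcarrier K" "cls P us \<in> hcarrier K"
        using Cons.prems by (simp_all add: tree_space_def)
      ultimately have "z (cls P (u # us)) = hadd K (cls P (lamb j x u)) (cls P (lam j x us))"
        using Cons zu[of u] by (simp add: adjointable_add[OF zK])
      also have "\<dots> = cls P (lam j x (u # us))"
        using lamb_in lam_in by (simp add: tree_space_def pre.hadd_cls)
      finally show ?case .
    qed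
    then show "z = y"
      using zK y unfolding tree_space_def by (intro pre.adjointables_eqI) auto
  qed
  then have "tree_lambda T H \<xi> j x = y" by (simp add: tree_lambda_def)
  with y show "tree_lambda T H \<xi> j x \<in> adjointables K"
    "set us \<subseteq> E \<Longrightarrow> tree_lambda T H \<xi> j x (cls P us) = cls P (lam j x us)"
    "g \<in> hcarrier K \<Longrightarrow> h \<in> hcarrier K \<Longrightarrow> hip K (tree_lambda T H \<xi> j x g) h = hip K g (tree_lambda T H \<xi> j x h)"
    by auto
qed

end

end

section \<open>Cumulants and first returns to the root\<close>

definition subtree :: "nat \<Rightarrow> nat list set \<Rightarrow> bool" where
  "subtree N T \<longleftrightarrow> T \<subseteq> free_strings N \<and> [] \<in> T \<and> (\<forall>j s. j # s \<in> T \<longrightarrow> s \<in> T)"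

text \<open>If \<open>s\<close> were missing, every vertex that a path inside \<open>T\<close>
  reaches from \<open>j # s\<close> would still end with \<open>j # s\<close>, because leaving these
  strings means passing through \<open>s\<close>; but the root is reached.\<close>

lemma Tree_subtree:
  assumes "T \<in> Tree N"
  shows "subtree N T"
proof -
  have T: "T \<subseteq> free_strings N" "[] \<in> T"
    and conn: "\<And>s t. s \<in> T \<Longrightarrow> t \<in> T \<Longrightarrow> (s, t) \<in> (free_edges N \<inter> T \<times> T)\<^sup>*"
    using assms by (auto simp: Tree_def)
  have "s \<in> T" if js: "j # s \<in> T" for j s
  proof (rule ccontr)
    assume s: "s \<notin> T"
    have "\<exists>r. t = r @ j # s" if "(j # s, t) \<in> (free_edges N \<inter> T \<times> T)\<^sup>*" for t
      using that
    proof (induction rule: rtrancl_induct)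
      case (step t t')
      then obtain r where r: "t = r @ j # s" by blast
      from step(2) have "t' \<in> T" and "(\<exists>i. t' = i # t) \<or> (\<exists>i. t = i # t')"
        by (auto simp: free_edges_def)
      then show ?case
      proof (elim disjE exE)
        fix i assume "t' = i # t"
        then show ?thesis using r by (intro exI[of _ "i # r"]) simp
      next
        fix i assume "t = i # t'"
        then show ?thesis using r s \<open>t' \<in> T\<close> by (cases r) auto
      qed
    qed simp
    from this[OF conn[OF js T(2)]] show False by simp
  qed
  with T show ?thesis by (auto simp: subtree_def)
qed

lemma free_strings_append: "s @ t \<in> free_strings N \<Longrightarrow> s \<in> free_strings N"
  by (auto simp: free_strings_def distinct_adj_append_iff)

lemma branch_iff: "subtree N T \<Longrightarrow> s \<in> branch N T j \<longleftrightarrow> s @ [j] \<in> T"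
  using free_strings_append[of s "[j]" N] by (auto simp: branch_def subtree_def)

lemma subtree_branch: "subtree N T \<Longrightarrow> [j] \<in> T \<Longrightarrow> subtree N (branch N T j)"
  by (auto simp: subtree_def branch_def free_strings_def distinct_adj_Cons)

text \<open>\<open>\<beta>\<close> collects the contributions of the paths up to their first return to the root, and \<open>k\<close> is
  the position of that return.\<close>

definition cumulants :: "('b::cstar_algebra list \<Rightarrow> 'b) \<Rightarrow> ('b list \<Rightarrow> 'b) \<Rightarrow> bool" where
  "cumulants m \<beta> \<longleftrightarrow> m [] = 1 \<and>
     (\<forall>as. as \<noteq> [] \<longrightarrow> m as = (\<Sum>k<length as. \<beta> (take k as) * as ! k * m (drop (Suc k) as)))"

lemma cumulants_Cons:
  "cumulants m \<beta> \<Longrightarrow> m (a # as) =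
    \<beta> [] * a * m as + (\<Sum>k<length as. \<beta> (a # take k as) * as ! k * m (drop (Suc k) as))"
  unfolding cumulants_def
  by (elim conjE allE[of _ "a # as"]) (simp add: sum.lessThan_Suc_shift del: sum.lessThan_Suc)

lemma cumulants_moments_unique:
  assumes "cumulants m \<beta>" "cumulants m' \<beta>"
  shows "m as = m' as"
proof (induction as rule: length_induct)
  case (1 as)
  show ?case
  proof (cases as)
    case (Cons a as')
    show ?thesis unfolding Cons cumulants_Cons[OF assms(1)] cumulants_Cons[OF assms(2)]
      using 1 Cons by (intro arg_cong2[where f = "(+)"] sum.cong) auto
  qed (use assms in \<open>simp add: cumulants_def\<close>)
qed

text \<open>In the moment of \<open>us @ [1]\<close> the term of the last position is \<beta>(us)
  itself, followed by the coefficient 1 and the empty moment; all other terms involve cumulants of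
  shorter lists.\<close>

lemma cumulants_unique:
  assumes "cumulants m \<beta>" "cumulants m \<beta>'"
  shows "\<beta> us = \<beta>' us"
proof (induction us rule: length_induct)
  case (1 us)
  have m: "m (us @ [1]) = (\<Sum>k<length us. \<gamma> (take k us) * us ! k * m (drop (Suc k) us @ [1])) + \<gamma> us"
    if "cumulants m \<gamma>" for \<gamma>
  proof -
    have "m (us @ [1]) = (\<Sum>k<length (us @ [1]). \<gamma> (take k (us @ [1])) * (us @ [1]) ! k * m (drop (Suc k) (us @ [1])))"
      using that unfolding cumulants_def by blast
    also have "\<dots> = (\<Sum>k<length us. \<gamma> (take k us) * us ! k * m (drop (Suc k) us @ [1])) + \<gamma> us"
    proof -
      have "m [] = 1" using that by (simp add: cumulants_def)
      then show ?thesis by (simp add: nth_append)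
    qed
    finally show ?thesis .
  qed
  have "(\<Sum>k<length us. \<beta> (take k us) * us ! k * m (drop (Suc k) us @ [1])) =
      (\<Sum>k<length us. \<beta>' (take k us) * us ! k * m (drop (Suc k) us @ [1]))"
    using 1 by (intro sum.cong) auto
  with m[OF assms(1)] m[OF assms(2)] show ?case by simp
qed

section \<open>Boolean cumulants of a single law\<close>

definition centered :: "'b::cstar_algebra law \<Rightarrow> 'b ncpoly \<Rightarrow> 'b ncpoly" where
  "centered \<mu> p = p - ncconst (\<mu> p)"

text \<open>The component of the first-return paths in the space of \<open>\<mu>\<close>, right after an application of
  \<open>X\<close>; in between, the paths move in the branch, and \<open>m\<close> gives the moments with which they return to
  the root of the branch.\<close>

function path :: "'b::cstar_algebra law \<Rightarrow> ('b list \<Rightarrow> 'b) \<Rightarrow> 'b list \<Rightarrow> 'b ncpoly" where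
  "path \<mu> m [] = ncX"
| "path \<mu> m (a # as) =
    (\<Sum>k\<le>length as. ncX * (ncconst (a * m (take k as)) * centered \<mu> (path \<mu> m (drop k as))))"
  by pat_completeness auto
termination by (relation "Wellfounded.measure (\<lambda>(\<mu>, m, as). length as)") auto

text \<open>The functional F of the overview, with \<open>m\<close> standing for the moments of the
  second law.\<close>

definition path_cumulant :: "'b::cstar_algebra law \<Rightarrow> ('b list \<Rightarrow> 'b) \<Rightarrow> 'b list \<Rightarrow> 'b" where
  "path_cumulant \<mu> m as = \<mu> (path \<mu> m as)"

definition moments :: "'b::cstar_algebra law \<Rightarrow> 'b list \<Rightarrow> 'b" where
  "moments \<mu> as = \<mu> (ncmono as)"

text \<open>The moments of \<delta>_0, the convolution over the tree that consists of the root. For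
  them \<open>path_cumulant\<close> yields the Boolean cumulants of the law, by
  \<open>cumulants_law\<close>.\<close>

definition zero_moments :: "'b::cstar_algebra list \<Rightarrow> 'b" where
  "zero_moments as = (if as = [] then 1 else 0)"

lemma law_eq_moments: "bimodule_map \<mu> \<Longrightarrow> bimodule_map \<nu> \<Longrightarrow> moments \<mu> = moments \<nu> \<Longrightarrow> \<mu> = \<nu>"
  by (rule law_eqI) (auto simp: moments_def fun_eq_iff)

context quasi
begin

lemma path_zero_moments: "path \<mu> zero_moments (a # as) =
   ncX * (ncconst a * centered \<mu> (path \<mu> zero_moments as))"
proof -
  have "path \<mu> zero_moments (a # as) =
      (\<Sum>k\<le>length as. if k = 0 then ncX * (ncconst a * centered \<mu> (path \<mu> zero_moments as)) else 0)"
    unfolding path.simps by (intro sum.cong) (auto simp: zero_moments_def ncconst_zero)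
  then show ?thesis by simp
qed

text \<open>Successive products are split into their expectation, a return to the unit, and a
  centered remainder. The prefactor \<open>p\<close> is general because the induction moves the
  first factor of the word into it.\<close>

lemma mult_ncmono:
  "\<mu> (p * ncmono as) = \<mu> p * moments \<mu> as +
    (\<Sum>k<length as. \<mu> (p * centered \<mu> (path \<mu> zero_moments (take k as))) * as ! k * moments \<mu> (drop (Suc k) as))"
proof (induction as arbitrary: p)
  case Nil
  then show ?case by (simp add: moments_def unital)
next
  case (Cons a as)
  define y where "y us = path \<mu> zero_moments us" for us
  define c where "c us = path_cumulant \<mu> zero_moments us" for us
  \<comment> \<open>The same sum arises for every \<open>p\<close>; p = 1, for which the centered
    terms vanish, identifies it as the moment of \<open>a # as\<close>.\<close>
  define R where "R = c [] * a * moments \<mu> as + (\<Sum>k<length as. c (a # take k as) * as ! k * moments \<mu> (drop (Suc k) as))"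
  have X: "\<mu> (p * (ncX * ncconst a)) = \<mu> p * c [] * a + \<mu> (p * centered \<mu> (y [])) * a" for p
  proof -
    have "\<mu> (p * (ncX * ncconst a)) = \<mu> (p * ncX) * a"
      by (simp add: bimodule_map_right[OF bimodule] mult.assoc[symmetric])
    moreover have "p * ncX = p * ncconst (c []) + p * centered \<mu> (y [])"
      by (simp add: c_def path_cumulant_def centered_def y_def algebra_simps)
    ultimately show ?thesis
      by (simp add: bimodule_map_add[OF bimodule] bimodule_map_right[OF bimodule] ring_distribs)
  qed
  have Y: "\<mu> (p * (ncX * ncconst a) * centered \<mu> (y us)) = \<mu> p * c (a # us) + \<mu> (p * centered \<mu> (y (a # us)))" for p us
  proof -
    have "p * (ncX * ncconst a) * centered \<mu> (y us) = p * y (a # us)"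
      by (simp add: y_def path_zero_moments mult.assoc del: path.simps)
    also have "\<dots> = p * ncconst (c (a # us)) + p * centered \<mu> (y (a # us))"
      by (simp add: c_def path_cumulant_def centered_def y_def algebra_simps del: path.simps)
    finally show ?thesis by (simp add: bimodule_map_add[OF bimodule] bimodule_map_right[OF bimodule])
  qed
  have main: "\<mu> (p * ncmono (a # as)) = \<mu> p * R +
    (\<Sum>k<length (a # as). \<mu> (p * centered \<mu> (y (take k (a # as)))) * (a # as) ! k * moments \<mu> (drop (Suc k) (a # as)))" for p
  proof -
    have "\<mu> (p * ncmono (a # as)) = \<mu> (p * (ncX * ncconst a) * ncmono as)" by (simp add: mult.assoc)
    also have "\<dots> = (\<mu> p * c [] * a + \<mu> (p * centered \<mu> (y [])) * a) * moments \<mu> as +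
      (\<Sum>k<length as. (\<mu> p * c (a # take k as) + \<mu> (p * centered \<mu> (y (a # take k as)))) * as ! k * moments \<mu> (drop (Suc k) as))"
      unfolding Cons.IH X y_def[symmetric] Y ..
    also have "\<dots> = \<mu> p * R + (\<mu> (p * centered \<mu> (y [])) * a * moments \<mu> as +
      (\<Sum>k<length as. \<mu> (p * centered \<mu> (y (a # take k as))) * as ! k * moments \<mu> (drop (Suc k) as)))"
      by (simp add: R_def ring_distribs sum.distrib sum_distrib_left mult.assoc)
    also have "\<mu> (p * centered \<mu> (y [])) * a * moments \<mu> as +
      (\<Sum>k<length as. \<mu> (p * centered \<mu> (y (a # take k as))) * as ! k * moments \<mu> (drop (Suc k) as)) =
      (\<Sum>k<length (a # as). \<mu> (p * centered \<mu> (y (take k (a # as)))) * (a # as) ! k * moments \<mu> (drop (Suc k) (a # as)))"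
      by (simp add: sum.lessThan_Suc_shift del: sum.lessThan_Suc)
    finally show ?thesis .
  qed
  have c0: "\<mu> (centered \<mu> p) = 0" for p
    using bimodule_map_left[OF bimodule, of "\<mu> p" 1]
    by (simp add: centered_def bimodule_map_diff[OF bimodule] unital)
  have "moments \<mu> (a # as) = R" using main[of 1] by (simp add: c0 unital moments_def)
  then show ?case using main[of p] by (simp add: y_def)
qed

text \<open>This is \<open>mult_ncmono\<close> with p = X a: each product of p with a centered path
  is again a path, by \<open>path_zero_moments\<close>.\<close>

lemma cumulants_law: "cumulants (moments \<mu>) (path_cumulant \<mu> zero_moments)"
proof (unfold cumulants_def, intro conjI allI impI)
  show "moments \<mu> [] = 1" by (simp add: moments_def unital)
  fix as :: "'b list" assume "as \<noteq> []"
  then obtain a as' where as: "as = a # as'" by (cases as) auto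
  have c: "\<mu> (ncX * ncconst a * centered \<mu> (path \<mu> zero_moments us)) = path_cumulant \<mu> zero_moments (a # us)" for us
    by (simp add: path_cumulant_def path_zero_moments mult.assoc del: path.simps)
  have "moments \<mu> (a # as') = \<mu> (ncX * ncconst a * ncmono as')" by (simp add: moments_def)
  also have "\<dots> = path_cumulant \<mu> zero_moments [] * a * moments \<mu> as' +
      (\<Sum>k<length as'. path_cumulant \<mu> zero_moments (a # take k as') * as' ! k * moments \<mu> (drop (Suc k) as'))"
    unfolding mult_ncmono c by (simp add: path_cumulant_def bimodule_map_right[OF bimodule])
  finally show "moments \<mu> as = (\<Sum>k<length as. path_cumulant \<mu> zero_moments (take k as) * as ! k * moments \<mu> (drop (Suc k) as))"
    by (simp add: as sum.lessThan_Suc_shift del: sum.lessThan_Suc)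
qed

end

section \<open>The sum operator and its moments\<close>

locale tree_laws =
  fixes N :: nat and T :: "nat list set" and \<mu> :: "nat \<Rightarrow> 'b::cstar_algebra law"
  assumes quasi_laws: "j \<in> {1..N} \<Longrightarrow> quasi_law (\<mu> j)"
    and subtree: "subtree N T"
begin

lemma quasi: "j \<in> {1..N} \<Longrightarrow> quasi (\<mu> j)"
  by (rule quasi.intro[OF quasi_laws])

sublocale tree_family "{1..N}" "\<lambda>j. L2 (\<mu> j)" "\<lambda>j. L2_unit (\<mu> j)" T
proof (intro tree_family.intro correspondence_family.intro tree_family_axioms.intro)
  fix j b assume j: "j \<in> {1..N}"
  interpret quasi "\<mu> j" by (rule quasi[OF j])
  show "correspondence (L2 (\<mu> j))" by (rule L2.correspondence_axioms)
  show "L2_unit (\<mu> j) \<in> hcarrier (L2 (\<mu> j))" by simp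
  show "hip (L2 (\<mu> j)) (L2_unit (\<mu> j)) (L2_unit (\<mu> j)) = 1" by (rule L2_unit_norm)
  show "hlact (L2 (\<mu> j)) b (L2_unit (\<mu> j)) = hract (L2 (\<mu> j)) (L2_unit (\<mu> j)) b" by (rule L2_unit_central)
next
  show "set s \<subseteq> {1..N}" if "s \<in> T" for s
    using that subtree by (auto simp: subtree_def free_strings_def)
  show "[] \<in> T" using subtree by (simp add: subtree_def)
  show "s \<in> T" if "j # s \<in> T" for j s using that subtree by (auto simp: subtree_def)
  show "s = [] \<or> hd s \<noteq> j" if "j # s \<in> T" for j s
    using that subtree by (auto simp: subtree_def free_strings_def distinct_adj_Cons)
qed

abbreviation letters :: "nat list" where "letters \<equiv> [1..<Suc N]"

abbreviation X where "X j \<equiv> L2_X (\<mu> j)"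

lemma letters_iff: "j \<in> set letters \<longleftrightarrow> j \<in> {1..N}"
  by auto

lemma X_adjointable: "j \<in> {1..N} \<Longrightarrow> X j \<in> adjointables (L2 (\<mu> j))"
  and X_sym: "j \<in> {1..N} \<Longrightarrow> g \<in> hcarrier (L2 (\<mu> j)) \<Longrightarrow> h \<in> hcarrier (L2 (\<mu> j)) \<Longrightarrow>
    hip (L2 (\<mu> j)) (X j g) h = hip (L2 (\<mu> j)) g (X j h)"
  and X_cls: "j \<in> {1..N} \<Longrightarrow> X j (cls (pre_L2 (\<mu> j)) p) = cls (pre_L2 (\<mu> j)) (ncX * p)"
  using quasi.L2_X[OF quasi] by blast+

definition lam_sum where "lam_sum us = concat (map (\<lambda>j. lam j (X j) us) letters)"

definition S where
  "S = (\<lambda>k\<in>hcarrier K. foldr (\<lambda>j. hadd K (tree_lambda T (\<lambda>j. L2 (\<mu> j)) (\<lambda>j. L2_unit (\<mu> j)) j (X j) k))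
     letters (hzero K))"

lemma tree_conv_eq: "tree_conv N T \<mu> = law_of K unit S"
  by (simp only: tree_conv_def S_def Let_def)

lemma lam_sum_in: "set (lam_sum us) \<subseteq> E"
  using lam_in[OF _ X_adjointable X_sym] by (fastforce simp: lam_sum_def)

lemma hip_concat: "hip P g (concat (map f js)) = (\<Sum>j\<leftarrow>js. hip P g (f j))"
  by (induction js) (auto simp: sum_list_addf)

lemma hip_concat_left: "hip P (concat (map f js)) g = (\<Sum>j\<leftarrow>js. hip P (f j) g)"
  by (induction js) auto

lemma lam_sum_sym: "set us \<subseteq> E \<Longrightarrow> set vs \<subseteq> E \<Longrightarrow> hip P (lam_sum us) vs = hip P us (lam_sum vs)"
  unfolding lam_sum_def hip_concat hip_concat_left
  by (intro sum_list_cong lam_sym[OF _ X_adjointable X_sym]) auto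

lemma S_properties:
  "S \<in> adjointables K" "set us \<subseteq> E \<Longrightarrow> S (cls P us) = cls P (lam_sum us)"
  "g \<in> hcarrier K \<Longrightarrow> h \<in> hcarrier K \<Longrightarrow> hip K (S g) h = hip K g (S h)"
proof -
  let ?l = "\<lambda>j. tree_lambda T (\<lambda>j. L2 (\<mu> j)) (\<lambda>j. L2_unit (\<mu> j)) j (X j)"
  define Z where "Z js = (\<lambda>k\<in>hcarrier K. foldr (\<lambda>j. hadd K (?l j k)) js (hzero K))" for js
  have "Z js \<in> adjointables K \<and> (\<forall>us. set us \<subseteq> E \<longrightarrow> Z js (cls P us) = cls P (concat (map (\<lambda>j. lam j (X j) us) js))) \<and>
    (\<forall>g\<in>hcarrier K. \<forall>h\<in>hcarrier K. hip K (Z js g) h = hip K g (Z js h))"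
    if "set js \<subseteq> {1..N}" for js
    using that
  proof (induction js)
    case Nil
    have "Z [] \<in> adjointables K"
      by (rule K.adjointableI[of _ 0 "\<lambda>_. hzero K"])
        (auto simp: Z_def K.hnorm_zero K.ip_zero_left K.ip_zero_right)
    moreover have Z0: "Z [] g = hzero K" if "g \<in> hcarrier K" for g using that by (simp add: Z_def)
    moreover have "cls P us \<in> hcarrier K" if "set us \<subseteq> E" for us using that by (simp add: tree_space_def)
    ultimately show ?case
      by (simp add: K.ip_zero_left K.ip_zero_right) (simp add: tree_space_def pre.hzero_cls)
  next
    case (Cons j js)
    then have j: "j \<in> {1..N}" and IH: "Z js \<in> adjointables K"
      "\<And>us. set us \<subseteq> E \<Longrightarrow> Z js (cls P us) = cls P (concat (map (\<lambda>j. lam j (X j) us) js))"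
      "\<And>g h. g \<in> hcarrier K \<Longrightarrow> h \<in> hcarrier K \<Longrightarrow> hip K (Z js g) h = hip K g (Z js h)" by auto
    note l = tree_lambda[OF j X_adjointable[OF j] X_sym[OF j]]
    note c = adjointable_closed[OF IH(1)] adjointable_closed[OF l(1)]
    have Z: "Z (j # js) = K.add_op (?l j) (Z js)"
      by (auto simp: Z_def K.add_op_def fun_eq_iff)
    have "Z (j # js) (cls P us) = cls P (concat (map (\<lambda>j. lam j (X j) us) (j # js)))" if us: "set us \<subseteq> E" for us
    proof -
      have "cls P us \<in> hcarrier K" using us by (simp add: tree_space_def)
      then have "Z (j # js) (cls P us) = hadd K (cls P (lam j (X j) us)) (cls P (concat (map (\<lambda>j. lam j (X j) us) js)))"
        using us by (simp add: Z K.add_op_def l(2) IH(2))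
      also have "\<dots> = cls P (concat (map (\<lambda>j. lam j (X j) us) (j # js)))"
      proof -
        have "set (lam i (X i) us) \<subseteq> E" if "i \<in> {1..N}" for i
          using lam_in[OF that X_adjointable[OF that] X_sym[OF that]] by blast
        note lam_E = this
        have "set (lam j (X j) us) \<subseteq> E" by (rule lam_E[OF j])
        moreover have "set (concat (map (\<lambda>j. lam j (X j) us) js)) \<subseteq> E"
        proof
          fix v assume "v \<in> set (concat (map (\<lambda>j. lam j (X j) us) js))"
          then obtain i where "i \<in> set js" "v \<in> set (lam i (X i) us)" by auto
          moreover have "i \<in> {1..N}" using Cons.prems \<open>i \<in> set js\<close> by auto
          ultimately show "v \<in> E" using lam_E by blast
        qed
        ultimately show ?thesis by (simp add: tree_space_def pre.hadd_cls)
      qed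
      finally show ?thesis .
    qed
    moreover have "Z (j # js) \<in> adjointables K" unfolding Z by (intro K.add_op_adjointable l(1) IH(1))
    moreover have "hip K (Z (j # js) g) h = hip K g (Z (j # js) h)" if "g \<in> hcarrier K" "h \<in> hcarrier K" for g h
      using that by (simp add: Z K.add_op_def K.ip_add_left K.ip_add_right c l(3) IH(3))
    ultimately show ?case by blast
  qed
  note fold = this
  have "set letters \<subseteq> {1..N}" by auto
  note fold = fold[OF this]
  have "Z letters = S" by (simp only: Z_def S_def)
  note fold = fold[unfolded this]
  have *: "S \<in> adjointables K \<and> (\<forall>us. set us \<subseteq> E \<longrightarrow> S (cls P us) = cls P (lam_sum us)) \<and>
    (\<forall>g\<in>hcarrier K. \<forall>h\<in>hcarrier K. hip K (S g) h = hip K g (S h))"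
    unfolding lam_sum_def by (rule fold)
  then show "S \<in> adjointables K" "set us \<subseteq> E \<Longrightarrow> S (cls P us) = cls P (lam_sum us)"
    "g \<in> hcarrier K \<Longrightarrow> h \<in> hcarrier K \<Longrightarrow> hip K (S g) h = hip K g (S h)" by blast+
qed

lemma quasi_law_tree_conv: "quasi_law (tree_conv N T \<mu>)"
  unfolding tree_conv_eq
  by (rule K.law_of_quasi_law[OF S_properties(1,3)]) (auto simp: unit_norm_K unit_central_K)

text \<open>The vectors S a_1 S a_2 ... S a_n \<xi> as formal sums, so that the path computations
  stay outside the completion.\<close>

primrec vec where
  "vec [] = [([], 1)]"
| "vec (a # as) = lam_sum (map (etensor_lact (\<lambda>j. L2 (\<mu> j)) a) (vec as))"

lemma vec_in: "set (vec as) \<subseteq> E"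
  by (cases as) (auto dest: lam_sum_in[THEN subsetD])

lemma moments_eq: "moments (tree_conv N T \<mu>) as = hip P [([], 1)] (vec as)"
proof -
  have "poly_eval K S (ncmono as) unit = cls P (vec as)"
  proof (induction as)
    case Nil
    have "poly_eval K S (ncconst 1) unit = unit"
      by (simp add: K.is_poly_evalD(2)[OF S_properties(1)] K.lact_op_def K.lact_one)
    then show ?case by (simp add: ncconst_one tree_unit_def)
  next
    case (Cons a as)
    have "hlact K a (cls P (vec as)) = cls P (map (etensor_lact (\<lambda>j. L2 (\<mu> j)) a) (vec as))"
      using vec_in by (simp add: tree_space_def pre.hlact_cls)
    moreover have "set (map (etensor_lact (\<lambda>j. L2 (\<mu> j)) a) (vec as)) \<subseteq> E"
      unfolding set_map using vec_in lact_E by blast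
    ultimately show ?case
      using Cons S_properties(2) by (simp add: K.law_of_ncmono_Cons[OF S_properties(1)] del: ncmono_simps)
  qed
  then show ?thesis
    using vec_in by (simp add: moments_def tree_conv_eq law_of_def tree_unit_def tree_space_def pre.hip_cls del: P_simps(6))
qed


text \<open>The tensor u \<otimes> y, for u in the branch at \<open>j\<close>. The right coefficient
  of u passes through the tensor sign to the left of y, which leaves the coefficient 1.\<close>

definition append_vec :: "nat \<Rightarrow> 'b L2 \<Rightarrow> ('b, 'b L2) etensor \<Rightarrow> ('b, 'b L2) etensor" where
  "append_vec j y u = (fst u @ [(j, hlact (L2 (\<mu> j)) (snd u) y)], 1)"

end

section \<open>Paths inside one branch\<close>

locale tree_branch = tree_laws N T \<mu>
  for N :: nat and T :: "nat list set" and \<mu> :: "nat \<Rightarrow> 'b::cstar_algebra law" +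
  fixes j :: nat
  assumes j: "[j] \<in> T"
begin

lemma j_letter: "j \<in> {1..N}"
  using T_letters[OF j] by simp

sublocale Hj: quasi "\<mu> j"
  by (rule quasi[OF j_letter])

sublocale B: tree_laws N "branch N T j" \<mu>
  by unfold_locales (use quasi_laws subtree_branch[OF subtree j] in auto)

abbreviation y_space where "y_space \<equiv> hcirc (\<lambda>j. L2 (\<mu> j)) (\<lambda>j. L2_unit (\<mu> j)) j"

abbreviation act where "act \<equiv> etensor_lact (\<lambda>j. L2 (\<mu> j))"

lemma append_in:
  assumes y: "y \<in> y_space" and u: "u \<in> B.E"
  shows "append_vec j y u \<in> E"
proof -
  have "map fst (fst u) @ [j] \<in> T" using u branch_iff[OF subtree] by (cases u) (auto simp: B.in_E_iff)
  then show ?thesis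
    using u hcirc_lact[OF j_letter y] by (cases u) (auto simp: append_vec_def in_E_iff B.in_E_iff)
qed

lemma lact_mult: "y \<in> hcarrier (L2 (\<mu> j)) \<Longrightarrow>
    hlact (L2 (\<mu> j)) a (hlact (L2 (\<mu> j)) b y) = hlact (L2 (\<mu> j)) (a * b) y"
  by (rule Hj.L2.separated) (auto simp: Hj.L2.ip_lact_mult)

lemma append_lact: "y \<in> y_space \<Longrightarrow> append_vec j y (act a u) = act a (append_vec j y u)"
  using hcircD(1)[of y j] by (cases u; cases "fst u") (auto simp: append_vec_def lact_mult)

lemma append_tens:
  assumes y: "y \<in> y_space"
  shows "tens i h (append_vec j y v) = map (append_vec j y) (tens i h v)"
  by (simp add: tens_def append_lact[OF y]) (simp add: append_vec_def)

text \<open>Appending y does not change the first letter of u unless u lies at the root of the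
  branch. There \<lambda>_j finds y as its head, while every other \<lambda>_i finds the head
  \<xi>_i as before.\<close>

lemma lamb_append:
  assumes y: "y \<in> y_space" and u: "u \<in> B.E" and i: "i \<in> {1..N}"
  shows "lamb i x (append_vec j y u) = map (append_vec j y) (B.lamb i x u) @
    (if fst u = [] \<and> i = j then tens j (x (hlact (L2 (\<mu> j)) (snd u) y)) ([], 1) else [])"
proof (cases "fst u = [] \<and> i = j")
  case True
  then obtain b where u': "u = ([], b)" by (cases u) auto
  \<comment> \<open>Hence the operator of the branch for the letter \<open>j\<close> kills the root
    of the branch, and the extra term is all that remains.\<close>
  have "[j, j] \<notin> T" using T_alternating[of j "[j]"] by auto
  then have "\<not> B.active j u" using branch_iff[OF subtree, of "[j]" j] by (simp add: B.active_def u')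
  moreover have "active j (append_vec j y u)"
    using append_in[OF y u] by (simp add: active_def append_vec_def u')
  ultimately show ?thesis
    using True by (simp add: lamb_def B.lamb_def head_def rest_def append_vec_def u')
next
  case False
  have act: "active i (append_vec j y u) \<longleftrightarrow> B.active i u"
    using False append_in[OF y u] u branch_iff[OF subtree, of "i # map fst (fst u)" j]
    by (cases "fst u") (auto simp: active_def B.active_def append_vec_def)
  have "head i (append_vec j y u) = B.head i u"
    using False by (cases "fst u") (auto simp: head_def B.head_def append_vec_def)
  moreover have "rest i (append_vec j y u) = append_vec j y (B.rest i u)"
    using False by (cases "fst u") (auto simp: rest_def B.rest_def append_vec_def)
  ultimately show ?thesis
    using False by (auto simp: lamb_def B.lamb_def act append_tens[OF y])
qed

definition root_coeff where "root_coeff W = hip B.P [([], 1)] W"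

lemma root_coeff_Cons: "root_coeff (u # W) = (if fst u = [] then snd u else 0) + root_coeff W"
  by (cases u; cases "fst u") (auto simp: root_coeff_def etensor_ip_def star_one)

text \<open>Pairing with the image of h \<otimes> \<xi>; \<open>final_eq\<close> separates the
  return to the root of the tree from the part that remains at the vertex \<open>j\<close>.\<close>

definition final :: "('b, 'b L2) etensor list \<Rightarrow> 'b L2 \<Rightarrow> 'b" where
  "final g h = hip P g (tens j h ([], 1))"

lemma hip_root: "hip P g [([], a)] = hip P g [([], 1)] * a"
proof -
  have "etensor_ip (\<lambda>j. L2 (\<mu> j)) u ([], a) = etensor_ip (\<lambda>j. L2 (\<mu> j)) u ([], 1) * a" for u :: "('b, 'b L2) etensor"
    by (simp add: etensor_ip_def)
  then show ?thesis by (simp add: sum_list_mult_const)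
qed

definition edge :: "('b, 'b L2) etensor list \<Rightarrow> 'b L2 \<Rightarrow> 'b" where
  "edge g k = hip P g [([(j, k)], 1)]"

lemma edge_add:
  assumes g: "set g \<subseteq> E" and k: "k \<in> hcarrier (L2 (\<mu> j))" "k' \<in> hcarrier (L2 (\<mu> j))"
  shows "edge g (hadd (L2 (\<mu> j)) k k') = edge g k + edge g k'"
proof -
  have "etensor_ip (\<lambda>j. L2 (\<mu> j)) u ([(j, hadd (L2 (\<mu> j)) k k')], 1) =
    etensor_ip (\<lambda>j. L2 (\<mu> j)) u ([(j, k)], 1) + etensor_ip (\<lambda>j. L2 (\<mu> j)) u ([(j, k')], 1)" if u: "u \<in> E" for u
  proof (cases "fst u")
    case (Cons p w)
    then show ?thesis
      using E_words[OF u] k by (cases p; cases w) (auto simp: etensor_ip_def Hj.L2.ip_lact_hadd ring_distribs simp del: One_nat_def)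
  qed (simp add: etensor_ip_def)
  then have "(\<Sum>u\<leftarrow>g. etensor_ip (\<lambda>j. L2 (\<mu> j)) u ([(j, hadd (L2 (\<mu> j)) k k')], 1)) =
     (\<Sum>u\<leftarrow>g. etensor_ip (\<lambda>j. L2 (\<mu> j)) u ([(j, k)], 1) + etensor_ip (\<lambda>j. L2 (\<mu> j)) u ([(j, k')], 1))"
    using g by (intro sum_list_cong) auto
  then show ?thesis by (simp add: edge_def sum_list_addf)
qed

abbreviation cl_poly where "cl_poly \<equiv> cls (pre_L2 (\<mu> j))"

lemma final_eq: "final g h = hip P g [([], 1)] * hip (L2 (\<mu> j)) (L2_unit (\<mu> j)) h + edge g (proj j h)"
proof -
  have "final g h = hip P g [([], hip (L2 (\<mu> j)) (L2_unit (\<mu> j)) h)] + edge g (proj j h)"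
    by (simp add: final_def tens_def edge_def sum_list_addf)
  then show ?thesis using hip_root by metis
qed

lemma proj_cls: "proj j (cl_poly p) = cl_poly (centered (\<mu> j) p)"
proof -
  have "hip (L2 (\<mu> j)) (L2_unit (\<mu> j)) (cl_poly p) = \<mu> j p"
    by (simp add: L2_unit_def Hj.ip_L2_cls star_ncpoly_one)
  then show ?thesis
    unfolding proj_def hdiff_def by (simp add: L2_unit_def Hj.ract_L2_cls Hj.add_L2_cls centered_def
        ncconst_minus ncconst_one)
qed

lemma final_cls: "final g (cl_poly p) = hip P g [([], 1)] * \<mu> j p + edge g (cl_poly (centered (\<mu> j) p))"
  by (simp add: final_eq proj_cls) (simp add: L2_unit_def Hj.ip_L2_cls star_ncpoly_one)

lemma centered_add: "centered (\<mu> j) (p + q) = centered (\<mu> j) p + centered (\<mu> j) q"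
  by (simp add: centered_def bimodule_map_add[OF Hj.bimodule] ncconst_add)

lemma final_cls_add:
  assumes "set g \<subseteq> E"
  shows "final g (cl_poly (p + q)) = final g (cl_poly p) + final g (cl_poly q)"
proof -
  have "edge g (cl_poly (p' + q')) = edge g (cl_poly p') + edge g (cl_poly q')" for p' q'
    using edge_add[OF assms, of "cl_poly p'" "cl_poly q'"] by (simp add: Hj.add_L2_cls)
  then show ?thesis
    by (simp add: final_cls centered_add bimodule_map_add[OF Hj.bimodule] ring_distribs del: P_simps)
qed

lemma final_cls_zero: "set g \<subseteq> E \<Longrightarrow> final g (cl_poly 0) = 0"
  using final_cls_add[of g 0 0] by simp

lemma final_cls_sum:
  assumes "set g \<subseteq> E"
  shows "final g (cl_poly (\<Sum>i\<in>I. f i)) = (\<Sum>i\<in>I. final g (cl_poly (f i)))"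
  by (induction I rule: infinite_finite_induct)
    (simp_all add: final_cls_zero[OF assms] final_cls_add[OF assms])

abbreviation "center p \<equiv> cl_poly (centered (\<mu> j) p)"

lemma center_in: "center p \<in> y_space"
  unfolding proj_cls[symmetric] by (rule proj_hcirc[OF j_letter]) simp

text \<open>By \<open>lamb_append\<close> the sum operator acts in the branch, plus X_j at the root
  of the branch. The extra term is additive in the coefficient, so of \<open>W\<close> it sees only
  \<open>root_coeff W\<close>.\<close>

lemma lam_sum_append:
  assumes W: "set W \<subseteq> B.E" and g: "set g \<subseteq> E"
  shows "hip P g (lam_sum (map (append_vec j (center p)) W)) =
    hip P g (map (append_vec j (center p)) (B.lam_sum W)) +
    final g (cl_poly (ncX * (ncconst (root_coeff W) * centered (\<mu> j) p)))"
proof -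
  note y = center_in[of p]
  define t where "t b = final g (X j (hlact (L2 (\<mu> j)) b (center p)))" for b
  have t: "t b = final g (cl_poly (ncX * (ncconst b * centered (\<mu> j) p)))" for b
    by (simp add: t_def Hj.lact_L2_cls X_cls[OF j_letter])
  have t_add: "t (a + b) = t a + t b" for a b
    by (simp add: t ncconst_add ring_distribs final_cls_add[OF g])
  have t0: "t 0 = 0" using t_add[of 0 0] by simp
  have 1: "hip P g (lam i (X i) (map (append_vec j (center p)) W)) =
      hip P g (map (append_vec j (center p)) (B.lam i (X i) W)) + (if i = j then t (root_coeff W) else 0)"
    if i: "i \<in> {1..N}" for i
    using W
  proof (induction W)
    case Nil
    then show ?case by (simp add: root_coeff_def t0)
  next
    case (Cons u W)
    have hip_append: "hip P g (us @ vs) = hip P g us + hip P g vs" for us vs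
      by (simp add: sum_list_addf)
    have "hip P g (lam i (X i) (map (append_vec j (center p)) (u # W))) =
        hip P g (lamb i (X i) (append_vec j (center p) u)) + hip P g (lam i (X i) (map (append_vec j (center p)) W))"
      by (simp only: list.map lam_simps hip_append)
    also have "hip P g (lamb i (X i) (append_vec j (center p) u)) =
        hip P g (map (append_vec j (center p)) (B.lamb i (X i) u)) +
        (if i = j then t (if fst u = [] then snd u else 0) else 0)"
    proof -
      have "hip P g [] = 0" by simp
      then have "hip P g (if fst u = [] \<and> i = j then tens j (X i (hlact (L2 (\<mu> j)) (snd u) (center p))) ([], 1) else []) =
          (if i = j then t (if fst u = [] then snd u else 0) else 0)"
        using t0 by (simp add: t_def final_def del: P_simps)
      moreover have "u \<in> B.E" using Cons.prems by simp
      ultimately show ?thesis by (simp only: lamb_append[OF y _ i] hip_append)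
    qed
    finally show ?case
      using Cons by (simp add: hip_append root_coeff_Cons t_add del: P_simps(6))
  qed
  have "hip P g (lam_sum (map (append_vec j (center p)) W)) =
      (\<Sum>i\<leftarrow>letters. hip P g (map (append_vec j (center p)) (B.lam i (X i) W)) + (if i = j then t (root_coeff W) else 0))"
    unfolding lam_sum_def hip_concat by (intro sum_list_cong 1) (auto simp: letters_iff)
  also have "\<dots> = (\<Sum>i\<leftarrow>letters. hip P g (map (append_vec j (center p)) (B.lam i (X i) W))) +
      (\<Sum>i\<leftarrow>letters. if i = j then t (root_coeff W) else 0)"
    by (rule sum_list_addf)
  also have "(\<Sum>i\<leftarrow>letters. if i = j then t (root_coeff W) else 0) = t (root_coeff W)"
    using j_letter by (subst sum_list_distinct_conv_sum_set) (auto simp del: upt_Suc)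
  also have "(\<Sum>i\<leftarrow>letters. hip P g (map (append_vec j (center p)) (B.lam i (X i) W))) =
      hip P g (map (append_vec j (center p)) (B.lam_sum W))"
    unfolding B.lam_sum_def map_concat map_map comp_def by (simp only: hip_concat)
  finally show ?thesis by (simp add: t del: P_simps(6))
qed

abbreviation m_branch where "m_branch \<equiv> moments (tree_conv N (branch N T j) \<mu>)"

abbreviation pth where "pth \<equiv> path (\<mu> j) m_branch"

text \<open>The part in the branch at \<open>j\<close> of the vectors reached by paths that avoid the root.\<close>

definition part where
  "part g us = (\<Sum>k\<le>length us. hip P g (map (append_vec j (center (pth (drop k us)))) (B.vec (take k us))))"

text \<open>From the summand k, the operator either stays in the branch, which extends
  \<open>take k us\<close> by \<open>a\<close>, or applies X_j at its root, with \<open>a\<close>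
  times the moment of \<open>take k us\<close> as coefficient. The latter terms add up to the path
  of \<open>a # us\<close>, whose expectation is the return to the root of the tree and whose
  centered part is the summand 0 of the new \<open>part\<close>.\<close>

lemma part_step:
  assumes g: "set g \<subseteq> E"
  shows "(\<Sum>k\<le>length us. hip P g (lam_sum (map (act a) (map (append_vec j (center (pth (drop k us)))) (B.vec (take k us))))))
    = hip P g [([], 1)] * path_cumulant (\<mu> j) m_branch (a # us) + part g (a # us)"
proof -
  let ?t = "\<lambda>k. ncX * (ncconst (a * m_branch (take k us)) * centered (\<mu> j) (pth (drop k us)))"
  have step: "hip P g (lam_sum (map (act a) (map (append_vec j (center (pth (drop k us)))) (B.vec (take k us)))))
    = hip P g (map (append_vec j (center (pth (drop k us)))) (B.vec (a # take k us))) + final g (cl_poly (?t k))" for k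
  proof -
    have W: "set (map (act a) (B.vec (take k us))) \<subseteq> B.E"
      unfolding set_map using B.vec_in B.lact_E by blast
    have "root_coeff (map (act a) (B.vec (take k us))) = a * m_branch (take k us)"
    proof -
      have Om: "set [([], 1)] \<subseteq> B.E" by simp
      have "root_coeff (map (act a) (B.vec (take k us))) = hip B.P (hlact B.P (star a) [([], 1)]) (B.vec (take k us))"
        unfolding root_coeff_def using B.pre.ip_lact_right[of "[([], 1)]" "B.vec (take k us)" a] B.vec_in by (simp del: B.P_simps(6) P_simps)
      also have "hlact B.P (star a) [([], 1)] = hract B.P [([], 1)] (star a)" by simp
      also have "hip B.P \<dots> (B.vec (take k us)) = a * hip B.P [([], 1)] (B.vec (take k us))"
        using B.pre.ip_ract_left[of "[([], 1)]" "B.vec (take k us)" "star a"] B.vec_in by (simp add: star_star del: B.P_simps(6) P_simps)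
      finally show ?thesis by (simp add: B.moments_eq del: B.P_simps(6) P_simps)
    qed
    moreover have "map (act a) (map (append_vec j (center q)) W) = map (append_vec j (center q)) (map (act a) W)" for q W
      by (simp add: append_lact[OF center_in])
    ultimately show ?thesis by (simp only: lam_sum_append[OF W g] B.vec.simps)
  qed
  have "(\<Sum>k\<le>length us. final g (cl_poly (?t k))) = final g (cl_poly (pth (a # us)))"
    unfolding path.simps by (rule final_cls_sum[OF g, symmetric])
  also have "\<dots> = hip P g [([], 1)] * path_cumulant (\<mu> j) m_branch (a # us) + edge g (center (pth (a # us)))"
    by (simp only: final_cls path_cumulant_def)
  also have "edge g (center (pth (a # us))) = hip P g (map (append_vec j (center (pth (drop 0 (a # us))))) (B.vec (take 0 (a # us))))"
    using Hj.L2.lact_one[of "center (pth (a # us))"] by (simp add: edge_def append_vec_def)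
  finally have "(\<Sum>k\<le>length us. final g (cl_poly (?t k))) = hip P g [([], 1)] * path_cumulant (\<mu> j) m_branch (a # us) +
    hip P g (map (append_vec j (center (pth (drop 0 (a # us))))) (B.vec (take 0 (a # us))))" .
  then show ?thesis
    unfolding step part_def by (simp add: sum.distrib sum.atMost_Suc_shift del: sum.atMost_Suc P_simps path.simps B.vec.simps vec.simps)
qed

text \<open>The start of an excursion: X_j \<xi>_j has the cumulant of the empty list as its
  expectation, and its centered part is the only summand of \<open>part g []\<close>.\<close>

lemma part_Nil:
  assumes g: "set g \<subseteq> E"
  shows "hip P g (lam j (X j) [([], a)]) = (hip P g [([], 1)] * path_cumulant (\<mu> j) m_branch [] + part g []) * a"
proof -
  have "lam j (X j) [([], a)] = tens j (X j (L2_unit (\<mu> j))) ([], a)"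
    using j T_Nil by (simp add: lamb_def active_def head_def rest_def in_E_iff)
  also have "X j (L2_unit (\<mu> j)) = cl_poly (pth [])" by (simp add: L2_unit_def X_cls[OF j_letter])
  also have "tens j (cl_poly (pth [])) ([], a) = hract P (tens j (cl_poly (pth [])) ([], 1)) a"
    by (simp add: tens_def)
  finally have "hip P g (lam j (X j) [([], a)]) = final g (cl_poly (pth [])) * a"
    using pre.ip_ract_right[of g "tens j (cl_poly (pth [])) ([], 1)" a] g tens_in[of j "([], 1)" "cl_poly (pth [])"] j
    by (simp add: final_def base_def del: P_simps(6) path.simps)
  moreover have "edge g (center (pth [])) = part g []"
    using Hj.L2.lact_one[of "center (pth [])"] by (simp add: edge_def part_def append_vec_def)
  ultimately show ?thesis by (simp add: final_cls path_cumulant_def del: P_simps(6) path.simps)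
qed

lemma part_root: "part [([], 1)] us = 0"
proof -
  have "hip P [([], 1)] (map (append_vec j y) W) = 0" for y W
    by (induction W) (auto simp: append_vec_def etensor_ip_def word_ip_neq)
  then show ?thesis by (simp add: part_def del: P_simps(6))
qed

end

section \<open>Joining the branches at the root\<close>

context tree_laws
begin

definition root_letters where "root_letters = filter (\<lambda>j. [j] \<in> T) letters"

lemma root_letters: "j \<in> set root_letters \<Longrightarrow> tree_branch N T \<mu> j"
  by (simp add: root_letters_def tree_branch_def tree_branch_axioms_def tree_laws_axioms)

definition cumulant where
  "cumulant us = (\<Sum>j\<leftarrow>root_letters. path_cumulant (\<mu> j) (moments (tree_conv N (branch N T j) \<mu>)) us)"

text \<open>Pairing with the excursions that have left the root and not returned, summed over the
  branches in which they may be.\<close>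

definition away where "away g us = (\<Sum>j\<leftarrow>root_letters. tree_branch.part N T \<mu> j g us)"

lemma lam_sum_root:
  assumes g: "set g \<subseteq> E"
  shows "hip P g (lam_sum [([], a)]) = (hip P g [([], 1)] * cumulant [] + away g []) * a"
proof -
  have "hip P g (lam j (X j) [([], a)]) = 0" if "[j] \<notin> T" for j
    using that by (simp add: lamb_def active_def)
  then have "hip P g (lam_sum [([], a)]) = (\<Sum>j\<leftarrow>letters. if [j] \<in> T then hip P g (lam j (X j) [([], a)]) else 0)"
    unfolding lam_sum_def hip_concat by (intro sum_list_cong) auto
  also have "\<dots> = (\<Sum>j\<leftarrow>root_letters. hip P g (lam j (X j) [([], a)]))"
    by (simp only: root_letters_def sum_list_map_filter')
  also have "\<dots> = (\<Sum>j\<leftarrow>root_letters. (hip P g [([], 1)] *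
      path_cumulant (\<mu> j) (moments (tree_conv N (branch N T j) \<mu>)) [] + tree_branch.part N T \<mu> j g []) * a)"
    by (intro sum_list_cong tree_branch.part_Nil[OF root_letters g])
  finally show ?thesis
    by (simp add: cumulant_def away_def sum_list_mult_const sum_list_addf sum_list_const_mult del: P_simps)
qed

text \<open>Moving the operator and the coefficient to the left side replaces \<open>g\<close> by
  another vector; this is why \<open>hip_vec\<close> is stated for all \<open>g\<close>.\<close>

lemma hip_pull:
  assumes "set g \<subseteq> E" "set W \<subseteq> E"
  shows "hip P (map (etensor_lact (\<lambda>j. L2 (\<mu> j)) (star a)) (lam_sum g)) W =
    hip P g (lam_sum (map (etensor_lact (\<lambda>j. L2 (\<mu> j)) a) W))"
proof -
  have "hip P (hlact P (star a) (lam_sum g)) W = hip P (lam_sum g) (hlact P a W)"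
    using pre.ip_lact_right[of "lam_sum g" W a] assms lam_sum_in by (simp del: P_simps(4,6))
  also have "\<dots> = hip P g (lam_sum (hlact P a W))"
  proof (rule lam_sum_sym[OF assms(1)])
    show "set (hlact P a W) \<subseteq> E" unfolding P_simps set_map using assms(2) lact_E by blast
  qed
  finally show ?thesis by (simp del: P_simps(6))
qed

lemma pull_in: "set (map (etensor_lact (\<lambda>j. L2 (\<mu> j)) a) (lam_sum g)) \<subseteq> E"
  unfolding set_map using lam_sum_in lact_E by blast

lemma away_pull:
  assumes g: "set g \<subseteq> E"
  shows "away (map (etensor_lact (\<lambda>j. L2 (\<mu> j)) (star a)) (lam_sum g)) us =
    hip P g [([], 1)] * cumulant (a # us) + away g (a # us)"
proof -
  let ?g = "map (etensor_lact (\<lambda>j. L2 (\<mu> j)) (star a)) (lam_sum g)"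
  have "tree_branch.part N T \<mu> j ?g us = hip P g [([], 1)] *
      path_cumulant (\<mu> j) (moments (tree_conv N (branch N T j) \<mu>)) (a # us) + tree_branch.part N T \<mu> j g (a # us)"
    if "j \<in> set root_letters" for j
  proof -
    interpret tree_branch N T \<mu> j by (rule root_letters[OF that])
    have "set (map (append_vec j (center p)) (B.vec as)) \<subseteq> E" for p as
      unfolding set_map using append_in[OF center_in] B.vec_in by blast
    then have "part ?g us = (\<Sum>k\<le>length us. hip P g (lam_sum (map (act a)
        (map (append_vec j (center (pth (drop k us)))) (B.vec (take k us))))))"
      unfolding part_def by (intro sum.cong refl hip_pull g)
    then show ?thesis using part_step[OF g, of a us] by (simp del: P_simps path.simps)
  qed
  then have "away ?g us = (\<Sum>j\<leftarrow>root_letters. hip P g [([], 1)] *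
      path_cumulant (\<mu> j) (moments (tree_conv N (branch N T j) \<mu>)) (a # us) + tree_branch.part N T \<mu> j g (a # us))"
    unfolding away_def by (intro sum_list_cong)
  then show ?thesis
    by (simp add: cumulant_def away_def sum_list_addf sum_list_const_mult del: P_simps path.simps)
qed

abbreviation m where "m \<equiv> moments (tree_conv N T \<mu>)"

text \<open>The right-hand side of the recursion for the moments under its own name:
  \<open>hip_vec\<close> produces it as the coefficient of the root, and its instance at the root
  identifies it with the moment.\<close>

primrec first_return :: "'b list \<Rightarrow> 'b" where
  "first_return [] = 1"
| "first_return (a # as) = cumulant [] * a * m as +
    (\<Sum>k<length as. cumulant (a # take k as) * as ! k * m (drop (Suc k) as))"

lemma away_root: "away [([], 1)] us = 0"
proof -
  have "tree_branch.part N T \<mu> j [([], 1)] us = 0" if "j \<in> set root_letters" for j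
  proof -
    interpret tree_branch N T \<mu> j by (rule root_letters[OF that])
    show ?thesis by (rule part_root)
  qed
  then have "away [([], 1)] us = (\<Sum>j\<leftarrow>root_letters. 0)" unfolding away_def by (rule sum_list_cong)
  then show ?thesis by simp
qed

text \<open>The first term belongs to paths that end at the root. The others are split by the last
  visit to the root, in the order in which the operators act: up to it they contribute the moment of
  the remaining list, after it an excursion that is paired with \<open>g\<close>.\<close>

lemma hip_vec:
  assumes "set g \<subseteq> E"
  shows "hip P g (vec as) = hip P g [([], 1)] * first_return as +
    (\<Sum>k<length as. away g (take k as) * as ! k * m (drop (Suc k) as))"
  using assms
proof (induction as arbitrary: g)
  case Nil
  then show ?case by (simp del: P_simps)
next
  case (Cons a as)
  let ?g = "map (etensor_lact (\<lambda>j. L2 (\<mu> j)) (star a)) (lam_sum g)"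
  have "hip P [([], 1)] (vec as) = first_return as"
    using Cons.IH[of "[([], 1)]"] by (simp add: away_root etensor_ip_def star_one)
  \<comment> \<open>The induction hypothesis at the root itself, where excursions contribute
    nothing.\<close>
  then have fr: "first_return as = m as" by (simp add: moments_eq del: P_simps)
  have root: "hip P ?g [([], 1)] = (hip P g [([], 1)] * cumulant [] + away g []) * a"
    using hip_pull[OF Cons.prems, of "[([], 1)]" a] lam_sum_root[OF Cons.prems, of a] by (simp del: P_simps)
  have "hip P g (vec (a # as)) = hip P ?g (vec as)"
    using hip_pull[OF Cons.prems vec_in] by (simp del: P_simps)
  also have "\<dots> = hip P ?g [([], 1)] * m as + (\<Sum>k<length as. away ?g (take k as) * as ! k * m (drop (Suc k) as))"
    unfolding Cons.IH[OF pull_in] fr ..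
  also have "\<dots> = hip P g [([], 1)] * first_return (a # as) + (away g [] * a * m as +
      (\<Sum>k<length as. away g (a # take k as) * as ! k * m (drop (Suc k) as)))"
    unfolding root away_pull[OF Cons.prems]
    by (simp add: ring_distribs sum.distrib sum_distrib_left mult.assoc del: P_simps)
  also have "away g [] * a * m as + (\<Sum>k<length as. away g (a # take k as) * as ! k * m (drop (Suc k) as)) =
      (\<Sum>k<length (a # as). away g (take k (a # as)) * (a # as) ! k * m (drop (Suc k) (a # as)))"
    by (simp add: sum.lessThan_Suc_shift del: sum.lessThan_Suc P_simps)
  finally show ?case .
qed

theorem cumulants_tree_conv: "cumulants m cumulant"
proof -
  have fr: "m as = first_return as" for as
    using hip_vec[of "[([], 1)]" as] by (simp add: moments_eq away_root etensor_ip_def star_one)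
  show ?thesis
    unfolding cumulants_def
  proof (intro conjI allI impI)
    show "m [] = 1" by (simp add: fr)
    show "m as = (\<Sum>k<length as. cumulant (take k as) * as ! k * m (drop (Suc k) as))" if "as \<noteq> []" for as
    proof (cases as)
      case (Cons a as')
      have "m (a # as') = first_return (a # as')" by (rule fr)
      then show ?thesis by (simp add: Cons sum.lessThan_Suc_shift del: sum.lessThan_Suc)
    qed (use that in simp)
  qed
qed

end

section \<open>The trivial, Boolean and orthogonal trees\<close>

lemma cumulants_cong: "cumulants m \<beta> \<Longrightarrow> (\<And>us. \<beta> us = \<beta>' us) \<Longrightarrow> cumulants m \<beta>'"
  by (metis ext)

lemma moments_trivial_tree:
  assumes "\<And>j. j \<in> {1..N} \<Longrightarrow> quasi_law (\<mu> j)"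
  shows "moments (tree_conv N {[]} \<mu>) = zero_moments"
proof
  interpret tree_laws N "{[]}" \<mu>
    by unfold_locales (use assms in \<open>auto simp: subtree_def free_strings_def\<close>)
  have "cumulants m (\<lambda>us. 0)"
    by (rule cumulants_cong[OF cumulants_tree_conv]) (simp add: cumulant_def root_letters_def)
  then show "m as = zero_moments as" for as
    unfolding cumulants_def zero_moments_def by (cases "as = []") auto
qed

text \<open>All branches are trivial, so F is evaluated at the moments of \<delta>_0 and gives the
  Boolean cumulants of the single laws.\<close>

lemma cumulants_boolean_conv:
  assumes "\<And>\<nu>. \<nu> \<in> set \<nu>s \<Longrightarrow> quasi_law \<nu>"
  shows "cumulants (moments (boolean_conv \<nu>s)) (\<lambda>us. \<Sum>\<nu>\<leftarrow>\<nu>s. path_cumulant \<nu> zero_moments us)"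
    and "quasi_law (boolean_conv \<nu>s)"
proof -
  define n where "n = length \<nu>s"
  define T where "T = insert [] {[i] | i. i \<in> {1..n}}"
  define \<mu> where "\<mu> i = \<nu>s ! (i - 1)" for i
  have q: "quasi_law (\<mu> i)" if "i \<in> {1..n}" for i
    unfolding \<mu>_def using that by (intro assms nth_mem) (auto simp: n_def)
  interpret tree_laws n T \<mu>
    by unfold_locales (use q in \<open>auto simp: subtree_def free_strings_def T_def\<close>)
  have eq: "boolean_conv \<nu>s = tree_conv n T \<mu>"
    unfolding boolean_conv_def T_def n_def \<mu>_def[abs_def] ..
  show "quasi_law (boolean_conv \<nu>s)" unfolding eq by (rule quasi_law_tree_conv)
  have rl: "root_letters = letters"
    unfolding root_letters_def by (rule filter_True) (auto simp: T_def)
  have "branch n T i = {[]}" if "i \<in> {1..n}" for i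
    using that by (auto simp: branch_def T_def free_strings_def)
  then have "cumulant us = (\<Sum>i\<leftarrow>letters. path_cumulant (\<mu> i) zero_moments us)" for us
    unfolding cumulant_def rl using moments_trivial_tree[of n \<mu>] q
    by (intro arg_cong[where f = sum_list] map_cong refl) auto
  also have "(\<Sum>i\<leftarrow>letters. path_cumulant (\<mu> i) zero_moments us) = (\<Sum>\<nu>\<leftarrow>\<nu>s. path_cumulant \<nu> zero_moments us)" for us
  proof -
    have "map \<mu> letters = \<nu>s"
      by (intro nth_equalityI) (auto simp: n_def \<mu>_def simp del: upt_Suc)
    then have "map (\<lambda>i. path_cumulant (\<mu> i) zero_moments us) letters = map (\<lambda>\<nu>. path_cumulant \<nu> zero_moments us) \<nu>s"
      using map_map[of "\<lambda>\<nu>. path_cumulant \<nu> zero_moments us" \<mu> letters] by (simp add: comp_def)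
    then show ?thesis by simp
  qed
  finally show "cumulants (moments (boolean_conv \<nu>s)) (\<lambda>us. \<Sum>\<nu>\<leftarrow>\<nu>s. path_cumulant \<nu> zero_moments us)"
    unfolding eq by (rule cumulants_cong[OF cumulants_tree_conv])
qed

text \<open>The only neighbour of the root is 1, and its branch has the vertices [] and [2]. The
  convolution over that branch has the cumulants, hence the moments, of \<nu>.\<close>

lemma cumulants_orthogonal_conv:
  assumes "quasi_law \<mu>" "quasi_law \<nu>"
  shows "cumulants (moments (orthogonal_conv \<mu> \<nu>)) (path_cumulant \<mu> (moments \<nu>))"
    and "quasi_law (orthogonal_conv \<mu> \<nu>)"
proof -
  define \<sigma> where "\<sigma> i = (if i = 1 then \<mu> else \<nu>)" for i :: nat
  have q: "quasi_law (\<sigma> i)" for i using assms by (simp add: \<sigma>_def)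
  have upt: "[1..<Suc 2] = [1, 2]" by (simp add: numeral_2_eq_2)
  interpret O: tree_laws 2 "{[], [1], [2, 1]}" \<sigma>
    by unfold_locales (use q in \<open>auto simp: subtree_def free_strings_def\<close>)
  interpret B: tree_laws 2 "{[], [2]}" \<sigma>
    by unfold_locales (use q in \<open>auto simp: subtree_def free_strings_def\<close>)
  have eq: "orthogonal_conv \<mu> \<nu> = tree_conv 2 {[], [1], [2, 1]} \<sigma>"
    by (simp add: orthogonal_conv_def \<sigma>_def[abs_def])
  show "quasi_law (orthogonal_conv \<mu> \<nu>)" unfolding eq by (rule O.quasi_law_tree_conv)
  have bO: "branch 2 {[], [1], [2, 1]} 1 = {[], [2]}"
    by (auto simp: branch_def free_strings_def append_eq_Cons_conv)
  have bB: "branch 2 {[], [2]} 2 = {[]}"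
    by (auto simp: branch_def free_strings_def append_eq_Cons_conv)
  have "B.cumulant us = path_cumulant \<nu> zero_moments us" for us
    unfolding B.cumulant_def B.root_letters_def upt
    using moments_trivial_tree[of 2 \<sigma>] q by (simp add: bB \<sigma>_def)
  then have "cumulants B.m (path_cumulant \<nu> zero_moments)"
    by (rule cumulants_cong[OF B.cumulants_tree_conv])
  moreover have "cumulants (moments \<nu>) (path_cumulant \<nu> zero_moments)"
    by (rule quasi.cumulants_law[OF quasi.intro[OF assms(2)]])
  ultimately have "B.m = moments \<nu>" using cumulants_moments_unique by blast
  then have "O.cumulant us = path_cumulant \<mu> (moments \<nu>) us" for us
    unfolding O.cumulant_def O.root_letters_def upt
    by (simp add: bO[simplified] \<sigma>_def)
  then show "cumulants (moments (orthogonal_conv \<mu> \<nu>)) (path_cumulant \<mu> (moments \<nu>))"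
    unfolding eq by (rule cumulants_cong[OF O.cumulants_tree_conv])
qed

theorem proposition6p8:
  fixes N :: nat
    and T :: "nat list set"
    and \<mu> :: "nat \<Rightarrow> 'b::cstar_algebra law"
  assumes "T \<in> Tree N"
    and "\<And>j. j \<in> {1..N} \<Longrightarrow> is_law (\<mu> j)"
  shows "tree_conv N T \<mu> =
    boolean_conv
      (map (\<lambda>j. orthogonal_conv (\<mu> j) (tree_conv N (branch N T j) \<mu>))
        (filter (\<lambda>j. [j] \<in> T) [1..<Suc N]))"
proof -
  interpret tree_laws N T \<mu>
    by unfold_locales (use assms is_law_quasi_law Tree_subtree in auto)
  define \<rho> where "\<rho> j = orthogonal_conv (\<mu> j) (tree_conv N (branch N T j) \<mu>)" for j
  have q: "quasi_law (\<rho> j)" and c: "path_cumulant (\<rho> j) zero_moments us =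
      path_cumulant (\<mu> j) (moments (tree_conv N (branch N T j) \<mu>)) us" if "j \<in> set root_letters" for j us
  proof -
    interpret tree_branch N T \<mu> j by (rule root_letters[OF that])
    note o = cumulants_orthogonal_conv[OF Hj.quasi_law B.quasi_law_tree_conv]
    show "quasi_law (\<rho> j)" unfolding \<rho>_def by (rule o(2))
    show "path_cumulant (\<rho> j) zero_moments us =
      path_cumulant (\<mu> j) (moments (tree_conv N (branch N T j) \<mu>)) us"
      \<comment> \<open>Both are cumulants of the same moments: the left side since F at \<delta>_0
        gives the Boolean cumulants of any single law, the right side by the formula for the
        orthogonal tree.\<close>
      unfolding \<rho>_def by (rule cumulants_unique[OF quasi.cumulants_law[OF quasi.intro[OF o(2)]] o(1)])
  qed
  have qb: "\<nu> \<in> set (map \<rho> root_letters) \<Longrightarrow> quasi_law \<nu>" for \<nu> using q by auto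
  note bool = cumulants_boolean_conv[of "map \<rho> root_letters", OF qb]
  have "(\<Sum>\<nu>\<leftarrow>map \<rho> root_letters. path_cumulant \<nu> zero_moments us) = cumulant us" for us
    unfolding cumulant_def map_map comp_def using c by (intro sum_list_cong)
  then have "cumulants (moments (boolean_conv (map \<rho> root_letters))) cumulant"
    using cumulants_cong[OF bool(1)] by simp
  then have "m = moments (boolean_conv (map \<rho> root_letters))"
    using cumulants_moments_unique[OF cumulants_tree_conv] by blast
  then have "tree_conv N T \<mu> = boolean_conv (map \<rho> root_letters)"
    using quasi_law_tree_conv bool(2) by (intro law_eq_moments) (auto simp: quasi_law_def)
  then show ?thesis by (simp only: \<rho>_def[abs_def] root_letters_def)
qed

end
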